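(* Let $n,p\ge1$. Let the group $\prod_{j=1}^p \mathrm{S}_n$ act on $\bigoplus_{j=1}^p\mathbb{R}^n=\mathbb{R}^{pn}$, the $j$-th factor permuting the coordinates of the $j$-th summand. Let $\sigma=(\sigma_1,\ldots,\sigma_n):\mathbb{R}^n\to\mathbb{R}^n$ where $\sigma_i(x)=\sum_{1\le j_1<\cdots<j_i\le n}x_{j_1}\cdots x_{j_i}$, and let $\theta:\mathbb{R}^{pn}\to\mathbb{R}^{pn}$, $\theta(x^1,\ldots,x^p)=(\sigma(x^1),\ldots,\sigma(x^p))$. Let $M=(M_k)$ and $N=(N_k)$ be increasing (i.e. $M_{k+1}\ge M_k$, $N_{k+1}\ge N_k$) logarithmically convex sequences of positive reals with $M_0=N_0=1$. Then the following are equivalent: (i) for every $\prod_{j=1}^p\mathrm{S}_n$-invariant $f\in C^M(\mathbb{R}^{pn})$ there exists $F\in C^N(\theta(\mathbb{R}^{pn}))$ with $f=F\circ\theta$; (ii) $\sup_{k\in\mathbb{N}_{>0}}\big(M_{kn}/N_k\big)^{1/k}<\infty$.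
   Context: A sequence $(M_k)$ of positive reals is logarithmically convex if $M_k^2\le M_{k-1}M_{k+1}$ for all $k\ge1$. For $U\subseteq\mathbb{R}^q$ open, $C^M(U)$ is the set of $f\in C^\infty(U)$ such that for each compact $K\subseteq U$ there are $C,\varrho>0$ with $|\partial^\alpha f(x)|\le C\varrho^{|\alpha|}|\alpha|!\,M_{|\alpha|}$ for all $\alpha$ and $x\in K$. For the closed set $A=\theta(\mathbb{R}^{pn})$ (which is the closure of its interior), $C^N(A)$ denotes the set of functions $F:A\to\mathbb{R}$ which are $C^\infty$ in the interior of $A$, all of whose partial derivatives extend continuously to $A$, and such that for each compact $K\subseteq A$ there are $C,\varrho>0$ with $|\partial^\alpha F(y)|\le C\varrho^{|\alpha|}|\alpha|!\,N_{|\alpha|}$ for all $\alpha$ and $y\in K$. *)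

theory Defs
  imports "HOL-Analysis.Analysis"
begin

definition pd :: "'a::euclidean_space \<Rightarrow> ('a \<Rightarrow> real) \<Rightarrow> 'a \<Rightarrow> real" where
  "pd b f x = deriv (\<lambda>t. f (x + t *\<^sub>R b)) 0"

fun pds :: "'a::euclidean_space list \<Rightarrow> ('a \<Rightarrow> real) \<Rightarrow> 'a \<Rightarrow> real" where
  "pds [] f = f"
| "pds (b # bs) f = pd b (pds bs f)"

definition smooth_on :: "'a::euclidean_space set \<Rightarrow> ('a \<Rightarrow> real) \<Rightarrow> bool" where
  "smooth_on U f \<longleftrightarrow>
     (\<forall>bs \<in> lists Basis. continuous_on U (pds bs f) \<and>
        (\<forall>b\<in>Basis. \<forall>x\<in>U. (\<lambda>t. pds bs f (x + t *\<^sub>R b)) differentiable (at 0)))"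

definition log_convex :: "(nat \<Rightarrow> real) \<Rightarrow> bool" where
  "log_convex M \<longleftrightarrow> (\<forall>k\<ge>1. (M k)\<^sup>2 \<le> M (k - 1) * M (k + 1))"

definition CM_on :: "(nat \<Rightarrow> real) \<Rightarrow> 'a::euclidean_space set \<Rightarrow> ('a \<Rightarrow> real) \<Rightarrow> bool" where
  "CM_on M U f \<longleftrightarrow> smooth_on U f \<and>
     (\<forall>K. compact K \<and> K \<subseteq> U \<longrightarrow>
        (\<exists>C>0. \<exists>\<rho>>0. \<forall>bs \<in> lists Basis. \<forall>x\<in>K.
           \<bar>pds bs f x\<bar> \<le> C * \<rho> ^ length bs * fact (length bs) * M (length bs)))"

(* C^N(A), A closed with A = closure of its interior: smooth in the interior,
   all partial derivatives extend continuously to A (extensions G bs), bounds on compacts *)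
definition CN_closed :: "(nat \<Rightarrow> real) \<Rightarrow> 'a::euclidean_space set \<Rightarrow> ('a \<Rightarrow> real) \<Rightarrow> bool" where
  "CN_closed N A F \<longleftrightarrow> smooth_on (interior A) F \<and>
     (\<exists>G :: 'a list \<Rightarrow> 'a \<Rightarrow> real.
        (\<forall>bs \<in> lists Basis. continuous_on A (G bs) \<and> (\<forall>y\<in>interior A. G bs y = pds bs F y)) \<and>
        (\<forall>K. compact K \<and> K \<subseteq> A \<longrightarrow>
           (\<exists>C>0. \<exists>\<rho>>0. \<forall>bs \<in> lists Basis. \<forall>y\<in>K.
              \<bar>G bs y\<bar> \<le> C * \<rho> ^ length bs * fact (length bs) * N (length bs))))"

definition esym :: "nat \<Rightarrow> real ^ 'n \<Rightarrow> real" where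
  "esym k x = (\<Sum>S \<in> {S. card S = k}. \<Prod>i\<in>S. x $ i)"

(* sigma = (sigma_1,...,sigma_n); the i-th coordinate (in the order of 'n) has degree
   card {j. j \<le> i} \<in> {1..n} *)
definition sigma :: "real ^ 'n::{finite,linorder} \<Rightarrow> real ^ 'n::{finite,linorder}" where
  "sigma x = (\<chi> i. esym (card {j. j \<le> i}) x)"

definition theta :: "real ^ 'n::{finite,linorder} ^ 'p::finite \<Rightarrow> real ^ 'n::{finite,linorder} ^ 'p::finite" where
  "theta x = (\<chi> j. sigma (x $ j))"

definition prod_sym_invariant :: "(real ^ 'n ^ 'p \<Rightarrow> real) \<Rightarrow> bool" where
  "prod_sym_invariant f \<longleftrightarrow>
     (\<forall>\<pi> :: 'p \<Rightarrow> 'n \<Rightarrow> 'n. (\<forall>j. \<pi> j permutes UNIV) \<longrightarrow>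
        (\<forall>x. f (\<chi> j. \<chi> i. x $ j $ (\<pi> j i)) = f x))"

end

theory Submission
  imports Defs "HOL-Combinatorics.Permutations" "HOL-Computational_Algebra.Polynomial"
begin

text \<open>
  Fix the polynomials with roots \<open>x\<^sup>j\<close>. By Newton interpolation an invariant \<open>f\<close> is a signed sum, over the
  tuples of permutations, of divided differences at the roots applied in each variable to \<open>f\<close> times
  complementary partial node polynomials of an auxiliary point \<open>y\<close>. Divided differences are division remainders,
  so they depend on the roots only through the coefficients of the polynomial, and the resolvent identity for
  division differentiates them in these coefficients: each derivative inserts one more division by the node
  polynomial, that is \<open>n\<close> more derivatives of \<open>f\<close>. After differentiation one puts \<open>y = x\<close>; the Newton factors
  then cancel nodes, and a derivative of order \<open>k\<close> of \<open>F\<close> costs exactly \<open>kn\<close> derivatives of \<open>f\<close>, up to constants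
  \<open>C \<rho>\<^sup>k k!\<close>.

  For the converse let \<open>h\<close> be a function of class \<open>C\<^sup>M\<close> on the line whose derivatives at \<open>0\<close> all have maximal
  size, and extend \<open>\<Sum>\<^sub>i h (x\<^sub>i)\<close>. Moving only the last elementary symmetric function of \<open>\<epsilon> w\<close>, a \<open>k\<close>-th finite
  difference of \<open>F\<close> isolates the derivative of \<open>h\<close> of order \<open>kn\<close> as \<open>\<epsilon>\<close> tends to \<open>0\<close>.
\<close>

section \<open>Families of smooth functions\<close>

text \<open>Nothing bounds \<open>M (k + 1)\<close> by \<open>C * \<rho> ^ k * M k\<close>, so
  losing even a fixed number of derivatives on top of \<open>k * n\<close> would spoil the estimate
  by \<open>M (k * n)\<close>. Divided differences at \<open>n\<close> nodes in each of the
  \<open>n\<close> variables of a block lose \<open>n * (n - 1)\<close> derivatives before anything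
  is differentiated. The Newton factors of a block have total degree exactly
  \<open>n * (n - 1)\<close> and win these back, but only when their zeros are the nodes themselves.
  If the zeros moved along with the nodes, they would have to be differentiated too. Hence the
  auxiliary point: the formula holds for every \<open>y\<close>, is differentiated with
  \<open>y\<close> frozen, and \<open>y = x\<close> is inserted last. Working with quotients and
  remainders instead of root differences also keeps every formula meaningful and continuous where
  roots collide, which yields the extension of all derivatives to the boundary of the image.\<close>

abbreviation smooth :: "('a::euclidean_space \<Rightarrow> real) \<Rightarrow> bool" where
  "smooth u \<equiv> smooth_on UNIV u"

text \<open>In the applications the parameter \<open>p\<close> moves the nodes of divided
  differences. Continuity of every derivative jointly in \<open>(p, z)\<close> is what allows limits
  at moving nodes.\<close>

definition smooth_fam :: "'p::topological_space set \<Rightarrow> ('p \<Rightarrow> 'a::euclidean_space \<Rightarrow> real) \<Rightarrow> bool" where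
  "smooth_fam S u \<longleftrightarrow> (\<forall>p\<in>S. smooth (u p)) \<and>
     (\<forall>bs\<in>lists Basis. continuous_on (S \<times> UNIV) (\<lambda>(p, z). pds bs (u p) z))"

lemma smooth_deriv:
  assumes "smooth u" "bs \<in> lists Basis" "b \<in> Basis"
  shows "((\<lambda>t. pds bs u (x + t *\<^sub>R b)) has_real_derivative pds (b # bs) u (x + s *\<^sub>R b)) (at s)"
proof -
  have "(\<lambda>t. pds bs u ((x + s *\<^sub>R b) + t *\<^sub>R b)) differentiable (at 0)"
    using assms by (auto simp: smooth_on_def)
  then have "((\<lambda>t. pds bs u ((x + s *\<^sub>R b) + t *\<^sub>R b)) has_real_derivative
      pds (b # bs) u (x + s *\<^sub>R b)) (at 0)"
    by (auto simp: pd_def DERIV_deriv_iff_real_differentiable)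
  then have "((\<lambda>t. pds bs u ((x + s *\<^sub>R b) + (t - s) *\<^sub>R b)) has_real_derivative
      pds (b # bs) u (x + s *\<^sub>R b)) (at (0 + s))"
    by (subst DERIV_shift) simp
  then show ?thesis by (simp add: algebra_simps)
qed

lemma smooth_deriv_scaled:
  assumes "smooth u" "bs \<in> lists Basis" "b \<in> Basis"
  shows "((\<lambda>s. pds bs u (x + (k * s) *\<^sub>R b)) has_real_derivative k * pds (b # bs) u (x + (k * s) *\<^sub>R b)) (at s)"
  using DERIV_chain2[OF smooth_deriv[OF assms, of x "k * s"] DERIV_cmult_Id[of k s UNIV]]
  by (simp add: mult.commute)

lemma smooth_continuous:
  assumes "smooth u" "bs \<in> lists Basis"
  shows "continuous_on S (pds bs u)"
  using assms by (auto simp: smooth_on_def intro: continuous_on_subset)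

lemma smooth_continuous_on: "smooth u \<Longrightarrow> continuous_on S u"
  using smooth_continuous[of u "[]"] by simp

lemma pds_eqI:
  assumes "\<And>z. D [] z = u z"
    and "\<And>bs b z. bs \<in> lists Basis \<Longrightarrow> b \<in> Basis \<Longrightarrow>
      ((\<lambda>t. D bs (z + t *\<^sub>R b)) has_real_derivative D (b # bs) z) (at 0)"
    and "bs \<in> lists Basis"
  shows "pds bs u = D bs"
  using assms(3)
proof (induction bs)
  case Nil
  then show ?case using assms(1) by auto
next
  case (Cons b bs)
  then have bs: "bs \<in> lists Basis" "b \<in> Basis" by auto
  show ?case
  proof
    fix z
    show "pds (b # bs) u z = D (b # bs) z"
      using Cons.IH DERIV_imp_deriv[OF assms(2)[OF bs, of z]] by (simp add: pd_def)
  qed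
qed

text \<open>The closure properties below go through this rule: an explicit table \<open>D\<close> of
  all iterated derivatives is proposed, and only one differentiation step and joint continuity have
  to be checked.\<close>

lemma smooth_famI:
  fixes u :: "'p::topological_space \<Rightarrow> 'a::euclidean_space \<Rightarrow> real"
  assumes D0: "\<And>p z. p \<in> S \<Longrightarrow> D p [] z = u p z"
    and D1: "\<And>p bs b z. p \<in> S \<Longrightarrow> bs \<in> lists Basis \<Longrightarrow> b \<in> Basis \<Longrightarrow>
      ((\<lambda>t. D p bs (z + t *\<^sub>R b)) has_real_derivative D p (b # bs) z) (at 0)"
    and D2: "\<And>bs. bs \<in> lists Basis \<Longrightarrow> continuous_on (S \<times> UNIV) (\<lambda>(p, z). D p bs z)"
  shows "smooth_fam S u" and "\<And>p bs. p \<in> S \<Longrightarrow> bs \<in> lists Basis \<Longrightarrow> pds bs (u p) = D p bs"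
proof -
  show eq: "pds bs (u p) = D p bs" if "p \<in> S" "bs \<in> lists Basis" for p bs
    by (rule pds_eqI) (use D0 D1 that in auto)
  have cont: "continuous_on UNIV (D p bs)" if "p \<in> S" "bs \<in> lists Basis" for p bs
  proof -
    have "continuous_on UNIV ((\<lambda>(p, z). D p bs z) \<circ> (\<lambda>z. (p, z)))"
      by (rule continuous_on_compose)
        (use that in \<open>auto intro!: continuous_intros continuous_on_subset[OF D2]\<close>)
    then show ?thesis by (simp add: o_def)
  qed
  have "smooth (u p)" if "p \<in> S" for p
    unfolding smooth_on_def
  proof (intro ballI conjI)
    fix bs b :: "'a list" and x assume bs: "bs \<in> lists Basis"
    show "continuous_on UNIV (pds bs (u p))" using eq[OF that bs] cont[OF that bs] by simp
  next
    fix bs :: "'a list" and b x :: 'a assume "bs \<in> lists Basis" "b \<in> Basis"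
    then show "(\<lambda>t. pds bs (u p) (x + t *\<^sub>R b)) differentiable at 0"
      using eq[OF that] D1[OF that, of bs b x] real_differentiable_def by metis
  qed
  moreover have "continuous_on (S \<times> UNIV) (\<lambda>(p, z). pds bs (u p) z)" if "bs \<in> lists Basis" for bs
    using D2[OF that] by (rule continuous_on_eq) (auto simp: eq that)
  ultimately show "smooth_fam S u" by (auto simp: smooth_fam_def)
qed

lemma smooth_fam_smooth: "smooth_fam S u \<Longrightarrow> p \<in> S \<Longrightarrow> smooth (u p)"
  by (auto simp: smooth_fam_def)

lemma smooth_fam_cont: "smooth_fam S u \<Longrightarrow> bs \<in> lists Basis \<Longrightarrow> continuous_on (S \<times> UNIV) (\<lambda>(p, z). pds bs (u p) z)"
  by (auto simp: smooth_fam_def)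

lemma smooth_fam_const:
  assumes "smooth u"
  shows "smooth_fam S (\<lambda>_. u)"
proof (rule smooth_famI[where D = "\<lambda>_ bs. pds bs u"])
  fix bs :: "'a list" assume bs: "bs \<in> lists Basis"
  have "continuous_on (S \<times> UNIV) (pds bs u \<circ> snd)"
    by (intro continuous_on_compose smooth_continuous[OF assms bs] continuous_intros)
  then show "continuous_on (S \<times> UNIV) (\<lambda>(p, z). pds bs u z)"
    by (simp add: o_def case_prod_unfold)
qed (use smooth_deriv[OF assms, of _ _ _ 0] in auto)

lemma smooth_iff_fam: "smooth u \<longleftrightarrow> smooth_fam (UNIV :: real set) (\<lambda>_. u)"
  using smooth_fam_const smooth_fam_smooth by blast

lemma smooth_fam_compose:
  assumes "smooth_fam S u" "bs \<in> lists Basis" "continuous_on T g" "continuous_on T h"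
    "\<And>x. x \<in> T \<Longrightarrow> g x \<in> S"
  shows "continuous_on T (\<lambda>x. pds bs (u (g x)) (h x))"
proof -
  have "continuous_on T ((\<lambda>(p, z). pds bs (u p) z) \<circ> (\<lambda>x. (g x, h x)))"
    by (rule continuous_on_compose)
      (use assms in \<open>auto intro!: continuous_intros intro: continuous_on_subset[OF smooth_fam_cont[OF assms(1,2)]]\<close>)
  then show ?thesis by (simp add: o_def)
qed

lemma smooth_fam_compose0:
  assumes "smooth_fam S u" "continuous_on T g" "continuous_on T h" "\<And>x. x \<in> T \<Longrightarrow> g x \<in> S"
  shows "continuous_on T (\<lambda>x. u (g x) (h x))"
  using smooth_fam_compose[OF assms(1) _ assms(2-4), of "[]"] by simp

lemma smooth_fam_add:
  assumes "smooth_fam S u" "smooth_fam S v"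
  shows "smooth_fam S (\<lambda>p z. u p z + v p z)"
    and "\<And>p bs. p \<in> S \<Longrightarrow> bs \<in> lists Basis \<Longrightarrow> pds bs (\<lambda>z. u p z + v p z) = (\<lambda>z. pds bs (u p) z + pds bs (v p) z)"
proof -
  let ?D = "\<lambda>p bs z. pds bs (u p) z + pds bs (v p) z"
  have 1: "?D p [] z = u p z + v p z" for p z by simp
  have 2: "((\<lambda>t. ?D p bs (z + t *\<^sub>R b)) has_real_derivative ?D p (b # bs) z) (at 0)"
    if "p \<in> S" "bs \<in> lists Basis" "b \<in> Basis" for p bs b z
    using DERIV_add[OF smooth_deriv[OF smooth_fam_smooth[OF assms(1) that(1)] that(2,3), of z 0]
      smooth_deriv[OF smooth_fam_smooth[OF assms(2) that(1)] that(2,3), of z 0]] by simp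
  have 3: "continuous_on (S \<times> UNIV) (\<lambda>(p, z). ?D p bs z)" if "bs \<in> lists Basis" for bs
    using continuous_on_add[OF smooth_fam_cont[OF assms(1) that] smooth_fam_cont[OF assms(2) that]]
    by (simp add: case_prod_unfold)
  note R = smooth_famI[where D = ?D and S = S and u = "\<lambda>p z. u p z + v p z"]
  show "smooth_fam S (\<lambda>p z. u p z + v p z)" by (rule R(1)) (use 1 2 3 in auto)
  show "pds bs (\<lambda>z. u p z + v p z) = ?D p bs" if "p \<in> S" "bs \<in> lists Basis" for p bs
    by (rule R(2)) (use 1 2 3 that in auto)
qed

lemma smooth_fam_cmult:
  assumes "smooth_fam S u" "continuous_on S k"
  shows "smooth_fam S (\<lambda>p z. k p * u p z)"
    and "\<And>p bs. p \<in> S \<Longrightarrow> bs \<in> lists Basis \<Longrightarrow> pds bs (\<lambda>z. k p * u p z) = (\<lambda>z. k p * pds bs (u p) z)"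
proof -
  let ?D = "\<lambda>p bs z. k p * pds bs (u p) z"
  have 1: "?D p [] z = k p * u p z" for p z by simp
  have 2: "((\<lambda>t. ?D p bs (z + t *\<^sub>R b)) has_real_derivative ?D p (b # bs) z) (at 0)"
    if "p \<in> S" "bs \<in> lists Basis" "b \<in> Basis" for p bs b z
    using DERIV_cmult[OF smooth_deriv[OF smooth_fam_smooth[OF assms(1) that(1)] that(2,3), of z 0]] by simp
  have 3: "continuous_on (S \<times> UNIV) (\<lambda>(p, z). ?D p bs z)" if "bs \<in> lists Basis" for bs
    unfolding case_prod_unfold
    by (intro continuous_intros smooth_fam_cont[OF assms(1) that, unfolded case_prod_unfold]
        continuous_on_compose2[OF assms(2)]) auto
  note R = smooth_famI[where D = ?D and S = S and u = "\<lambda>p z. k p * u p z"]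
  show "smooth_fam S (\<lambda>p z. k p * u p z)" by (rule R(1)) (use 1 2 3 in auto)
  show "pds bs (\<lambda>z. k p * u p z) = ?D p bs" if "p \<in> S" "bs \<in> lists Basis" for p bs
    by (rule R(2)) (use 1 2 3 that in auto)
qed

text \<open>Leibniz rule for a coordinate factor: \<open>z \<bullet> c\<close> is linear, so at most
  one derivative falls on it, and each entry of the result uses up one occurrence of
  \<open>c\<close>.\<close>

fun removals :: "'b \<Rightarrow> 'b list \<Rightarrow> 'b list list" where
  "removals c [] = []"
| "removals c (b # bs) = (if b = c then [bs] else []) @ map ((#) b) (removals c bs)"

lemma removals_lists: "bs \<in> lists B \<Longrightarrow> l \<in> set (removals c bs) \<Longrightarrow> l \<in> lists B"
  by (induction bs arbitrary: l) (fastforce split: if_splits)+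

lemma DERIV_sum_list:
  assumes "\<And>l. l \<in> set ls \<Longrightarrow> (f l has_real_derivative f' l) (at x)"
  shows "((\<lambda>t. \<Sum>l\<leftarrow>ls. f l t) has_real_derivative (\<Sum>l\<leftarrow>ls. f' l)) (at x)"
  using assms by (induction ls) (auto intro!: DERIV_add)

lemma continuous_on_sum_list:
  fixes f :: "'b \<Rightarrow> 'c::topological_space \<Rightarrow> real"
  assumes "\<And>l. l \<in> set ls \<Longrightarrow> continuous_on S (f l)"
  shows "continuous_on S (\<lambda>t. \<Sum>l\<leftarrow>ls. f l t)"
  using assms by (induction ls) (auto intro!: continuous_intros)

lemma smooth_fam_coord:
  fixes u :: "'p::topological_space \<Rightarrow> 'a::euclidean_space \<Rightarrow> real"
  assumes "smooth_fam S u" "c \<in> Basis"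
  shows "smooth_fam S (\<lambda>p z. (z \<bullet> c) * u p z)"
    and "\<And>p bs. p \<in> S \<Longrightarrow> bs \<in> lists Basis \<Longrightarrow> pds bs (\<lambda>z. (z \<bullet> c) * u p z) =
       (\<lambda>z. (z \<bullet> c) * pds bs (u p) z + (\<Sum>l\<leftarrow>removals c bs. pds l (u p) z))"
proof -
  let ?D = "\<lambda>p bs z. (z \<bullet> c) * pds bs (u p) z + (\<Sum>l\<leftarrow>removals c bs. pds l (u p) z)"
  have 1: "?D p [] z = (z \<bullet> c) * u p z" for p z by simp
  have 2: "((\<lambda>t. ?D p bs (z + t *\<^sub>R b)) has_real_derivative ?D p (b # bs) z) (at 0)"
    if "p \<in> S" "bs \<in> lists Basis" "b \<in> Basis" for p bs b z
  proof -
    note sm = smooth_fam_smooth[OF assms(1) that(1)]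
    have a: "((\<lambda>t. (z + t *\<^sub>R b) \<bullet> c) has_real_derivative (b \<bullet> c)) (at 0)"
      by (auto simp: inner_add_left intro!: derivative_eq_intros)
    have b: "((\<lambda>t. \<Sum>l\<leftarrow>removals c bs. pds l (u p) (z + t *\<^sub>R b)) has_real_derivative
        (\<Sum>l\<leftarrow>removals c bs. pds (b # l) (u p) z)) (at 0)"
      by (rule DERIV_sum_list)
        (use smooth_deriv[OF sm removals_lists[OF that(2)] that(3), of _ _ z 0] in simp)
    have eq: "(\<Sum>l\<leftarrow>map ((#) b) (removals c bs). pds l (u p) z) = (\<Sum>l\<leftarrow>removals c bs. pds (b # l) (u p) z)"
      by (simp add: o_def)
    have bc: "b \<bullet> c = (if b = c then 1 else 0)"
      using that(3) assms(2) by (auto simp: inner_Basis)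
    show ?thesis
      using DERIV_add[OF DERIV_mult[OF a smooth_deriv[OF sm that(2,3), of z 0]] b]
      unfolding removals.simps map_append sum_list_append eq bc
      by (cases "b = c") (simp_all add: algebra_simps)
  qed
  have 3: "continuous_on (S \<times> UNIV) (\<lambda>(p, z). ?D p bs z)" if "bs \<in> lists Basis" for bs
    unfolding case_prod_unfold
    by (intro continuous_intros continuous_on_sum_list smooth_fam_cont[OF assms(1), unfolded case_prod_unfold] that
        removals_lists[OF that])
  note R = smooth_famI[where D = ?D and S = S and u = "\<lambda>p z. (z \<bullet> c) * u p z"]
  show "smooth_fam S (\<lambda>p z. (z \<bullet> c) * u p z)" by (rule R(1)) (use 1 2 3 in auto)
  show "pds bs (\<lambda>z. (z \<bullet> c) * u p z) = ?D p bs" if "p \<in> S" "bs \<in> lists Basis" for p bs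
    by (rule R(2)) (use 1 2 3 that in auto)
qed

definition upd :: "'a::euclidean_space \<Rightarrow> real \<Rightarrow> 'a \<Rightarrow> 'a" where
  "upd c a z = z + (a - z \<bullet> c) *\<^sub>R c"

definition ev :: "'a::euclidean_space \<Rightarrow> real \<Rightarrow> ('a \<Rightarrow> real) \<Rightarrow> 'a \<Rightarrow> real" where
  "ev c a u z = u (upd c a z)"

lemma upd_inner:
  assumes "c \<in> Basis" "b \<in> Basis"
  shows "upd c a z \<bullet> b = (if b = c then a else z \<bullet> b)"
  using assms by (auto simp: upd_def inner_add_left inner_Basis)

lemma upd_upd [simp]: "c \<in> Basis \<Longrightarrow> upd c a (upd c b z) = upd c a z"
  by (rule euclidean_eqI) (simp add: upd_inner)

lemma smooth_fam_ev:
  fixes u :: "'p::topological_space \<Rightarrow> 'a::euclidean_space \<Rightarrow> real"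
  assumes "smooth_fam S u" "c \<in> Basis" "continuous_on S a"
  shows "smooth_fam S (\<lambda>p. ev c (a p) (u p))"
    and "\<And>p bs. p \<in> S \<Longrightarrow> bs \<in> lists Basis \<Longrightarrow> pds bs (ev c (a p) (u p)) =
       (\<lambda>z. if c \<in> set bs then 0 else pds bs (u p) (upd c (a p) z))"
proof -
  let ?D = "\<lambda>p bs z. if c \<in> set bs then 0 else pds bs (u p) (upd c (a p) z)"
  have 1: "?D p [] z = ev c (a p) (u p) z" for p z by (simp add: ev_def)
  have 2: "((\<lambda>t. ?D p bs (z + t *\<^sub>R b)) has_real_derivative ?D p (b # bs) z) (at 0)"
    if "p \<in> S" "bs \<in> lists Basis" "b \<in> Basis" for p bs b z
  proof (cases "c \<in> set bs \<or> b = c")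
    case True
    have "upd c (a p) (z + t *\<^sub>R c) = upd c (a p) z" for t
      using assms(2) by (simp add: upd_def inner_add_left algebra_simps)
    with True show ?thesis by (cases "b = c"; cases "c \<in> set bs") auto
  next
    case False
    have "b \<bullet> c = 0" using False that(3) assms(2) by (auto simp: inner_Basis)
    then have "upd c (a p) (z + t *\<^sub>R b) = upd c (a p) z + t *\<^sub>R b" for t
      by (simp add: upd_def inner_add_left algebra_simps)
    then show ?thesis
      using smooth_deriv[OF smooth_fam_smooth[OF assms(1) that(1)] that(2,3), of "upd c (a p) z" 0] False by auto
  qed
  have 3: "continuous_on (S \<times> UNIV) (\<lambda>(p, z). ?D p bs z)" if bs: "bs \<in> lists Basis" for bs
  proof (cases "c \<in> set bs")
    case False
    have "continuous_on (S \<times> UNIV) (\<lambda>x. pds bs (u (fst x)) (upd c (a (fst x)) (snd x)))"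
      unfolding upd_def
      by (rule smooth_fam_compose[OF assms(1) bs])
         (auto intro!: continuous_intros continuous_on_compose2[OF assms(3)])
    with False show ?thesis by (simp add: case_prod_unfold)
  qed (simp add: case_prod_unfold)
  note R = smooth_famI[where D = ?D and S = S and u = "\<lambda>p. ev c (a p) (u p)"]
  show "smooth_fam S (\<lambda>p. ev c (a p) (u p))" by (rule R(1)) (use 1 2 3 in auto)
  show "pds bs (ev c (a p) (u p)) = ?D p bs" if "p \<in> S" "bs \<in> lists Basis" for p bs
    by (rule R(2)) (use 1 2 3 that in auto)
qed

text \<open>Hadamard's form of \<open>(u z - u (upd c a z)) / (z \<bullet> c - a)\<close>: the mean
  of the derivative over the segment stays smooth when the two points collide. The segment runs from
  the node at \<open>t = 0\<close> to \<open>z\<close> at \<open>t = 1\<close>.\<close>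

definition dquot :: "'a::euclidean_space \<Rightarrow> real \<Rightarrow> ('a \<Rightarrow> real) \<Rightarrow> 'a \<Rightarrow> real" where
  "dquot c a u z = integral {0..1} (\<lambda>t. pd c u (z + ((1 - t) * (a - z \<bullet> c)) *\<^sub>R c))"

text \<open>The \<open>c\<close>-coordinate on the segment is
  \<open>t * (z \<bullet> c) + (1 - t) * a\<close>, so every derivative in direction
  \<open>c\<close> brings out one factor \<open>t\<close> and the other directions none.\<close>

lemma smooth_fam_dquot:
  fixes u :: "'p::topological_space \<Rightarrow> 'a::euclidean_space \<Rightarrow> real"
  assumes "smooth_fam S u" "c \<in> Basis" "continuous_on S a"
  shows "smooth_fam S (\<lambda>p. dquot c (a p) (u p))"
    and "\<And>p bs. p \<in> S \<Longrightarrow> bs \<in> lists Basis \<Longrightarrow> pds bs (dquot c (a p) (u p)) =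
       (\<lambda>z. integral {0..1} (\<lambda>t. t ^ count_list bs c * pds (bs @ [c]) (u p) (z + ((1 - t) * (a p - z \<bullet> c)) *\<^sub>R c)))"
proof -
  let ?D = "\<lambda>p bs z. integral {0..1} (\<lambda>t. t ^ count_list bs c * pds (bs @ [c]) (u p) (z + ((1 - t) * (a p - z \<bullet> c)) *\<^sub>R c))"
  have 1: "?D p [] z = dquot c (a p) (u p) z" for p z by (simp add: dquot_def)
  have 2: "((\<lambda>t. ?D p bs (z + t *\<^sub>R b)) has_real_derivative ?D p (b # bs) z) (at 0)"
    if "p \<in> S" "bs \<in> lists Basis" "b \<in> Basis" for p bs b z
  proof -
    note sm = smooth_fam_smooth[OF assms(1) that(1)]
    have l: "bs @ [c] \<in> lists Basis" using that assms by auto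
    have l': "b # bs @ [c] \<in> lists Basis" using that assms by auto
    let ?k = "count_list (b # bs) c"
    let ?y = "\<lambda>s t. (z + s *\<^sub>R b) + ((1 - t) * (a p - (z + s *\<^sub>R b) \<bullet> c)) *\<^sub>R c"
    let ?f = "\<lambda>s t. t ^ count_list bs c * pds (bs @ [c]) (u p) (?y s t)"
    let ?f' = "\<lambda>s t. t ^ ?k * pds (b # bs @ [c]) (u p) (?y s t)"
    have ye: "?y s t = (z + ((1 - t) * (a p - z \<bullet> c)) *\<^sub>R c) + ((if b = c then t else 1) * s) *\<^sub>R b" for s t
    proof (cases "b = c")
      case True
      then show ?thesis using assms(2) by (simp add: inner_add_left algebra_simps)
    next
      case False
      then have "b \<bullet> c = 0" using that(3) assms(2) by (auto simp: inner_Basis)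
      with False show ?thesis by (simp add: inner_add_left)
    qed
    have d: "((\<lambda>s. ?f s t) has_real_derivative ?f' s t) (at s within UNIV)" for s t
    proof -
      let ?m = "if b = c then t else 1"
      have "((\<lambda>s. pds (bs @ [c]) (u p) (?y s t)) has_real_derivative ?m * pds (b # bs @ [c]) (u p) (?y s t)) (at s)"
        unfolding ye by (rule smooth_deriv_scaled[OF sm l that(3)])
      from DERIV_cmult[OF this, of "t ^ count_list bs c"] show ?thesis
        by (cases "b = c") (simp_all add: algebra_simps)
    qed
    have c: "continuous_on ((UNIV :: real set) \<times> cbox 0 1) (\<lambda>(s, t). ?f' s t)"
      unfolding case_prod_unfold
      by (intro continuous_intros continuous_on_compose2[OF smooth_continuous[OF sm l', of UNIV]]) auto
    have i: "?f s integrable_on cbox 0 1" for s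
      by (rule integrable_continuous)
        (intro continuous_intros continuous_on_compose2[OF smooth_continuous[OF sm l, of UNIV]], auto)
    have "((\<lambda>s. integral (cbox 0 1) (?f s)) has_real_derivative integral (cbox 0 1) (?f' 0)) (at 0 within UNIV)"
      by (rule leibniz_rule_field_derivative[OF d i c]) auto
    then show ?thesis by simp
  qed
  have 3: "continuous_on (S \<times> UNIV) (\<lambda>(p, z). ?D p bs z)" if "bs \<in> lists Basis" for bs
  proof -
    have l: "bs @ [c] \<in> lists Basis" using that assms by auto
    have "continuous_on ((S \<times> UNIV) \<times> cbox 0 1) (\<lambda>x. snd x ^ count_list bs c *
       pds (bs @ [c]) (u (fst (fst x))) (snd (fst x) + ((1 - snd x) * (a (fst (fst x)) - snd (fst x) \<bullet> c)) *\<^sub>R c))"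
      by (intro continuous_intros smooth_fam_compose[OF assms(1) l] continuous_on_compose2[OF assms(3)]) auto
    then have "continuous_on ((S \<times> UNIV) \<times> cbox 0 1) (\<lambda>(y, t). t ^ count_list bs c *
       pds (bs @ [c]) (u (fst y)) (snd y + ((1 - t) * (a (fst y) - snd y \<bullet> c)) *\<^sub>R c))"
      by (simp add: case_prod_unfold)
    from integral_continuous_on_param[OF this] show ?thesis by (simp add: case_prod_unfold)
  qed
  note R = smooth_famI[where D = ?D and S = S and u = "\<lambda>p. dquot c (a p) (u p)"]
  show "smooth_fam S (\<lambda>p. dquot c (a p) (u p))" by (rule R(1)) (use 1 2 3 in auto)
  show "pds bs (dquot c (a p) (u p)) = ?D p bs" if "p \<in> S" "bs \<in> lists Basis" for p bs
    by (rule R(2)) (use 1 2 3 that in auto)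
qed

section \<open>Divided differences in one variable\<close>

lemma smooth_add:
  assumes "smooth u" "smooth v"
  shows "smooth (\<lambda>z. u z + v z)"
    and "bs \<in> lists Basis \<Longrightarrow> pds bs (\<lambda>z. u z + v z) z = pds bs u z + pds bs v z"
  using smooth_fam_add[of "UNIV :: real set" "\<lambda>_. u" "\<lambda>_. v"] assms by (auto simp: smooth_iff_fam)

lemma smooth_cmult:
  assumes "smooth u"
  shows "smooth (\<lambda>z. k * u z)"
    and "bs \<in> lists Basis \<Longrightarrow> pds bs (\<lambda>z. k * u z) z = k * pds bs u z"
  using smooth_fam_cmult[of "UNIV :: real set" "\<lambda>_. u" "\<lambda>_. k"] assms by (auto simp: smooth_iff_fam)

lemma smooth_coord:
  assumes "smooth u" "c \<in> Basis"
  shows "smooth (\<lambda>z. (z \<bullet> c) * u z)"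
    and "bs \<in> lists Basis \<Longrightarrow> pds bs (\<lambda>z. (z \<bullet> c) * u z) z = (z \<bullet> c) * pds bs u z + (\<Sum>l\<leftarrow>removals c bs. pds l u z)"
  using smooth_fam_coord[of "UNIV :: real set" "\<lambda>_. u" c] assms by (auto simp: smooth_iff_fam)

lemma smooth_ev:
  assumes "smooth u" "c \<in> Basis"
  shows "smooth (ev c a u)"
    and "bs \<in> lists Basis \<Longrightarrow> pds bs (ev c a u) z = (if c \<in> set bs then 0 else pds bs u (upd c a z))"
  using smooth_fam_ev[of "UNIV :: real set" "\<lambda>_. u" c "\<lambda>_. a"] assms by (auto simp: smooth_iff_fam)

lemma smooth_dquot:
  assumes "smooth u" "c \<in> Basis"
  shows "smooth (dquot c a u)"
    and "bs \<in> lists Basis \<Longrightarrow> pds bs (dquot c a u) z =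
      integral {0..1} (\<lambda>t. t ^ count_list bs c * pds (bs @ [c]) u (z + ((1 - t) * (a - z \<bullet> c)) *\<^sub>R c))"
  using smooth_fam_dquot[of "UNIV :: real set" "\<lambda>_. u" c "\<lambda>_. a"] assms by (auto simp: smooth_iff_fam)

lemma smooth_zero [simp]: "smooth (\<lambda>_. 0)"
  and pds_zero: "bs \<in> lists Basis \<Longrightarrow> pds bs (\<lambda>_. 0) = (\<lambda>_. 0)"
  using smooth_famI[of "UNIV :: real set" "\<lambda>_ _ _. 0" "\<lambda>_ _. 0"] by (auto simp: smooth_iff_fam)

lemma smooth_fam_zero [simp]: "smooth_fam S (\<lambda>_ _. 0)"
  using smooth_fam_const[OF smooth_zero] .

lemma smooth_fam_poly:
  fixes u :: "'p::topological_space \<Rightarrow> 'a::euclidean_space \<Rightarrow> real"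
  assumes "smooth_fam S u" "c \<in> Basis"
  shows "smooth_fam S (\<lambda>p z. poly q (z \<bullet> c) * u p z)"
proof (induction q)
  case 0
  then show ?case by simp
next
  case (pCons a q)
  have "smooth_fam S (\<lambda>p z. a * u p z + (z \<bullet> c) * (poly q (z \<bullet> c) * u p z))"
    by (intro smooth_fam_add smooth_fam_cmult smooth_fam_coord assms pCons continuous_on_const)
  then show ?case by (simp add: algebra_simps)
qed

lemma smooth_poly:
  assumes "smooth u" "c \<in> Basis"
  shows "smooth (\<lambda>z. poly q (z \<bullet> c) * u z)"
  using smooth_fam_poly[of "UNIV :: real set" "\<lambda>_. u" c] assms by (auto simp: smooth_iff_fam)

lemma dquot_eq:
  assumes "smooth u" "c \<in> Basis"
  shows "u z = u (upd c a z) + (z \<bullet> c - a) * dquot c a u z"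
proof -
  let ?y = "\<lambda>t. z + ((1 - t) * (a - z \<bullet> c)) *\<^sub>R c"
  have "((\<lambda>t. u (?y t)) has_real_derivative (z \<bullet> c - a) * pd c u (?y t)) (at t within {0..1})" for t
  proof -
    have y: "?y t = (z + (a - z \<bullet> c) *\<^sub>R c) + ((z \<bullet> c - a) * t) *\<^sub>R c" for t
      by (simp add: algebra_simps)
    show ?thesis
      unfolding y
      using smooth_deriv_scaled[OF assms(1) _ assms(2), of "[]" "z + (a - z \<bullet> c) *\<^sub>R c" "z \<bullet> c - a" t]
      by (simp add: has_field_derivative_at_within)
  qed
  then have "((\<lambda>t. (z \<bullet> c - a) * pd c u (?y t)) has_integral (u (?y 1) - u (?y 0))) {0..1}"
    by (intro fundamental_theorem_of_calculus) (auto simp: has_real_derivative_iff_has_vector_derivative)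
  then have "integral {0..1} (\<lambda>t. (z \<bullet> c - a) * pd c u (?y t)) = u z - u (upd c a z)"
    by (auto simp: upd_def dest: integral_unique)
  then show ?thesis by (simp add: dquot_def)
qed

text \<open>Off the hyperplane the factor is invertible; a point on it is approached along the line
  in direction \<open>c\<close>, where continuity carries the equality over.\<close>

lemma coord_cancel:
  assumes "continuous_on UNIV w1" "continuous_on UNIV w2" "(c::'a::euclidean_space) \<in> Basis"
    and eq: "\<And>z. (z \<bullet> c - a) * w1 z = (z \<bullet> c - a) * (w2 z :: real)"
  shows "w1 = w2"
proof
  fix z :: 'a
  have ne: "w1 z = w2 z" if "z \<bullet> c \<noteq> a" for z
    using eq[of z] that by simp
  show "w1 z = w2 z"
  proof (cases "z \<bullet> c = a")
    case True
    let ?y = "\<lambda>s::real. z + s *\<^sub>R c"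
    have "continuous_on UNIV (\<lambda>s. w1 (?y s) - w2 (?y s))"
      by (intro continuous_intros continuous_on_compose2[OF assms(1)] continuous_on_compose2[OF assms(2)]) auto
    then have "isCont (\<lambda>s. w1 (?y s) - w2 (?y s)) 0"
      by (simp add: continuous_on_eq_continuous_at)
    then have "(\<lambda>s. w1 (?y s) - w2 (?y s)) \<midarrow>0\<rightarrow> w1 (?y 0) - w2 (?y 0)"
      by (simp add: isCont_def)
    moreover have "(\<lambda>s. w1 (?y s) - w2 (?y s)) \<midarrow>0\<rightarrow> 0"
    proof (rule tendsto_eventually)
      have "w1 (?y s) - w2 (?y s) = 0" if "s \<noteq> 0" for s
        using ne[of "?y s"] that True assms(3) by (simp add: inner_add_left)
      then show "\<forall>\<^sub>F s in at 0. w1 (?y s) - w2 (?y s) = 0"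
        by (auto simp: eventually_at_filter)
    qed
    ultimately have "w1 (?y 0) - w2 (?y 0) = 0"
      by (rule LIM_unique)
    then show ?thesis by simp
  qed (use ne in auto)
qed

text \<open>Linearity, cancellation of linear factors and commutation of difference quotients follow
  by exhibiting a continuous quotient, without touching the integral.\<close>

lemma dquot_unique:
  assumes "smooth u" "c \<in> Basis" "continuous_on UNIV w"
    and "\<And>z. u z = u (upd c a z) + (z \<bullet> c - a) * w z"
  shows "dquot c a u = w"
proof (rule coord_cancel[where c = c and a = a])
  show "continuous_on UNIV (dquot c a u)"
    using smooth_continuous_on smooth_dquot assms by blast
  show "(z \<bullet> c - a) * dquot c a u z = (z \<bullet> c - a) * w z" for z
    using assms(4)[of z] dquot_eq[OF assms(1,2), of z a] by linarith
qed (use assms in auto)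

lemma dquot_lin:
  assumes "smooth u" "smooth v" "c \<in> Basis"
  shows "dquot c a (\<lambda>z. u z + k * v z) = (\<lambda>z. dquot c a u z + k * dquot c a v z)"
proof (rule dquot_unique)
  show "smooth (\<lambda>z. u z + k * v z)"
    by (intro smooth_add smooth_cmult assms)
  show "continuous_on UNIV (\<lambda>z. dquot c a u z + k * dquot c a v z)"
    by (intro smooth_continuous_on smooth_add smooth_cmult smooth_dquot assms)
  show "u z + k * v z = u (upd c a z) + k * v (upd c a z) + (z \<bullet> c - a) * (dquot c a u z + k * dquot c a v z)" for z
    by (subst dquot_eq[OF assms(1,3), of z a], subst dquot_eq[OF assms(2,3), of z a]) (simp add: algebra_simps)
qed (use assms in auto)

lemma dquot_zero: "c \<in> Basis \<Longrightarrow> dquot c a (\<lambda>_. 0) = (\<lambda>_. 0)"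
  by (rule dquot_unique) auto

lemma upd_in [simp]: "c \<in> Basis \<Longrightarrow> upd c a z \<bullet> c = a"
  by (simp add: upd_inner)

lemma smooth_linfac:
  assumes "smooth u" "c \<in> Basis"
  shows "smooth (\<lambda>z. (z \<bullet> c - b) * u z)"
  using smooth_poly[OF assms, of "[:-b, 1:]"] by (simp add: algebra_simps)

lemma dquot_linfac:
  assumes "smooth u" "c \<in> Basis"
  shows "dquot c a (\<lambda>z. (z \<bullet> c - a) * u z) = u"
  by (rule dquot_unique) (use assms smooth_linfac smooth_continuous_on in auto)

text \<open>For \<open>a \<noteq> b\<close>, \<open>(b - a)\<close> times the iterated quotient is
  the difference of the two simple quotients. Exchanging \<open>a\<close> and \<open>b\<close>
  changes the sign of both sides of this identity.\<close>

lemma dquot_commute: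
  assumes u: "smooth u" and c: "c \<in> Basis"
  shows "dquot c a (dquot c b u) = dquot c b (dquot c a u)"
proof (cases "a = b")
  case False
  have E: "(b - a) * dquot c b (dquot c a u) z = dquot c b u z - dquot c a u z"
    if "a \<noteq> b" for a b z
  proof -
    have "dquot c b (dquot c a u) = (\<lambda>z. (1 / (b - a)) * dquot c b u z + (- 1 / (b - a)) * dquot c a u z)"
    proof (rule dquot_unique)
      fix z
      have 1: "dquot c a u (upd c b z) = (u (upd c b z) - u (upd c a z)) / (b - a)"
        using dquot_eq[OF u c, of "upd c b z" a] that c by (simp add: field_simps)
      have 2: "u z = u (upd c a z) + (z \<bullet> c - a) * dquot c a u z" "u z = u (upd c b z) + (z \<bullet> c - b) * dquot c b u z"
        using dquot_eq[OF u c] by auto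
      have "(b - a) * dquot c a u z = (u (upd c b z) - u (upd c a z)) + (z \<bullet> c - b) * (dquot c b u z - dquot c a u z)"
        using 2 by (simp add: algebra_simps)
      then have "dquot c a u z = ((u (upd c b z) - u (upd c a z)) + (z \<bullet> c - b) * (dquot c b u z - dquot c a u z)) / (b - a)"
        using that by (simp add: eq_divide_eq mult.commute)
      also have "\<dots> = dquot c a u (upd c b z) +
          (z \<bullet> c - b) * ((1 / (b - a)) * dquot c b u z + (- 1 / (b - a)) * dquot c a u z)"
        unfolding 1 by (simp add: add_divide_distrib diff_divide_distrib right_diff_distrib)
      finally show "dquot c a u z = dquot c a u (upd c b z) +
          (z \<bullet> c - b) * ((1 / (b - a)) * dquot c b u z + (- 1 / (b - a)) * dquot c a u z)" .
    next
      show "continuous_on UNIV (\<lambda>z. (1 / (b - a)) * dquot c b u z + (- 1 / (b - a)) * dquot c a u z)"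
        by (intro smooth_continuous_on smooth_add smooth_cmult smooth_dquot u c)
    qed (use c u in \<open>auto intro!: smooth_dquot\<close>)
    moreover have "(b - a) * ((1 / (b - a)) * x + (- 1 / (b - a)) * y) = x - y" for x y
      using that by (simp add: right_diff_distrib)
    ultimately show ?thesis by simp
  qed
  show ?thesis
  proof
    fix z
    have "(b - a) * dquot c b (dquot c a u) z = (b - a) * dquot c a (dquot c b u) z"
      using E[of a b z] E[of b a z] False by (simp add: algebra_simps)
    then show "dquot c a (dquot c b u) z = dquot c b (dquot c a u) z"
      using False by simp
  qed
qed simp

text \<open>The quotient in the division of \<open>u\<close> by \<open>node_poly xs\<close> in the
  variable \<open>z \<bullet> c\<close>; repeated nodes are allowed.\<close>

definition dquots :: "'a::euclidean_space \<Rightarrow> real list \<Rightarrow> ('a \<Rightarrow> real) \<Rightarrow> 'a \<Rightarrow> real" where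
  "dquots c xs = fold (dquot c) xs"

text \<open>The divided difference at all nodes: quotients at all but the last, then evaluation
  there. It is the coefficient of degree \<open>length xs - 1\<close> of the remainder of
  \<open>u\<close> modulo \<open>node_poly xs\<close>, and it no longer depends on
  \<open>z \<bullet> c\<close>.\<close>

definition ddiff :: "'a::euclidean_space \<Rightarrow> real list \<Rightarrow> ('a \<Rightarrow> real) \<Rightarrow> 'a \<Rightarrow> real" where
  "ddiff c xs u = ev c (last xs) (dquots c (butlast xs) u)"

definition node_poly :: "real list \<Rightarrow> real poly" where
  "node_poly xs = (\<Prod>x\<leftarrow>xs. [:- x, 1:])"

lemma poly_node_poly [simp]:
  "poly (node_poly []) t = 1" "poly (node_poly (x # xs)) t = (t - x) * poly (node_poly xs) t"
  by (simp_all add: node_poly_def algebra_simps)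

lemma poly_node_poly_append [simp]:
  "poly (node_poly (xs @ ys)) t = poly (node_poly xs) t * poly (node_poly ys) t"
  by (simp add: node_poly_def)

lemma dquots_Nil [simp]: "dquots c [] u = u"
  and dquots_Cons [simp]: "dquots c (a # xs) u = dquots c xs (dquot c a u)"
  and dquots_append: "dquots c (xs @ ys) u = dquots c ys (dquots c xs u)"
  by (simp_all add: dquots_def)

lemma ddiff_Cons: "xs \<noteq> [] \<Longrightarrow> ddiff c (a # xs) u = ddiff c xs (dquot c a u)"
  and ddiff_single: "ddiff c [a] u = ev c a u"
  and ddiff_snoc: "ddiff c (xs @ [a]) u = ev c a (dquots c xs u)"
  by (simp_all add: ddiff_def)

lemma smooth_dquots: "smooth u \<Longrightarrow> c \<in> Basis \<Longrightarrow> smooth (dquots c xs u)"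
  by (induction xs arbitrary: u) (auto intro: smooth_dquot)

lemma smooth_ddiff: "smooth u \<Longrightarrow> c \<in> Basis \<Longrightarrow> smooth (ddiff c xs u)"
  by (simp add: ddiff_def smooth_dquots smooth_ev)

lemma smooth_fam_dquots:
  fixes u :: "'p::topological_space \<Rightarrow> 'a::euclidean_space \<Rightarrow> real"
  assumes "smooth_fam S u" "c \<in> Basis" "\<And>l. l \<in> set ls \<Longrightarrow> continuous_on S (a l)"
  shows "smooth_fam S (\<lambda>p. dquots c (map (\<lambda>l. a l p) ls) (u p))"
  using assms
proof (induction ls arbitrary: u)
  case (Cons l ls)
  have "smooth_fam S (\<lambda>p. dquot c (a l p) (u p))"
    using smooth_fam_dquot Cons.prems by fastforce
  from Cons.IH[OF this] Cons.prems show ?case by simp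
qed simp

lemma smooth_fam_ddiff:
  fixes u :: "'p::topological_space \<Rightarrow> 'a::euclidean_space \<Rightarrow> real"
  assumes "smooth_fam S u" "c \<in> Basis" "\<And>l. l \<in> set ls \<Longrightarrow> continuous_on S (a l)" "ls \<noteq> []"
  shows "smooth_fam S (\<lambda>p. ddiff c (map (\<lambda>l. a l p) ls) (u p))"
proof -
  obtain ls' l where ls: "ls = ls' @ [l]" using assms(4) by (metis append_butlast_last_id)
  have "smooth_fam S (\<lambda>p. ev c (a l p) (dquots c (map (\<lambda>l. a l p) ls') (u p)))"
    by (rule smooth_fam_ev, rule smooth_fam_dquots) (use assms ls in auto)
  then show ?thesis by (simp add: ls ddiff_snoc)
qed

lemma dquots_lin:
  "smooth u \<Longrightarrow> smooth v \<Longrightarrow> c \<in> Basis \<Longrightarrow>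
   dquots c xs (\<lambda>z. u z + k * v z) = (\<lambda>z. dquots c xs u z + k * dquots c xs v z)"
  by (induction xs arbitrary: u v) (simp_all add: dquot_lin smooth_dquot)

lemma dquots_zero: "c \<in> Basis \<Longrightarrow> dquots c xs (\<lambda>_. 0) = (\<lambda>_. 0)"
  by (induction xs) (simp_all add: dquot_zero)

lemma ddiff_lin:
  "smooth u \<Longrightarrow> smooth v \<Longrightarrow> c \<in> Basis \<Longrightarrow>
   ddiff c xs (\<lambda>z. u z + k * v z) = (\<lambda>z. ddiff c xs u z + k * ddiff c xs v z)"
  by (simp add: ddiff_def dquots_lin ev_def fun_eq_iff)

lemma ddiff_zero: "c \<in> Basis \<Longrightarrow> ddiff c xs (\<lambda>_. 0) = (\<lambda>_. 0)"
  by (simp add: ddiff_def dquots_zero ev_def fun_eq_iff)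

section \<open>Division with remainder by the node polynomial\<close>

definition remainder :: "'a::euclidean_space \<Rightarrow> real list \<Rightarrow> ('a \<Rightarrow> real) \<Rightarrow> 'a \<Rightarrow> real" where
  "remainder c xs u z = u z + (- 1) * (poly (node_poly xs) (z \<bullet> c) * dquots c xs u z)"

lemma smooth_remainder: "smooth u \<Longrightarrow> c \<in> Basis \<Longrightarrow> smooth (remainder c xs u)"
  unfolding remainder_def by (intro smooth_add smooth_cmult smooth_poly smooth_dquots)

lemma dquot_remainder_Cons:
  assumes "smooth u" "c \<in> Basis"
  shows "dquot c b (remainder c (a # xs) u) =
    (\<lambda>z. remainder c xs (dquot c a u) z + (b - a) * dquot c b (remainder c xs (dquot c a u)) z)"
proof (rule dquot_unique)
  let ?r' = "remainder c xs (dquot c a u)"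
  have r': "smooth ?r'" by (intro smooth_remainder smooth_dquot assms)
  have r: "remainder c (a # xs) u z = u (upd c a z) + (z \<bullet> c - a) * ?r' z" for z
    using dquot_eq[OF assms, of z a] by (simp add: remainder_def algebra_simps)
  show "continuous_on UNIV (\<lambda>z. ?r' z + (b - a) * dquot c b ?r' z)"
    by (intro smooth_continuous_on smooth_add smooth_cmult smooth_dquot r' assms)
  show "remainder c (a # xs) u z = remainder c (a # xs) u (upd c b z) +
      (z \<bullet> c - b) * (?r' z + (b - a) * dquot c b ?r' z)" for z
  proof -
    have "(b - a) * ?r' z = (b - a) * (?r' (upd c b z) + (z \<bullet> c - b) * dquot c b ?r' z)"
      using dquot_eq[OF r' assms(2), of z b] by simp
    then show ?thesis
      unfolding r using assms(2) by (simp add: algebra_simps)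
  qed
qed (use assms in \<open>auto intro: smooth_remainder\<close>)

text \<open>In \<open>z \<bullet> c\<close> the remainder is like a polynomial of degree below
  \<open>length xs\<close>, so this many difference quotients annihilate it, whatever their nodes.
  The recursion \<open>dquot_remainder_Cons\<close> replaces an argument by degrees.\<close>

lemma dquots_remainder:
  "smooth u \<Longrightarrow> c \<in> Basis \<Longrightarrow> length xs \<le> length ys \<Longrightarrow> dquots c ys (remainder c xs u) = (\<lambda>_. 0)"
proof (induction xs arbitrary: ys u)
  case Nil
  have "remainder c [] u = (\<lambda>_. 0)" by (auto simp: remainder_def)
  then show ?case using Nil by (simp add: dquots_zero)
next
  case (Cons a xs)
  then obtain b ys' where ys: "ys = b # ys'" by (cases ys) auto
  let ?r' = "remainder c xs (dquot c a u)"
  have sm: "smooth (dquot c a u)" "smooth ?r'" "smooth (dquot c b ?r')"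
    using Cons.prems by (auto intro!: smooth_remainder smooth_dquot)
  have "dquots c ys' ?r' = (\<lambda>_. 0)" "dquots c (b # ys') ?r' = (\<lambda>_. 0)"
    using Cons.IH[OF sm(1), of ys'] Cons.IH[OF sm(1), of "b # ys'"] Cons.prems ys
    by (simp_all del: dquots_Cons)
  then show ?case
    unfolding ys dquots_Cons dquot_remainder_Cons[OF Cons.prems(1,2)]
    using dquots_lin[OF sm(2,3) Cons.prems(2)] by simp
qed

text \<open>With one difference quotient fewer than in \<open>dquots_remainder\<close>, only the
  leading coefficient of the remainder survives, and it does not see the nodes
  \<open>ys\<close>.\<close>

lemma ddiff_remainder:
  "smooth u \<Longrightarrow> c \<in> Basis \<Longrightarrow> length ys = length xs \<Longrightarrow> xs \<noteq> [] \<Longrightarrow>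
    ddiff c ys (remainder c xs u) = ddiff c xs u"
proof (induction xs arbitrary: ys u)
  case (Cons a xs)
  then obtain b ys' where ys: "ys = b # ys'" by (cases ys) auto
  let ?r' = "remainder c xs (dquot c a u)"
  have sm: "smooth (dquot c a u)" "smooth ?r'" "smooth (dquot c b ?r')"
    using Cons.prems by (auto intro!: smooth_remainder smooth_dquot)
  show ?case
  proof (cases "xs = []")
    case True
    then have "ys' = []" using Cons.prems ys by simp
    moreover have "remainder c [a] u z = u (upd c a z)" for z
      using dquot_eq[OF Cons.prems(1,2), of z a] by (simp add: remainder_def)
    ultimately show ?thesis
      using True ys Cons.prems(2) by (simp add: ddiff_single ev_def fun_eq_iff)
  next
    case False
    then have ne: "ys' \<noteq> []" using Cons.prems ys by auto
    have "ddiff c ys' ?r' = ddiff c xs (dquot c a u)"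
      using Cons.IH[OF sm(1)] Cons.prems ys False by auto
    moreover have "ddiff c (b # ys') ?r' = (\<lambda>_. 0)"
      using dquots_remainder[OF sm(1) Cons.prems(2), of xs "butlast (b # ys')"] Cons.prems ys
      by (simp add: ddiff_def ev_def fun_eq_iff del: butlast.simps)
    ultimately show ?thesis
      using False ne unfolding ys
      by (simp add: ddiff_Cons dquot_remainder_Cons[OF Cons.prems(1,2)] ddiff_lin[OF sm(2,3) Cons.prems(2)])
  qed
qed simp

text \<open>A factor vanishing at a node undoes the difference quotient there. This is how Newton
  factors win back derivatives.\<close>

lemma dquots_node_poly:
  "smooth u \<Longrightarrow> c \<in> Basis \<Longrightarrow> dquots c (xs @ ys) (\<lambda>z. poly (node_poly xs) (z \<bullet> c) * u z) = dquots c ys u"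
proof (induction xs)
  case (Cons a xs)
  have "dquot c a (\<lambda>z. (z \<bullet> c - a) * (poly (node_poly xs) (z \<bullet> c) * u z)) = (\<lambda>z. poly (node_poly xs) (z \<bullet> c) * u z)"
    by (intro dquot_linfac smooth_poly Cons.prems)
  then show ?case using Cons by (simp add: mult.assoc)
qed simp

lemma ddiff_node_poly:
  assumes "smooth u" "c \<in> Basis" "ys \<noteq> []"
  shows "ddiff c (xs @ ys) (\<lambda>z. poly (node_poly xs) (z \<bullet> c) * u z) = ddiff c ys u"
proof -
  obtain ys' l where "ys = ys' @ [l]" using assms(3) by (metis append_butlast_last_id)
  then show ?thesis using dquots_node_poly[OF assms(1,2), of xs ys']
    by (simp add: ddiff_def butlast_append)
qed

lemma ddiff_node_poly_all:
  assumes "smooth u" "c \<in> Basis" "xs \<noteq> []"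
  shows "ddiff c xs (\<lambda>z. poly (node_poly xs) (z \<bullet> c) * u z) = (\<lambda>_. 0)"
proof -
  obtain ys l where xs: "xs = ys @ [l]" using assms(3) by (metis append_butlast_last_id)
  have "ddiff c (ys @ [l]) (\<lambda>z. poly (node_poly ys) (z \<bullet> c) * ((z \<bullet> c - l) * u z)) = ddiff c [l] (\<lambda>z. (z \<bullet> c - l) * u z)"
    by (intro ddiff_node_poly smooth_linfac assms) auto
  also have "\<dots> = (\<lambda>_. 0)" using assms(2) by (auto simp: ddiff_single ev_def)
  finally show ?thesis by (simp add: xs mult.assoc)
qed

text \<open>Write \<open>u = r + node_poly xs * q\<close> with quotient \<open>q\<close> and
  remainder \<open>r\<close> at the old nodes, replace \<open>node_poly xs\<close> by
  \<open>node_poly ys - s * v\<close>, and divide at the new nodes. The quotient kills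
  \<open>r\<close> and returns \<open>q\<close> from \<open>node_poly ys * q\<close>; the divided
  difference keeps the contribution of \<open>r\<close> and kills that of
  \<open>node_poly ys * q\<close>.\<close>

lemma dquots_resolvent:
  assumes u: "smooth u" and c: "c \<in> Basis" and len: "length ys = length xs"
    and p: "\<And>t. poly (node_poly ys) t = poly (node_poly xs) t + s * poly v t"
  shows "dquots c ys u z = dquots c xs u z - s * dquots c ys (\<lambda>z. poly v (z \<bullet> c) * dquots c xs u z) z"
    and "xs \<noteq> [] \<Longrightarrow> ddiff c ys u z = ddiff c xs u z - s * ddiff c ys (\<lambda>z. poly v (z \<bullet> c) * dquots c xs u z) z"
proof -
  let ?q = "dquots c xs u" and ?r = "remainder c xs u"
  let ?m = "\<lambda>z. poly (node_poly ys) (z \<bullet> c) * ?q z" and ?v = "\<lambda>z. poly v (z \<bullet> c) * ?q z"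
  have q: "smooth ?q" "smooth ?r" "smooth ?m" "smooth ?v" "smooth (\<lambda>z. ?m z + (- s) * ?v z)"
    by (intro smooth_dquots smooth_remainder smooth_add smooth_cmult smooth_poly u c)+
  have ue: "u = (\<lambda>z. ?r z + 1 * (?m z + (- s) * ?v z))"
    by (auto simp: remainder_def p algebra_simps)
  have mq: "dquots c ys ?m = ?q"
    using dquots_node_poly[OF q(1) c, of ys "[]"] by simp
  have "dquots c ys u z = dquots c ys (\<lambda>z. ?r z + 1 * (?m z + (- s) * ?v z)) z"
    by (rule fun_cong[OF arg_cong[OF ue]])
  also have "\<dots> = ?q z - s * dquots c ys ?v z"
    by (simp only: dquots_lin[OF q(2,5) c] dquots_lin[OF q(3,4) c])
       (simp add: dquots_remainder u c len mq)
  finally show "dquots c ys u z = ?q z - s * dquots c ys ?v z" .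
  assume ne: "xs \<noteq> []"
  then have ne': "ys \<noteq> []" using len by auto
  have "ddiff c ys u z = ddiff c ys (\<lambda>z. ?r z + 1 * (?m z + (- s) * ?v z)) z"
    by (rule fun_cong[OF arg_cong[OF ue]])
  also have "\<dots> = ddiff c xs u z - s * ddiff c ys ?v z"
    by (simp only: ddiff_lin[OF q(2,5) c] ddiff_lin[OF q(3,4) c])
       (simp add: ddiff_remainder u c len ne ddiff_node_poly_all[OF q(1) c ne'])
  finally show "ddiff c ys u z = ddiff c xs u z - s * ddiff c ys ?v z" .
qed

section \<open>Symmetry of divided differences in the nodes\<close>

lemma dquots_to_front:
  "a \<in> set xs \<Longrightarrow> smooth u \<Longrightarrow> c \<in> Basis \<Longrightarrow> dquots c xs u = dquots c (a # remove1 a xs) u"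
proof (induction xs arbitrary: u)
  case (Cons b xs)
  then show ?case
    using Cons.IH[of "dquot c b u"] by (cases "a = b") (auto simp: dquot_commute smooth_dquot)
qed simp

lemma dquots_perm:
  "mset xs = mset ys \<Longrightarrow> smooth u \<Longrightarrow> c \<in> Basis \<Longrightarrow> dquots c xs u = dquots c ys u"
proof (induction xs arbitrary: ys u)
  case (Cons a xs)
  then have a: "a \<in> set ys" "mset xs = mset (remove1 a ys)"
    by (metis list.set_intros(1) mset_eq_setD, metis add_mset_remove_trivial mset.simps(2) mset_remove1)
  show ?case
    using dquots_to_front[OF a(1) Cons.prems(2,3)] Cons.IH[OF a(2)] Cons.prems by (simp add: smooth_dquot)
qed simp

text \<open>The last node is special in \<open>ddiff\<close> because it is used for evaluation.
  Exchanging it with its neighbour is the symmetry of the difference quotient of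
  \<open>dquots c xs u\<close> between \<open>a\<close> and \<open>b\<close>.\<close>

lemma ddiff_swap:
  assumes "smooth u" "c \<in> Basis"
  shows "ddiff c (xs @ [a, b]) u = ddiff c (xs @ [b, a]) u"
proof -
  let ?w = "dquots c xs u"
  have w: "smooth ?w" using assms by (rule smooth_dquots)
  have "ev c b (dquot c a ?w) z = ev c a (dquot c b ?w) z" for z
  proof (cases "a = b")
    case False
    have "?w (upd c b z) = ?w (upd c a z) + (b - a) * dquot c a ?w (upd c b z)"
      "?w (upd c a z) = ?w (upd c b z) + (a - b) * dquot c b ?w (upd c a z)"
      using dquot_eq[OF w assms(2), of "upd c b z" a] dquot_eq[OF w assms(2), of "upd c a z" b] assms(2) by auto
    then have "(b - a) * dquot c a ?w (upd c b z) = (b - a) * dquot c b ?w (upd c a z)"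
      by (simp add: algebra_simps)
    then show ?thesis using False by (simp add: ev_def)
  qed simp
  then show ?thesis
    using ddiff_snoc[of c "xs @ [a]" b u] ddiff_snoc[of c "xs @ [b]" a u]
    by (auto simp: dquots_append fun_eq_iff)
qed

lemma ddiff_perm:
  assumes "mset xs = mset ys" "xs \<noteq> []" "smooth u" "c \<in> Basis"
  shows "ddiff c xs u = ddiff c ys u"
proof -
  have ne: "ys \<noteq> []" using assms by auto
  obtain xs' a where xs: "xs = xs' @ [a]" using assms(2) by (metis append_butlast_last_id)
  obtain ys' b where ys: "ys = ys' @ [b]" using ne by (metis append_butlast_last_id)
  show ?thesis
  proof (cases "a = b")
    case True
    then have "mset xs' = mset ys'" using assms(1) xs ys by simp
    with dquots_perm[OF this assms(3,4)] True show ?thesis by (simp add: xs ys ddiff_snoc)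
  next
    case False
    have "a \<in> set ys" using assms(1) xs by (metis in_set_conv_decomp mset_eq_setD)
    then have a: "a \<in> set ys'" using False ys by simp
    \<comment> \<open>Up to order, both node lists consist of \<open>zs\<close>, \<open>a\<close>
      and \<open>b\<close>, so \<open>ddiff_swap\<close> connects them.\<close>
    define zs where "zs = remove1 a ys'"
    have m: "mset ys' = mset (zs @ [a])" using a by (simp add: zs_def)
    moreover have "add_mset a (mset xs') = add_mset b (mset ys')" using assms(1) xs ys by simp
    ultimately have m2: "mset xs' = mset (zs @ [b])" by (simp add: add_mset_commute)
    have "ddiff c ys u = ddiff c (zs @ [a, b]) u"
      using dquots_perm[OF m assms(3,4)] ddiff_snoc[of c "zs @ [a]" b u] by (simp add: ys ddiff_snoc)
    also have "\<dots> = ddiff c (zs @ [b, a]) u" by (rule ddiff_swap[OF assms(3,4)])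
    also have "\<dots> = ddiff c xs u"
      using dquots_perm[OF m2 assms(3,4)] ddiff_snoc[of c "zs @ [b]" a u] by (simp add: xs ddiff_snoc)
    finally show ?thesis by simp
  qed
qed

section \<open>Words of divided differences and multiplications\<close>

text \<open>Derivatives are measured against \<open>\<alpha>!\<close> because a divided difference shifts Taylor coefficients without
  losing a constant.\<close>

definition weight :: "'a::euclidean_space list \<Rightarrow> real" where
  "weight bs = (\<Prod>c\<in>Basis. fact (count_list bs c))"

text \<open>\<open>a\<close> majorizes Taylor coefficients by their order alone, on a cube. The cube
  is convex and will contain the nodes, so evaluation at a node and the segments in
  \<open>dquot\<close> stay inside it.\<close>

definition jet_bound :: "real \<Rightarrow> (nat \<Rightarrow> real) \<Rightarrow> ('a::euclidean_space \<Rightarrow> real) \<Rightarrow> bool" where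
  "jet_bound R a u \<longleftrightarrow> smooth u \<and>
     (\<forall>bs\<in>lists Basis. \<forall>z. (\<forall>c\<in>Basis. \<bar>z \<bullet> c\<bar> \<le> R) \<longrightarrow> \<bar>pds bs u z\<bar> \<le> weight bs * a (length bs))"

lemma jet_boundD:
  "jet_bound R a u \<Longrightarrow> bs \<in> lists Basis \<Longrightarrow> (\<And>c. c \<in> Basis \<Longrightarrow> \<bar>z \<bullet> c\<bar> \<le> R) \<Longrightarrow> \<bar>pds bs u z\<bar> \<le> weight bs * a (length bs)"
  by (auto simp: jet_bound_def)

lemma jet_bound_smooth: "jet_bound R a u \<Longrightarrow> smooth u"
  by (simp add: jet_bound_def)

lemma jet_boundI:
  assumes "smooth u"
    "\<And>bs z. bs \<in> lists Basis \<Longrightarrow> (\<And>c. c \<in> Basis \<Longrightarrow> \<bar>z \<bullet> c\<bar> \<le> R) \<Longrightarrow> \<bar>pds bs u z\<bar> \<le> weight bs * a (length bs)"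
  shows "jet_bound R a u"
  using assms by (auto simp: jet_bound_def)

lemma weight_pos: "weight bs > 0"
  by (auto simp: weight_def intro!: prod_pos)

lemma weight_Nil [simp]: "weight [] = 1"
  by (simp add: weight_def)

lemma weight_Cons:
  assumes "c \<in> Basis"
  shows "weight (c # bs) = real (count_list bs c + 1) * weight bs"
proof -
  have "weight (c # bs) = fact (count_list (c # bs) c) * (\<Prod>d\<in>Basis - {c}. fact (count_list (c # bs) d))"
    unfolding weight_def by (rule prod.remove) (use assms in auto)
  also have "(\<Prod>d\<in>Basis - {c}. fact (count_list (c # bs) d)) = (\<Prod>d\<in>Basis - {c}. (fact (count_list bs d) :: real))"
    by (rule prod.cong) auto
  also have "fact (count_list (c # bs) c) * \<dots> = real (count_list bs c + 1) * (fact (count_list bs c) * \<dots>)"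
    by simp
  also have "fact (count_list bs c) * (\<Prod>d\<in>Basis - {c}. (fact (count_list bs d) :: real)) = weight bs"
    unfolding weight_def by (rule prod.remove[symmetric]) (use assms in auto)
  finally show ?thesis .
qed

lemma weight_mset: "mset bs = mset cs \<Longrightarrow> weight bs = weight cs"
  unfolding weight_def by (metis count_mset)

lemma weight_snoc: "c \<in> Basis \<Longrightarrow> weight (bs @ [c]) = real (count_list bs c + 1) * weight bs"
  using weight_mset[of "bs @ [c]" "c # bs"] weight_Cons[of c bs] by simp

lemma length_removals: "length (removals c bs) = count_list bs c"
  by (induction bs) auto

lemma removals_mset: "l \<in> set (removals c bs) \<Longrightarrow> mset bs = add_mset c (mset l)"
  by (induction bs arbitrary: l) (auto split: if_splits)

lemma removals_weight:
  assumes "c \<in> Basis" "l \<in> set (removals c bs)"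
  shows "weight l * count_list bs c = weight bs" "length bs = Suc (length l)"
proof -
  have m: "mset bs = mset (c # l)" using removals_mset[OF assms(2)] by simp
  have "count_list bs c = count_list l c + 1"
    using arg_cong[OF m, of "\<lambda>M. count M c"] by (simp add: count_mset)
  then show "weight l * count_list bs c = weight bs"
    using weight_mset[OF m] weight_Cons[OF assms(1), of l] by (simp add: mult.commute)
  show "length bs = Suc (length l)"
    using arg_cong[OF m, of size] by simp
qed

lemma has_integral_power_unit:
  "((\<lambda>t::real. t ^ k) has_integral 1 / real (k + 1)) {0..1}"
proof -
  have "((\<lambda>t::real. t ^ (k + 1) / real (k + 1)) has_real_derivative t ^ k) (at t within {0..1})" for t
    using DERIV_cdivide[OF DERIV_pow[of "k + 1" t "{0..1}"], of "real (k + 1)"] by (simp del: of_nat_Suc)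
  then have "((\<lambda>t::real. t ^ k) has_integral (1 ^ (k + 1) / real (k + 1) - 0 ^ (k + 1) / real (k + 1))) {0..1}"
    by (intro fundamental_theorem_of_calculus) (simp_all flip: has_real_derivative_iff_has_vector_derivative)
  then show ?thesis by simp
qed

text \<open>The factor \<open>t ^ k\<close> integrates to \<open>1 / (k + 1)\<close>, which is
  exactly the ratio \<open>weight bs / weight (bs @ [c])\<close> for
  \<open>k = count_list bs c\<close>.\<close>

lemma jet_bound_dquot:
  assumes u: "jet_bound R a u" and c: "c \<in> Basis" and x: "\<bar>x\<bar> \<le> R"
  shows "jet_bound R (\<lambda>m. a (Suc m)) (dquot c x u)"
proof (rule jet_boundI)
  note sm = jet_bound_smooth[OF u]
  show "smooth (dquot c x u)" using sm c by (rule smooth_dquot)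
  fix bs :: "'a list" and z :: 'a
  assume bs: "bs \<in> lists Basis" and z: "\<And>c. c \<in> Basis \<Longrightarrow> \<bar>z \<bullet> c\<bar> \<le> R"
  have bs': "bs @ [c] \<in> lists Basis" using bs c by auto
  let ?k = "count_list bs c"
  let ?y = "\<lambda>t. z + ((1 - t) * (x - z \<bullet> c)) *\<^sub>R c"
  let ?f = "\<lambda>t. t ^ ?k * pds (bs @ [c]) u (?y t)"
  let ?B = "weight (bs @ [c]) * a (Suc (length bs))"
  have y: "\<bar>?y t \<bullet> d\<bar> \<le> R" if "t \<in> {0..1}" "d \<in> Basis" for t d
  proof (cases "d = c")
    case True
    have "?y t \<bullet> d = t * (z \<bullet> c) + (1 - t) * x"
      using True c by (simp add: inner_add_left algebra_simps)
    also have "\<bar>\<dots>\<bar> \<le> t * \<bar>z \<bullet> c\<bar> + (1 - t) * \<bar>x\<bar>"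
      using that(1) by (intro order.trans[OF abs_triangle_ineq]) (simp add: abs_mult)
    also have "\<dots> \<le> t * R + (1 - t) * R"
      using that(1) z[OF c] x by (intro add_mono mult_left_mono) auto
    finally show ?thesis by (simp add: algebra_simps)
  next
    case False
    then show ?thesis using z[OF that(2)] c that(2) by (simp add: inner_add_left inner_Basis)
  qed
  have cont: "continuous_on {0..1} ?f"
    by (intro continuous_intros continuous_on_compose2[OF smooth_continuous[OF sm bs', of UNIV]]) auto
  have I: "((\<lambda>t. t ^ ?k * ?B) has_integral (1 / real (?k + 1) * ?B)) {0..1}"
    by (rule has_integral_mult_left[OF has_integral_power_unit])
  have "\<bar>integral {0..1} ?f\<bar> \<le> integral {0..1} (\<lambda>t. t ^ ?k * ?B)"
  proof -
    have "norm (integral {0..1} ?f) \<le> integral {0..1} (\<lambda>t. t ^ ?k * ?B)"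
    proof (rule integral_norm_bound_integral)
      fix t :: real assume t: "t \<in> {0..1}"
      have "\<bar>pds (bs @ [c]) u (?y t)\<bar> \<le> ?B"
        using jet_boundD[OF u bs' y[OF t]] by simp
      then show "norm (?f t) \<le> t ^ ?k * ?B"
        using t by (simp add: abs_mult power_abs mult_left_mono)
    qed (use integrable_continuous_real[OF cont] I in auto)
    then show ?thesis by simp
  qed
  also have "\<dots> = 1 / real (?k + 1) * ?B" using I by (rule integral_unique)
  also have "\<dots> = weight bs * a (Suc (length bs))"
    by (simp add: weight_snoc[OF c] del: of_nat_add of_nat_Suc)
  finally show "\<bar>pds bs (dquot c x u) z\<bar> \<le> weight bs * a (Suc (length bs))"
    unfolding smooth_dquot(2)[OF sm c bs] .
qed

lemma jet_bound_ev:
  assumes u: "jet_bound R a u" and c: "c \<in> Basis" and x: "\<bar>x\<bar> \<le> R" and a: "\<And>m. 0 \<le> a m"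
  shows "jet_bound R a (ev c x u)"
proof (rule jet_boundI)
  note sm = jet_bound_smooth[OF u]
  show "smooth (ev c x u)" using sm c by (rule smooth_ev)
  fix bs :: "'a list" and z :: 'a
  assume bs: "bs \<in> lists Basis" and z: "\<And>c. c \<in> Basis \<Longrightarrow> \<bar>z \<bullet> c\<bar> \<le> R"
  have "\<bar>upd c x z \<bullet> d\<bar> \<le> R" if "d \<in> Basis" for d
    using upd_inner[OF c that, of x z] z[OF that] x by simp
  then show "\<bar>pds bs (ev c x u) z\<bar> \<le> weight bs * a (length bs)"
    using jet_boundD[OF u bs, of "upd c x z"] a[of "length bs"] weight_pos[of bs]
    by (simp add: smooth_ev(2)[OF sm c bs])
qed

text \<open>There are \<open>count_list bs c\<close> Leibniz terms, each carrying
  \<open>weight bs\<close> divided by that count, so together they cost a single \<open>a\<close>;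
  the coordinate itself costs \<open>R\<close>.\<close>

lemma jet_bound_coord:
  assumes u: "jet_bound R a u" and c: "c \<in> Basis" and a: "\<And>m. 0 \<le> a m" "mono a"
  shows "jet_bound R (\<lambda>m. (R + 1) * a m) (\<lambda>z. (z \<bullet> c) * u z)"
proof (rule jet_boundI)
  note sm = jet_bound_smooth[OF u]
  show "smooth (\<lambda>z. (z \<bullet> c) * u z)" using sm c by (rule smooth_coord)
  fix bs :: "'a list" and z :: 'a
  assume bs: "bs \<in> lists Basis" and z: "\<And>c. c \<in> Basis \<Longrightarrow> \<bar>z \<bullet> c\<bar> \<le> R"
  let ?A = "a (length bs)"
  have "\<bar>\<Sum>l\<leftarrow>removals c bs. pds l u z\<bar> \<le> (\<Sum>l\<leftarrow>removals c bs. \<bar>pds l u z\<bar>)"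
    using sum_list_abs[of "map (\<lambda>l. pds l u z) (removals c bs)"] by (simp add: o_def)
  also have "\<dots> \<le> (\<Sum>l\<leftarrow>removals c bs. weight bs / count_list bs c * ?A)"
  proof (rule sum_list_mono)
    fix l assume l: "l \<in> set (removals c bs)"
    then have pos: "real (count_list bs c) > 0"
      by (metis length_removals length_pos_if_in_set of_nat_0_less_iff)
    have "\<bar>pds l u z\<bar> \<le> weight l * a (length l)"
      by (rule jet_boundD[OF u removals_lists[OF bs l] z])
    also have "\<dots> \<le> weight l * ?A"
      using removals_weight(2)[OF c l] weight_pos[of l] monoD[OF a(2), of "length l" "length bs"]
      by (intro mult_left_mono) auto
    also have "weight l = weight bs / count_list bs c"
      using removals_weight(1)[OF c l] pos by (simp add: eq_divide_eq)
    finally show "\<bar>pds l u z\<bar> \<le> weight bs / count_list bs c * ?A" .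
  qed
  also have "\<dots> = real (count_list bs c) * (weight bs / count_list bs c * ?A)"
    by (simp add: sum_list_triv length_removals)
  also have "\<dots> \<le> weight bs * ?A"
    using weight_pos[of bs] a(1)[of "length bs"] by (cases "count_list bs c = 0") auto
  finally have 1: "\<bar>\<Sum>l\<leftarrow>removals c bs. pds l u z\<bar> \<le> weight bs * ?A" .
  have "\<bar>(z \<bullet> c) * pds bs u z\<bar> \<le> R * (weight bs * ?A)"
    unfolding abs_mult using jet_boundD[OF u bs z] z[OF c] by (intro mult_mono) auto
  with 1 have "\<bar>(z \<bullet> c) * pds bs u z + (\<Sum>l\<leftarrow>removals c bs. pds l u z)\<bar> \<le> R * (weight bs * ?A) + weight bs * ?A"
    by linarith
  then show "\<bar>pds bs (\<lambda>z. (z \<bullet> c) * u z) z\<bar> \<le> weight bs * ((R + 1) * ?A)"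
    unfolding smooth_coord(2)[OF sm c bs] by (simp add: algebra_simps)
qed

lemma jet_bound_add_cmult:
  assumes "jet_bound R a u" "jet_bound R b v"
  shows "jet_bound R (\<lambda>m. \<bar>k\<bar> * a m + b m) (\<lambda>z. k * u z + v z)"
proof (rule jet_boundI)
  note sm = assms[THEN jet_bound_smooth]
  show "smooth (\<lambda>z. k * u z + v z)" by (intro smooth_add smooth_cmult sm)
  fix bs :: "'a list" and z :: 'a
  assume bs: "bs \<in> lists Basis" and z: "\<And>c. c \<in> Basis \<Longrightarrow> \<bar>z \<bullet> c\<bar> \<le> R"
  have "\<bar>k * pds bs u z\<bar> \<le> \<bar>k\<bar> * (weight bs * a (length bs))"
    unfolding abs_mult using jet_boundD[OF assms(1) bs z] by (intro mult_left_mono) auto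
  then have "\<bar>k * pds bs u z + pds bs v z\<bar> \<le> \<bar>k\<bar> * (weight bs * a (length bs)) + weight bs * b (length bs)"
    using jet_boundD[OF assms(2) bs z] by linarith
  then show "\<bar>pds bs (\<lambda>z. k * u z + v z) z\<bar> \<le> weight bs * (\<bar>k\<bar> * a (length bs) + b (length bs))"
    unfolding smooth_add(2)[OF smooth_cmult(1)[OF sm(1)] sm(2) bs] smooth_cmult(2)[OF sm(1) bs]
    by (simp add: algebra_simps)
qed

text \<open>The radius is \<open>R + 1\<close> because each multiplication by a coordinate costs
  that factor in \<open>jet_bound_coord\<close>.\<close>

definition poly_norm :: "real \<Rightarrow> real poly \<Rightarrow> real" where
  "poly_norm R q = poly (map_poly abs q) (R + 1)"

lemma poly_norm_pCons: "poly_norm R (pCons k q) = \<bar>k\<bar> + (R + 1) * poly_norm R q"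
  by (simp add: poly_norm_def map_poly_pCons)

lemma poly_norm_0: "poly_norm R 0 = 0"
  by (simp add: poly_norm_def)

lemma poly_norm_nonneg: "0 \<le> R \<Longrightarrow> 0 \<le> poly_norm R q"
  by (induction q) (auto simp: poly_norm_pCons poly_norm_0)

lemma jet_bound_poly:
  assumes u: "jet_bound R a u" and c: "c \<in> Basis" and a: "\<And>m. 0 \<le> a m" "mono a" and R: "0 \<le> R"
  shows "jet_bound R (\<lambda>m. poly_norm R q * a m) (\<lambda>z. poly q (z \<bullet> c) * u z)"
proof (induction q)
  case 0
  then show ?case by (auto simp: jet_bound_def poly_norm_0 pds_zero)
next
  case (pCons k q)
  have "jet_bound R (\<lambda>m. (R + 1) * (poly_norm R q * a m)) (\<lambda>z. (z \<bullet> c) * (poly q (z \<bullet> c) * u z))"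
    by (rule jet_bound_coord[OF pCons(2) c])
      (use a poly_norm_nonneg[OF R, of q] in \<open>auto intro!: mult_left_mono monoI dest: monoD\<close>)
  from jet_bound_add_cmult[OF u this, of k] show ?case
    by (simp add: poly_norm_pCons algebra_simps)
qed

lemma jet_bound_mono:
  assumes "jet_bound R a u" "\<And>m. a m \<le> b m"
  shows "jet_bound R b u"
  using assms weight_pos unfolding jet_bound_def
  by (meson less_imp_le mult_left_mono order_trans)

lemma jet_bound_dquots:
  assumes "jet_bound R a u" "c \<in> Basis" "\<And>x. x \<in> set xs \<Longrightarrow> \<bar>x\<bar> \<le> R"
  shows "jet_bound R (\<lambda>m. a (m + length xs)) (dquots c xs u)"
  using assms
proof (induction xs arbitrary: a u)
  case (Cons x xs)
  show ?case
    using Cons.IH[OF jet_bound_dquot[OF Cons.prems(1,2), of x]] Cons.prems by simp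
qed simp

lemma jet_bound_ddiff:
  assumes "jet_bound R a u" "c \<in> Basis" "\<And>x. x \<in> set xs \<Longrightarrow> \<bar>x\<bar> \<le> R" "xs \<noteq> []" "\<And>m. 0 \<le> a m"
  shows "jet_bound R (\<lambda>m. a (m + (length xs - 1))) (ddiff c xs u)"
  unfolding ddiff_def
  using jet_bound_ev[OF jet_bound_dquots[OF assms(1,2), of "butlast xs"] assms(2), of "last xs"] assms
  by (auto dest: in_set_butlastD)

section \<open>Words of operators and their derivatives in the nodes\<close>

text \<open>A letter acts on functions of several variables through one variable: it takes the quotient
  of the division by the node polynomial, takes the divided difference at the nodes, or multiplies by a polynomial.\<close>

datatype 'a letter = Quo 'a | Dif 'a | Mul 'a "real poly"

fun act :: "('a::euclidean_space \<Rightarrow> real list) \<Rightarrow> 'a letter \<Rightarrow> ('a \<Rightarrow> real) \<Rightarrow> 'a \<Rightarrow> real" where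
  "act X (Quo c) u = dquots c (X c) u"
| "act X (Dif c) u = ddiff c (X c) u"
| "act X (Mul c q) u = (\<lambda>z. poly q (z \<bullet> c) * u z)"

fun run :: "('a::euclidean_space \<Rightarrow> real list) \<Rightarrow> 'a letter list \<Rightarrow> ('a \<Rightarrow> real) \<Rightarrow> 'a \<Rightarrow> real" where
  "run X [] u = u"
| "run X (l # w) u = act X l (run X w u)"

fun lvar :: "'a letter \<Rightarrow> 'a" where
  "lvar (Quo c) = c" | "lvar (Dif c) = c" | "lvar (Mul c q) = c"

lemma run_append: "run X (w1 @ w2) u = run X w1 (run X w2 u)"
  by (induction w1) auto

lemma smooth_act: "smooth u \<Longrightarrow> lvar l \<in> Basis \<Longrightarrow> smooth (act X l u)"
  by (cases l) (auto intro: smooth_dquots smooth_ddiff smooth_poly)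

lemma smooth_run: "smooth u \<Longrightarrow> lvar ` set w \<subseteq> Basis \<Longrightarrow> smooth (run X w u)"
  by (induction w) (auto intro: smooth_act)

lemma act_lin:
  "smooth u \<Longrightarrow> smooth v \<Longrightarrow> lvar l \<in> Basis \<Longrightarrow>
    act X l (\<lambda>z. u z + k * v z) = (\<lambda>z. act X l u z + k * act X l v z)"
  by (cases l) (auto simp: dquots_lin ddiff_lin algebra_simps)

lemma act_zero: "lvar l \<in> Basis \<Longrightarrow> act X l (\<lambda>_. 0) = (\<lambda>_. 0)"
  by (cases l) (auto simp: dquots_zero ddiff_zero)

lemma run_zero: "lvar ` set w \<subseteq> Basis \<Longrightarrow> run X w (\<lambda>_. 0) = (\<lambda>_. 0)"
  by (induction w) (auto simp: act_zero)

text \<open>The list of node functions is fixed while the parameter moves, so the number of nodes is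
  constant and positive along the family.\<close>

definition cont_nodes :: "'p::topological_space set \<Rightarrow> ('p \<Rightarrow> 'a::euclidean_space \<Rightarrow> real list) \<Rightarrow> bool" where
  "cont_nodes S X \<longleftrightarrow> (\<forall>c\<in>Basis. \<exists>fs. fs \<noteq> [] \<and> (\<forall>f\<in>set fs. continuous_on S f) \<and> (\<forall>p. X p c = map (\<lambda>f. f p) fs))"

lemma smooth_fam_act:
  assumes "smooth_fam S u" "lvar l \<in> Basis" "cont_nodes S X"
  shows "smooth_fam S (\<lambda>p. act (X p) l (u p))"
proof -
  obtain fs where fs: "fs \<noteq> []" "\<And>f. f \<in> set fs \<Longrightarrow> continuous_on S f" "\<And>p. X p (lvar l) = map (\<lambda>f. f p) fs"
    using assms(2,3) unfolding cont_nodes_def by metis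
  show ?thesis
    using smooth_fam_dquots[OF assms(1,2), of fs "\<lambda>f. f"] smooth_fam_ddiff[OF assms(1,2), of fs "\<lambda>f. f"]
      smooth_fam_poly[OF assms(1,2)] fs assms(2)
    by (cases l) (auto simp: smooth_fam_zero)
qed

lemma smooth_fam_run:
  "smooth_fam S u \<Longrightarrow> lvar ` set w \<subseteq> Basis \<Longrightarrow> cont_nodes S X \<Longrightarrow> smooth_fam S (\<lambda>p. run (X p) w (u p))"
  by (induction w) (auto intro: smooth_fam_act)

text \<open>Words act from right to left: a quotient at the same nodes, multiplication by
  \<open>- v\<close>, then the old letter, as in the first-order term of
  \<open>dquots_resolvent\<close>. Keeping the sign in the multiplier leaves words without
  coefficients. \<open>None\<close> marks letters that do not see the moving nodes.\<close>

fun letter_deriv :: "'a set \<Rightarrow> real poly \<Rightarrow> 'a letter \<Rightarrow> 'a letter list option" where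
  "letter_deriv J v (Quo c) = (if c \<in> J then Some [Quo c, Mul c (- v), Quo c] else None)"
| "letter_deriv J v (Dif c) = (if c \<in> J then Some [Dif c, Mul c (- v), Quo c] else None)"
| "letter_deriv J v (Mul c q) = None"

text \<open>If the node polynomials of the variables in \<open>J\<close> move in the direction \<open>v\<close>, the resolvent identity
  \<open>dquots_resolvent\<close> differentiates a letter into a word, so the derivative of a word is a sum of words.\<close>

fun word_deriv :: "'a set \<Rightarrow> real poly \<Rightarrow> 'a letter list \<Rightarrow> 'a letter list list" where
  "word_deriv J v [] = []"
| "word_deriv J v (l # w) = (case letter_deriv J v l of None \<Rightarrow> [] | Some l' \<Rightarrow> [l' @ w]) @ map ((#) l) (word_deriv J v w)"

text \<open>The difference quotient of \<^term>\<open>run\<close> in the nodes: letters left of the varied one use the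
  new nodes, letters right of it the old ones.\<close>

fun run_quot :: "('a::euclidean_space \<Rightarrow> real list) \<Rightarrow> ('a \<Rightarrow> real list) \<Rightarrow> 'a set \<Rightarrow> real poly \<Rightarrow>
    'a letter list \<Rightarrow> ('a \<Rightarrow> real) \<Rightarrow> 'a \<Rightarrow> real" where
  "run_quot X' X J v [] u = (\<lambda>z. 0)"
| "run_quot X' X J v (l # w) u = (\<lambda>z.
     (if letter_deriv J v l = None then 0
      else act X' l (act X' (Mul (lvar l) (- v)) (act X (Quo (lvar l)) (run X w u))) z)
     + 1 * act X' l (run_quot X' X J v w u) z)"

lemma smooth_run_quot:
  "smooth u \<Longrightarrow> lvar ` set w \<subseteq> Basis \<Longrightarrow> smooth (run_quot X' X J v w u)"
proof (induction w)
  case (Cons l w)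
  then have "lvar l \<in> Basis" by auto
  moreover have w: "lvar ` set w \<subseteq> Basis" using Cons by auto
  ultimately have 1: "smooth (act X' l (run_quot X' X J v w u))"
    using Cons by (intro smooth_act) auto
  have "smooth (act X' l (act X' (Mul (lvar l) (- v)) (act X (Quo (lvar l)) (run X w u))))"
    by (intro smooth_act smooth_run Cons.prems w) (use \<open>lvar l \<in> Basis\<close> in auto)
  from smooth_add(1)[OF this 1] 1 show ?case
    by (cases "letter_deriv J v l = None") (simp_all only: run_quot.simps simp_thms if_True if_False add_0 mult_1)
qed simp

lemma smooth_fam_run_quot:
  assumes "smooth u" "lvar ` set w \<subseteq> Basis" "cont_nodes S X'"
  shows "smooth_fam S (\<lambda>p. run_quot (X' p) X J v w u)"
  using assms(2)
proof (induction w)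
  case (Cons l w)
  then have l: "lvar l \<in> Basis" and w: "lvar ` set w \<subseteq> Basis" by auto
  have 1: "smooth_fam S (\<lambda>p. act (X' p) l (run_quot (X' p) X J v w u))"
    by (intro smooth_fam_act Cons.IH l w assms)
  show ?case
  proof (cases "letter_deriv J v l = None")
    case True
    with 1 show ?thesis by simp
  next
    case False
    have "smooth_fam S (\<lambda>p. act (X' p) l (act (X' p) (Mul (lvar l) (- v)) (act X (Quo (lvar l)) (run X w u))))"
      by (intro smooth_fam_act smooth_fam_const smooth_act smooth_run assms w) (use l in auto)
    from smooth_fam_add(1)[OF this 1] False show ?thesis
      by (simp only: run_quot.simps if_False mult_1)
  qed
qed simp

text \<open>A discrete product rule: \<open>dquots_resolvent\<close>, applied to one letter at a
  time, telescopes the increment exactly.\<close>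

lemma run_diff:
  assumes u: "smooth u" and w: "lvar ` set w \<subseteq> Basis"
    and J: "\<And>c. c \<in> Basis \<Longrightarrow> c \<in> J \<Longrightarrow> length (X' c) = length (X c) \<and> X c \<noteq> [] \<and>
      (\<forall>t. poly (node_poly (X' c)) t = poly (node_poly (X c)) t + s * poly v t)"
    and nJ: "\<And>c. c \<in> Basis \<Longrightarrow> c \<notin> J \<Longrightarrow> X' c = X c"
  shows "run X' w u z = run X w u z + s * run_quot X' X J v w u z"
  using w
proof (induction w arbitrary: z)
  case (Cons l w)
  then have l: "lvar l \<in> Basis" and w: "lvar ` set w \<subseteq> Basis" by auto
  let ?r = "run X w u"
  have sm: "smooth ?r" "smooth (run_quot X' X J v w u)"
    by (auto intro!: smooth_run smooth_run_quot u w)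
  have IH: "run X' w u = (\<lambda>z. ?r z + s * run_quot X' X J v w u z)"
    using Cons.IH[OF w] by blast
  have E: "act X' l ?r z = act X l ?r z + s * (if letter_deriv J v l = None then 0
      else act X' l (act X' (Mul (lvar l) (- v)) (act X (Quo (lvar l)) ?r)) z)"
  proof (cases "lvar l \<in> J")
    case False
    then show ?thesis using nJ[OF l] by (cases l) auto
  next
    case True
    note J = J[OF l True]
    have p: "poly (node_poly (X' (lvar l))) t = poly (node_poly (X (lvar l))) t + (- s) * poly (- v) t" for t
      using J by simp
    note R = dquots_resolvent[OF sm(1) l conjunct1[OF J] p]
    show ?thesis
      using R(1)[of z] R(2)[of z] J True by (cases l) auto
  qed
  show ?case
    unfolding run.simps IH act_lin[OF sm l] E by (simp add: algebra_simps)
qed simp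

lemma sum_list_act:
  assumes "lvar l \<in> Basis" "\<And>x. x \<in> set xs \<Longrightarrow> smooth (f x)"
  shows "act X l (\<lambda>z. \<Sum>x\<leftarrow>xs. f x z) z = (\<Sum>x\<leftarrow>xs. act X l (f x) z)"
  using assms(2)
proof (induction xs arbitrary: z)
  case Nil
  then show ?case using act_zero[OF assms(1)] by simp
next
  case (Cons x xs)
  have "smooth (\<lambda>z. \<Sum>x\<leftarrow>xs. f x z)"
    using Cons.prems by (induction xs) (auto intro!: smooth_add)
  then show ?case
    using act_lin[OF _ _ assms(1), of "f x" "\<lambda>z. \<Sum>x\<leftarrow>xs. f x z" X 1] Cons by simp
qed

lemma letter_deriv_lvar: "letter_deriv J v l = Some l' \<Longrightarrow> lvar ` set l' = {lvar l}"
  by (cases l) (auto split: if_splits)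

lemma word_deriv_lvar:
  "w' \<in> set (word_deriv J v w) \<Longrightarrow> lvar ` set w' \<subseteq> lvar ` set w"
proof (induction w arbitrary: w')
  case (Cons l w)
  then consider l' where "letter_deriv J v l = Some l'" "w' = l' @ w"
    | w'' where "w'' \<in> set (word_deriv J v w)" "w' = l # w''"
    by (cases "letter_deriv J v l") auto
  then show ?case
  proof cases
    case 1
    then show ?thesis using letter_deriv_lvar[OF 1(1)] by (simp add: image_Un)
  next
    case 2
    then show ?thesis using Cons.IH[OF 2(1)] by (simp add: subset_insertI2)
  qed
qed simp

lemma run_quot_diag:
  assumes "smooth u" "lvar ` set w \<subseteq> Basis"
  shows "run_quot X X J v w u z = (\<Sum>w'\<leftarrow>word_deriv J v w. run X w' u z)"
  using assms(2)
proof (induction w arbitrary: z)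
  case (Cons l w)
  then have l: "lvar l \<in> Basis" and w: "lvar ` set w \<subseteq> Basis" by auto
  have IH: "run_quot X X J v w u = (\<lambda>z. \<Sum>w'\<leftarrow>word_deriv J v w. run X w' u z)"
    using Cons.IH[OF w] by blast
  have 1: "act X l (run_quot X X J v w u) z = (\<Sum>w'\<leftarrow>map ((#) l) (word_deriv J v w). run X w' u z)"
  proof -
    have "smooth (run X w' u)" if "w' \<in> set (word_deriv J v w)" for w'
      using smooth_run[OF assms(1)] word_deriv_lvar[OF that] w by (meson order_trans)
    from sum_list_act[OF l this] show ?thesis
      unfolding IH by (simp add: o_def)
  qed
  show ?case
    unfolding run_quot.simps word_deriv.simps map_append sum_list_append 1
    by (cases l) simp_all
qed simp

text \<open>\<open>run_diff\<close> writes the increment as \<open>s\<close> times a function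
  continuous in \<open>s\<close>, so Caratheodory's criterion gives the derivative as its value
  where old and new nodes agree. The nodes are merely continuous in \<open>s\<close>; it is their
  polynomials that move linearly.\<close>

lemma run_has_derivative:
  assumes u: "smooth u" and w: "lvar ` set w \<subseteq> Basis" and S: "open S" "0 \<in> S"
    and X: "cont_nodes S X"
    and J: "\<And>c s. s \<in> S \<Longrightarrow> c \<in> Basis \<Longrightarrow> c \<in> J \<Longrightarrow>
      (\<forall>t. poly (node_poly (X s c)) t = poly (node_poly (X 0 c)) t + s * poly v t)"
    and nJ: "\<And>c s. s \<in> S \<Longrightarrow> c \<in> Basis \<Longrightarrow> c \<notin> J \<Longrightarrow> X s c = X 0 c"
  shows "((\<lambda>s. run (X s) w u z) has_real_derivative (\<Sum>w'\<leftarrow>word_deriv J v w. run (X 0) w' u z)) (at 0)"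
proof -
  let ?q = "\<lambda>s. run_quot (X s) (X 0) J v w u z"
  have len: "length (X s c) = length (X 0 c) \<and> X 0 c \<noteq> []" if c: "c \<in> Basis" for s c
  proof -
    obtain fs where "fs \<noteq> []" "\<forall>p. X p c = map (\<lambda>f. f p) fs"
      using X[unfolded cont_nodes_def, rule_format, OF c] by blast
    then show ?thesis by simp
  qed
  have E: "run (X s) w u z = run (X 0) w u z + s * ?q s" if "s \<in> S" for s
    by (rule run_diff[OF u w]) (use len J[OF that] nJ[OF that] in blast)+
  have "continuous_on S ?q"
    by (rule smooth_fam_compose0[OF smooth_fam_run_quot[OF u w X], where g = "\<lambda>s. s" and h = "\<lambda>_. z"])
      (auto intro: continuous_intros)
  then have "isCont ?q 0" using S by (simp add: continuous_on_eq_continuous_at)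
  then have "((\<lambda>s. run (X 0) w u z + s * ?q s) has_real_derivative ?q 0) (at 0)"
    unfolding CARAT_DERIV by (intro exI[of _ ?q] conjI allI) simp_all
  then have "((\<lambda>s. run (X s) w u z) has_real_derivative ?q 0) (at 0)"
    by (rule has_field_derivative_transform_within_open[OF _ S E[symmetric]])
  then show ?thesis
    unfolding run_quot_diag[OF u w] .
qed

section \<open>Loss of derivatives along a word\<close>

lemma node_poly_mset: "mset xs = mset ys \<Longrightarrow> node_poly xs = node_poly ys"
  unfolding node_poly_def by (metis mset_map prod_mset_prod_list)

text \<open>What repeated differentiation makes of the single letter \<open>Dif c\<close>: each
  entry of \<open>qs\<close> is the direction of one derivative and brings one more division by the
  node polynomial.\<close>

definition chain :: "'a \<Rightarrow> real poly list \<Rightarrow> 'a letter list" where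
  "chain c qs = Dif c # concat (map (\<lambda>q. [Mul c q, Quo c]) qs)"

text \<open>In each variable the weight \<open>W c\<close> acts before the chain. Empty
  \<open>Q\<close> gives the word of the representation formula, and differentiation changes only
  \<open>Q\<close>.\<close>

definition bword :: "'a list \<Rightarrow> ('a \<Rightarrow> real poly list) \<Rightarrow> ('a \<Rightarrow> real poly) \<Rightarrow> 'a letter list" where
  "bword cs Q W = concat (map (\<lambda>c. chain c (Q c) @ [Mul c (W c)]) cs)"

lemma chain_append: "chain c (qs @ qs') = chain c qs @ concat (map (\<lambda>q. [Mul c q, Quo c]) qs')"
  by (simp add: chain_def)

lemma lvar_chain: "lvar ` set (chain c qs) = {c}"
  by (auto simp: chain_def)

lemma lvar_bword: "lvar ` set (bword cs Q W) = set cs"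
proof (induction cs)
  case (Cons c cs)
  have "bword (c # cs) Q W = chain c (Q c) @ [Mul c (W c)] @ bword cs Q W" by (simp add: bword_def)
  then show ?case using Cons lvar_chain[of c "Q c"] by (simp add: image_Un)
qed (simp add: bword_def)

lemma jet_bound_poly_le:
  assumes "jet_bound R a u" "c \<in> Basis" "\<And>m. 0 \<le> a m" "mono a" "0 \<le> R" "poly_norm R q \<le> L"
  shows "jet_bound R (\<lambda>m. L * a m) (\<lambda>z. poly q (z \<bullet> c) * u z)"
  by (rule jet_bound_mono[OF jet_bound_poly[OF assms(1-5)]]) (use assms in \<open>auto intro: mult_right_mono\<close>)

lemma mono_shift:
  fixes a :: "nat \<Rightarrow> real"
  assumes "mono a" "0 \<le> L"
  shows "mono (\<lambda>m. L * a (m + k))"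
  using assms(2) by (intro monoI mult_left_mono monoD[OF assms(1)]) auto

text \<open>Each quotient costs \<open>n\<close> derivatives; the closing divided difference costs
  \<open>n - 1\<close>, its last node being only evaluated.\<close>

lemma chain_bound:
  fixes X :: "'a::euclidean_space \<Rightarrow> real list"
  assumes "jet_bound R a u" and c: "c \<in> Basis" and "\<And>m. 0 \<le> a m" "mono a" and R: "0 \<le> R" and L: "0 \<le> L"
    and X: "length (X c) = n" "0 < n" "\<And>x. x \<in> set (X c) \<Longrightarrow> \<bar>x\<bar> \<le> R"
    and "\<And>q. q \<in> set qs \<Longrightarrow> poly_norm R q \<le> L"
  shows "jet_bound R (\<lambda>m. L ^ length qs * a (m + (n * length qs + (n - 1)))) (run X (chain c qs) u)"
  using assms(1,3,4,10)
proof (induction qs arbitrary: a u rule: rev_induct)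
  case Nil
  have "X c \<noteq> []" using X by auto
  from jet_bound_ddiff[OF Nil(1) c, of "X c", OF X(3) this Nil(2)] show ?case
    using X by (simp add: chain_def)
next
  case (snoc q qs)
  have "jet_bound R (\<lambda>m. L * a (m + n)) (run X [Mul c q, Quo c] u)"
    using jet_bound_poly_le[OF jet_bound_dquots[OF snoc.prems(1) c, of "X c", OF X(3)] c _ _ R, where q = q and L = L] snoc.prems X
      mono_shift[OF snoc.prems(3), of 1 n] by simp
  from snoc.IH[OF this] snoc.prems L mono_shift[OF snoc.prems(3) L, of n] show ?case
    by (simp add: chain_append run_append algebra_simps)
qed

text \<open>Multiplication by a partial node polynomial \<open>W\<close> cancels the nodes it contains, which offsets
  the loss of derivatives by \<open>i - j\<close>; summed over a permutation these offsets vanish.\<close>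

lemma chain_weight_bound:
  fixes X :: "'a::euclidean_space \<Rightarrow> real list"
  assumes u: "jet_bound R a u" and c: "c \<in> Basis" and a: "\<And>m. 0 \<le> a m" "mono a" and R: "0 \<le> R" and L: "0 \<le> L"
    and X: "length (X c) = n" "\<And>x. x \<in> set (X c) \<Longrightarrow> \<bar>x\<bar> \<le> R"
    and qs: "\<And>q. q \<in> set qs \<Longrightarrow> poly_norm R q \<le> L"
    and ij: "i < n" "j < n" and W: "W = node_poly (take j (X c) @ drop (Suc i) (X c))"
  shows "run X (chain c qs @ [Mul c W]) u = (\<lambda>_. 0) \<or>
    (\<exists>r. r + j = n * length qs + i \<and>
      jet_bound R (\<lambda>m. L ^ length qs * a (m + r)) (run X (chain c qs @ [Mul c W]) u))"
proof -
  define xs where "xs = X c"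
  have n: "0 < n" "xs \<noteq> []" "length xs = n" using ij X by (auto simp: xs_def)
  have xR: "\<And>x. x \<in> set xs \<Longrightarrow> \<bar>x\<bar> \<le> R" using X by (simp add: xs_def)
  note su = jet_bound_smooth[OF u]
  define Y where "Y = take j xs @ drop (Suc i) xs"
  have W: "W = node_poly Y" using W by (simp add: Y_def xs_def)
  note CB = chain_bound[where X = X, OF _ c _ _ R L X(1) n(1) X(2)]
  show ?thesis
  proof (cases "j \<le> i")
    case True
    \<comment> \<open>\<open>W\<close> is a product over part of the nodes. The
      \<open>i + 1 - j\<close> nodes in \<open>Z\<close> are all that remains of the operator
      applied right after \<open>W\<close>.\<close>
    define Z where "Z = drop j (take (Suc i) xs)"
    have lZ: "length Z = i + 1 - j" "Z \<noteq> []" using ij n True by (auto simp: Z_def)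
    have ZR: "\<And>x. x \<in> set Z \<Longrightarrow> \<bar>x\<bar> \<le> R"
      using xR by (auto simp: Z_def dest!: in_set_dropD in_set_takeD)
    have "xs = take j xs @ Z @ drop (Suc i) xs"
      unfolding Z_def using True append_take_drop_id[of "Suc i" xs] append_take_drop_id[of j "take (Suc i) xs"]
      by (metis append.assoc le_SucI min.absorb1 take_take)
    then have m: "mset xs = mset (Y @ Z)"
      unfolding Y_def by (metis mset_append union_assoc union_commute)
    have smW: "smooth (\<lambda>z. poly (node_poly Y) (z \<bullet> c) * u z)" by (intro smooth_poly su c)
    show ?thesis
    proof (cases qs rule: rev_cases)
      case Nil
      have "run X (chain c qs @ [Mul c W]) u = ddiff c xs (\<lambda>z. poly (node_poly Y) (z \<bullet> c) * u z)"
        by (simp add: Nil chain_def W xs_def)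
      also have "\<dots> = ddiff c Z u"
        using ddiff_perm[OF m n(2) smW c] ddiff_node_poly[OF su c lZ(2)] by simp
      finally have "jet_bound R (\<lambda>m. a (m + (i - j))) (run X (chain c qs @ [Mul c W]) u)"
        using jet_bound_ddiff[OF u c, of Z, OF ZR lZ(2) a(1)] lZ True by (simp add: Suc_diff_le)
      then show ?thesis using Nil True by (intro disjI2 exI[of _ "i - j"]) simp
    next
      case (snoc qs' q)
      have "dquots c xs (\<lambda>z. poly (node_poly Y) (z \<bullet> c) * u z) = dquots c Z u"
        using dquots_perm[OF m smW c] dquots_node_poly[OF su c] by simp
      then have 1: "run X (chain c qs @ [Mul c W]) u = run X (chain c qs') (\<lambda>z. poly q (z \<bullet> c) * dquots c Z u z)"
        by (simp add: snoc chain_append W xs_def run_append)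
      have "jet_bound R (\<lambda>m. L * a (m + (i + 1 - j))) (\<lambda>z. poly q (z \<bullet> c) * dquots c Z u z)"
        using jet_bound_poly_le[OF jet_bound_dquots[OF u c, of Z, OF ZR] c _ _ R, where q = q and L = L] a mono_shift[OF a(2), of 1] qs snoc lZ by simp
      from CB[OF this _ mono_shift[OF a(2) L], of qs'] a L qs snoc
      have "jet_bound R (\<lambda>m. L ^ length qs' * (L * a (m + (n * length qs' + (n - 1)) + (i + 1 - j))))
         (run X (chain c qs') (\<lambda>z. poly q (z \<bullet> c) * dquots c Z u z))" by simp
      then have "jet_bound R (\<lambda>m. L ^ length qs * a (m + (n * length qs' + (n - 1) + (i + 1 - j))))
         (run X (chain c qs @ [Mul c W]) u)" unfolding 1 by (simp add: snoc mult_ac add_ac)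
      then show ?thesis
        using n True by (intro disjI2 exI[of _ "n * length qs' + (n - 1) + (i + 1 - j)"]) (simp add: snoc)
    qed
  next
    case False
    \<comment> \<open>Now \<open>W\<close> contains every node, and those in \<open>E\<close> twice.
      One full set cancels the first operator entirely; the leftover factors of \<open>E\<close>
      cancel nodes of the next operator, of which \<open>Z\<close> remain.\<close>
    define E where "E = drop (Suc i) (take j xs)"
    define Z where "Z = take (Suc i) xs @ drop j xs"
    have tj: "take j xs = take (Suc i) xs @ E"
      unfolding E_def using False append_take_drop_id[of "Suc i" "take j xs"] by (simp add: min_def)
    have xs: "xs = take (Suc i) xs @ E @ drop j xs"
      using append_take_drop_id[of j xs] tj by (metis append.assoc)
    have lZ: "length Z = Suc i + (n - j)" "Z \<noteq> []" using ij n False by (auto simp: Z_def)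
    have ZR: "\<And>x. x \<in> set Z \<Longrightarrow> \<bar>x\<bar> \<le> R"
      using xR by (auto simp: Z_def dest!: in_set_dropD in_set_takeD)
    have m: "mset xs = mset (E @ Z)"
      unfolding Z_def by (subst xs) simp
    have "mset Y = mset (take (Suc i) xs @ drop (Suc i) xs) + mset E"
      unfolding Y_def tj mset_append by (simp only: ac_simps)
    then have "mset Y = mset xs + mset E" unfolding append_take_drop_id .
    then have "mset Y = mset (xs @ E)" by simp
    then have WE: "poly W t = poly (node_poly xs) t * poly (node_poly E) t" for t
      using node_poly_mset[of Y "xs @ E"] by (simp add: W)
    define v where "v = (\<lambda>z. poly (node_poly E) (z \<bullet> c) * u z)"
    have v: "smooth v" unfolding v_def by (intro smooth_poly su c)
    have Wv: "run X [Mul c W] u = (\<lambda>z. poly (node_poly xs) (z \<bullet> c) * v z)"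
      by (simp add: WE v_def mult.assoc)
    have A1: "run X [Quo c, Mul c W] u = v"
      using dquots_node_poly[OF v c, of xs "[]"] by (simp add: Wv[simplified] xs_def)
    show ?thesis
    proof (cases qs rule: rev_cases)
      case Nil
      \<comment> \<open>The only operator is the divided difference, which kills multiples of the
        node polynomial. Since \<open>r + j = i\<close> has no solution here, zero has to be a
        separate alternative.\<close>
      then show ?thesis
        using ddiff_node_poly_all[OF v c n(2)] Wv by (simp add: chain_def xs_def)
    next
      case (snoc qs' q)
      have q: "jet_bound R (\<lambda>m. L * a m) (\<lambda>z. poly q (z \<bullet> c) * u z)"
        using jet_bound_poly_le[OF u c a R, where q = q and L = L] qs snoc by simp
      note sq = jet_bound_smooth[OF q]
      have qv: "run X [Mul c q, Quo c, Mul c W] u = (\<lambda>z. poly (node_poly E) (z \<bullet> c) * (poly q (z \<bullet> c) * u z))"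
        using A1 by (simp add: v_def mult_ac)
      have sqv: "smooth (\<lambda>z. poly (node_poly E) (z \<bullet> c) * (poly q (z \<bullet> c) * u z))"
        by (intro smooth_poly su c)
      show ?thesis
      proof (cases qs' rule: rev_cases)
        case Nil
        have "run X (chain c qs @ [Mul c W]) u = ddiff c xs (run X [Mul c q, Quo c, Mul c W] u)"
          by (simp add: snoc Nil chain_def xs_def)
        also have "\<dots> = ddiff c Z (\<lambda>z. poly q (z \<bullet> c) * u z)"
          unfolding qv using ddiff_perm[OF m n(2) sqv c] ddiff_node_poly[OF sq c lZ(2)] by simp
        finally have "jet_bound R (\<lambda>m. L * a (m + (i + (n - j)))) (run X (chain c qs @ [Mul c W]) u)"
          using jet_bound_ddiff[OF q c, of Z, OF ZR lZ(2)] a L lZ by simp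
        then show ?thesis using ij by (intro disjI2 exI[of _ "i + (n - j)"]) (simp add: snoc Nil)
      next
        case (snoc qs'' q')
        note s = \<open>qs = qs' @ [q]\<close> snoc
        have d: "dquots c xs (run X [Mul c q, Quo c, Mul c W] u) = dquots c Z (\<lambda>z. poly q (z \<bullet> c) * u z)"
          unfolding qv using dquots_perm[OF m sqv c] dquots_node_poly[OF sq c] by simp
        have "run X (chain c qs @ [Mul c W]) u = run X (chain c qs'') (\<lambda>z. poly q' (z \<bullet> c) * dquots c xs (run X [Mul c q, Quo c, Mul c W] u) z)"
          by (simp add: s chain_append run_append xs_def)
        then have 1: "run X (chain c qs @ [Mul c W]) u = run X (chain c qs'') (\<lambda>z. poly q' (z \<bullet> c) * dquots c Z (\<lambda>z. poly q (z \<bullet> c) * u z) z)"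
          unfolding d .
        have "jet_bound R (\<lambda>m. L * (L * a (m + length Z))) (\<lambda>z. poly q' (z \<bullet> c) * dquots c Z (\<lambda>z. poly q (z \<bullet> c) * u z) z)"
          using jet_bound_poly_le[OF jet_bound_dquots[OF q c, of Z, OF ZR] c _ _ R, where q = q' and L = L] a L mono_shift[OF a(2) L] qs s by simp
        then have "jet_bound R (\<lambda>m. (L * L) * a (m + length Z)) (\<lambda>z. poly q' (z \<bullet> c) * dquots c Z (\<lambda>z. poly q (z \<bullet> c) * u z) z)"
          by (simp add: mult.assoc)
        from CB[OF this _ mono_shift[OF a(2)], of qs''] a L qs s
        have "jet_bound R (\<lambda>m. L ^ length qs'' * (L * L * a (m + (n * length qs'' + (n - 1)) + length Z)))
           (run X (chain c qs'') (\<lambda>z. poly q' (z \<bullet> c) * dquots c Z (\<lambda>z. poly q (z \<bullet> c) * u z) z))" by simp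
        then have "jet_bound R (\<lambda>m. L ^ length qs * a (m + (n * length qs'' + (n - 1) + length Z)))
           (run X (chain c qs @ [Mul c W]) u)" unfolding 1 by (simp add: s mult_ac add_ac)
        then show ?thesis
          using n ij lZ by (intro disjI2 exI[of _ "n * length qs'' + (n - 1) + length Z"]) (simp add: s)
      qed
    qed
  qed
qed

text \<open>Losses and gains add up over the variables. The order \<open>r\<close> is given by an
  equation between sums because \<open>i c - j c\<close> may be negative for a single
  variable.\<close>

lemma bword_bound:
  fixes X :: "'a::euclidean_space \<Rightarrow> real list"
  assumes u: "jet_bound R a u" and a: "\<And>m. 0 \<le> a m" "mono a" and R: "0 \<le> R" and L: "0 \<le> L"
    and X: "\<And>c. c \<in> Basis \<Longrightarrow> length (X c) = n" "\<And>c x. c \<in> Basis \<Longrightarrow> x \<in> set (X c) \<Longrightarrow> \<bar>x\<bar> \<le> R"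
    and Q: "\<And>c q. q \<in> set (Q c) \<Longrightarrow> poly_norm R q \<le> L"
    and ij: "\<And>c. c \<in> Basis \<Longrightarrow> i c < n" "\<And>c. c \<in> Basis \<Longrightarrow> j c < n"
    and W: "\<And>c. c \<in> Basis \<Longrightarrow> W c = node_poly (take (j c) (X c) @ drop (Suc (i c)) (X c))"
    and cs: "set cs \<subseteq> Basis"
  shows "run X (bword cs Q W) u = (\<lambda>_. 0) \<or>
    (\<exists>r. r + (\<Sum>c\<leftarrow>cs. j c) = n * (\<Sum>c\<leftarrow>cs. length (Q c)) + (\<Sum>c\<leftarrow>cs. i c) \<and>
      jet_bound R (\<lambda>m. L ^ (\<Sum>c\<leftarrow>cs. length (Q c)) * a (m + r)) (run X (bword cs Q W) u))"
  using cs
proof (induction cs)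
  case Nil
  then show ?case using u by (simp add: bword_def)
next
  case (Cons c cs)
  have c: "c \<in> Basis" using Cons by simp
  let ?k = "\<Sum>c\<leftarrow>cs. length (Q c)"
  have E: "run X (bword (c # cs) Q W) u = run X (chain c (Q c) @ [Mul c (W c)]) (run X (bword cs Q W) u)"
    by (simp add: bword_def run_append)
  consider "run X (bword cs Q W) u = (\<lambda>_. 0)" |
    r where "r + (\<Sum>c\<leftarrow>cs. j c) = n * ?k + (\<Sum>c\<leftarrow>cs. i c)"
      "jet_bound R (\<lambda>m. L ^ ?k * a (m + r)) (run X (bword cs Q W) u)"
    using Cons by auto
  then show ?case
  proof cases
    case 1
    have "lvar ` set (chain c (Q c) @ [Mul c (W c)]) \<subseteq> Basis" using lvar_chain[of c "Q c"] c by (simp add: image_Un)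
    from run_zero[OF this] show ?thesis unfolding E 1 by blast
  next
    case 2
    have "run X (bword (c # cs) Q W) u = (\<lambda>_. 0) \<or>
      (\<exists>r'. r' + j c = n * length (Q c) + i c \<and>
        jet_bound R (\<lambda>m. L ^ length (Q c) * (L ^ ?k * a (m + r' + r))) (run X (bword (c # cs) Q W) u))"
      unfolding E
      by (rule chain_weight_bound[where a = "\<lambda>m. L ^ ?k * a (m + r)" and c = c and qs = "Q c" and X = X
            and i = "i c" and j = "j c" and W = "W c" and n = n and R = R and L = L])
        (use 2(2) c R L X[OF c] Q ij[OF c] W[OF c] a mono_shift[OF a(2)] in \<open>simp_all\<close>)
    then show ?thesis
    proof (elim disjE exE conjE)
      fix r' assume r': "r' + j c = n * length (Q c) + i c"
        and b: "jet_bound R (\<lambda>m. L ^ length (Q c) * (L ^ ?k * a (m + r' + r))) (run X (bword (c # cs) Q W) u)"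
      have "jet_bound R (\<lambda>m. L ^ (\<Sum>c\<leftarrow>c # cs. length (Q c)) * a (m + (r' + r))) (run X (bword (c # cs) Q W) u)"
        using b by (simp add: power_add algebra_simps)
      moreover have "(r' + r) + (\<Sum>c\<leftarrow>c # cs. j c) = n * (\<Sum>c\<leftarrow>c # cs. length (Q c)) + (\<Sum>c\<leftarrow>c # cs. i c)"
        using r' 2(1) by (simp add: algebra_simps)
      ultimately show ?thesis by blast
    qed blast
  qed
qed

section \<open>Shape and number of the words produced by differentiation\<close>

lemma set_word_deriv_append:
  "set (word_deriv J v (w1 @ w2)) = (\<lambda>x. x @ w2) ` set (word_deriv J v w1) \<union> (\<lambda>x. w1 @ x) ` set (word_deriv J v w2)"
proof (induction w1)
  case (Cons l w1)
  then show ?case by (cases "letter_deriv J v l") (auto simp: image_Un image_image)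
qed simp

text \<open>Differentiating \<open>Dif c\<close> or one of the letters \<open>Quo c\<close>
  reproduces that letter followed by a pair \<open>Mul\<close>, \<open>Quo\<close>, which amounts to
  inserting one multiplier into \<open>qs\<close>. So chains are closed under
  differentiation.\<close>

lemma word_deriv_chain:
  assumes "w \<in> set (word_deriv J v (chain c qs))"
  shows "c \<in> J \<and> (\<exists>qs1 qs2. qs = qs1 @ qs2 \<and> w = chain c (qs1 @ (- v) # qs2))"
proof -
  let ?s = "\<lambda>qs. concat (map (\<lambda>q. [Mul c q, Quo c]) qs)"
  have S: "c \<in> J \<and> (\<exists>qs1 qs2. qs = qs1 @ qs2 \<and> w = ?s (qs1 @ (- v) # qs2))" if "w \<in> set (word_deriv J v (?s qs))" for w qs
    using that
  proof (induction qs arbitrary: w)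
    case (Cons q qs)
    then consider "c \<in> J" "w = ?s (q # (- v) # qs)" | w' where "w = [Mul c q, Quo c] @ w'" "w' \<in> set (word_deriv J v (?s qs))"
      by (auto split: if_splits)
    then show ?case
    proof cases
      case 1
      then have "q # qs = [q] @ qs \<and> w = ?s ([q] @ (- v) # qs)" by simp
      with 1(1) show ?thesis by blast
    next
      case 2
      from Cons.IH[OF 2(2)] obtain qs1 qs2 where "c \<in> J" "qs = qs1 @ qs2" "w' = ?s (qs1 @ (- v) # qs2)" by blast
      then have "c \<in> J" "q # qs = (q # qs1) @ qs2 \<and> w = ?s ((q # qs1) @ (- v) # qs2)" using 2(1) by simp_all
      then show ?thesis by blast
    qed
  qed simp
  from assms consider "c \<in> J" "w = chain c ((- v) # qs)" | w' where "w = Dif c # w'" "w' \<in> set (word_deriv J v (?s qs))"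
    by (auto simp: chain_def split: if_splits)
  then show ?thesis
  proof cases
    case 1
    then have "qs = [] @ qs \<and> w = chain c ([] @ (- v) # qs)" by simp
    with 1(1) show ?thesis by blast
  next
    case 2
    from S[OF 2(2)] 2(1) show ?thesis by (auto simp: chain_def)
  qed
qed

lemma word_deriv_bword:
  "distinct cs \<Longrightarrow> w \<in> set (word_deriv J v (bword cs Q W)) \<Longrightarrow>
    \<exists>c\<in>set cs \<inter> J. \<exists>qs1 qs2. Q c = qs1 @ qs2 \<and> w = bword cs (Q(c := qs1 @ (- v) # qs2)) W"
proof (induction cs arbitrary: w)
  case (Cons c cs)
  have E: "bword (c # cs) Q' W = chain c (Q' c) @ [Mul c (W c)] @ bword cs Q' W" for Q'
    by (simp add: bword_def)
  have upd: "bword cs (Q(c := x)) W = bword cs Q W" for x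
    using Cons.prems(1) unfolding bword_def by (intro arg_cong[where f = concat] map_cong) auto
  from Cons.prems(2) consider w1 where "w1 \<in> set (word_deriv J v (chain c (Q c)))" "w = w1 @ [Mul c (W c)] @ bword cs Q W"
    | w2 where "w2 \<in> set (word_deriv J v (bword cs Q W))" "w = chain c (Q c) @ [Mul c (W c)] @ w2"
    unfolding E set_word_deriv_append by auto
  then show ?case
  proof cases
    case 1
    from word_deriv_chain[OF 1(1)] obtain qs1 qs2 where "c \<in> J" "Q c = qs1 @ qs2" "w1 = chain c (qs1 @ (- v) # qs2)" by blast
    then have "Q c = qs1 @ qs2 \<and> w = bword (c # cs) (Q(c := qs1 @ (- v) # qs2)) W"
      using 1(2) by (simp add: E upd)
    then have "\<exists>qs1 qs2. Q c = qs1 @ qs2 \<and> w = bword (c # cs) (Q(c := qs1 @ (- v) # qs2)) W" by blast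
    then show ?thesis by (rule bexI[of _ c]) (use \<open>c \<in> J\<close> in simp)
  next
    case 2
    have "distinct cs" using Cons.prems(1) by simp
    from Cons.IH[OF this 2(1)] obtain d qs1 qs2 where d: "d \<in> set cs \<inter> J" "Q d = qs1 @ qs2"
      "w2 = bword cs (Q(d := qs1 @ (- v) # qs2)) W" by blast
    then have "d \<noteq> c" using Cons.prems(1) by auto
    then have "Q d = qs1 @ qs2 \<and> w = bword (c # cs) (Q(d := qs1 @ (- v) # qs2)) W"
      using 2(2) d by (simp add: E)
    then have "\<exists>qs1 qs2. Q d = qs1 @ qs2 \<and> w = bword (c # cs) (Q(d := qs1 @ (- v) # qs2)) W" by blast
    then show ?thesis by (rule bexI[of _ d]) (use d(1) in simp)
  qed
qed (simp add: bword_def)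

fun words :: "('a \<Rightarrow> 'a set) \<Rightarrow> ('a \<Rightarrow> real poly) \<Rightarrow> 'a letter list \<Rightarrow> 'a list \<Rightarrow> 'a letter list list" where
  "words J v w [] = [w]"
| "words J v w (b # bs) = concat (map (word_deriv (J b) (v b)) (words J v w bs))"

lemma words_lvar: "w' \<in> set (words J v w bs) \<Longrightarrow> lvar ` set w' \<subseteq> lvar ` set w"
proof (induction bs arbitrary: w')
  case (Cons b bs)
  then obtain w1 where w1: "w1 \<in> set (words J v w bs)" "w' \<in> set (word_deriv (J b) (v b) w1)" by auto
  show ?case by (rule order_trans[OF word_deriv_lvar[OF w1(2)] Cons.IH[OF w1(1)]])
qed simp

lemma words_bword:
  assumes "distinct cs"
  shows "w \<in> set (words J v (bword cs (\<lambda>_. []) W) bs) \<Longrightarrow>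
    \<exists>Q. w = bword cs Q W \<and> (\<Sum>c\<leftarrow>cs. length (Q c)) = length bs \<and> (\<forall>c. set (Q c) \<subseteq> (\<lambda>b. - v b) ` set bs)"
proof (induction bs arbitrary: w)
  case Nil
  then have "w = bword cs (\<lambda>_. []) W" by simp
  then show ?case by (intro exI[of _ "\<lambda>_. []"]) simp
next
  case (Cons b bs)
  from Cons.prems obtain w1 where w1: "w1 \<in> set (words J v (bword cs (\<lambda>_. []) W) bs)" "w \<in> set (word_deriv (J b) (v b) w1)"
    by (simp only: words.simps set_concat set_map) blast
  from Cons.IH[OF w1(1)] obtain Q where Q: "w1 = bword cs Q W" "(\<Sum>c\<leftarrow>cs. length (Q c)) = length bs"
    "\<forall>c. set (Q c) \<subseteq> (\<lambda>b. - v b) ` set bs" by (elim exE conjE)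
  from word_deriv_bword[OF assms w1(2)[unfolded Q(1)]] obtain c qs1 qs2 where
    c: "c \<in> set cs \<inter> J b" "Q c = qs1 @ qs2" "w = bword cs (Q(c := qs1 @ (- v b) # qs2)) W" by (elim bexE exE conjE)
  define Q' where "Q' = Q(c := qs1 @ (- v b) # qs2)"
  have Q': "Q' c = qs1 @ (- v b) # qs2" "\<And>d. d \<noteq> c \<Longrightarrow> Q' d = Q d" by (simp_all add: Q'_def)
  have "(\<Sum>c\<leftarrow>cs. length (Q' c)) = (\<Sum>d\<in>set cs. length (Q' d))"
    by (rule sum_list_distinct_conv_sum_set[OF assms])
  also have "\<dots> = length (Q' c) + (\<Sum>d\<in>set cs - {c}. length (Q' d))"
    using c(1) by (intro sum.remove) auto
  also have "(\<Sum>d\<in>set cs - {c}. length (Q' d)) = (\<Sum>d\<in>set cs - {c}. length (Q d))"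
    by (rule sum.cong) (use Q' in auto)
  also have "length (Q' c) + \<dots> = Suc (length (Q c) + \<dots>)"
    unfolding Q'(1) c(2) by simp
  also have "length (Q c) + (\<Sum>d\<in>set cs - {c}. length (Q d)) = (\<Sum>d\<in>set cs. length (Q d))"
    using c(1) by (intro sum.remove[symmetric]) auto
  also have "\<dots> = length bs"
    using Q(2) sum_list_distinct_conv_sum_set[OF assms, of "\<lambda>c. length (Q c)"] by simp
  finally have 1: "(\<Sum>c\<leftarrow>cs. length (Q' c)) = length (b # bs)" by simp
  have 2: "set (Q' d) \<subseteq> (\<lambda>b. - v b) ` set (b # bs)" for d
  proof (cases "d = c")
    case True
    have "set (qs1 @ qs2) \<subseteq> (\<lambda>b. - v b) ` set bs" using Q(3) c(2) by metis
    then show ?thesis unfolding True Q'(1) by auto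
  next
    case False
    then show ?thesis using Q(3) Q'(2)[OF False] by (simp add: subset_insertI2)
  qed
  show ?case
    using c(3)[folded Q'_def] 1 2 by (intro exI[of _ Q'] conjI allI)
qed

fun active :: "'a letter \<Rightarrow> bool" where
  "active (Mul c q) = False" | "active (Quo c) = True" | "active (Dif c) = True"

lemma length_word_deriv: "length (word_deriv J v w) \<le> length (filter active w)"
proof (induction w)
  case (Cons l w)
  then show ?case by (cases l) auto
qed simp

lemma active_word_deriv:
  "w' \<in> set (word_deriv J v w) \<Longrightarrow> length (filter active w') = Suc (length (filter active w))"
proof (induction w arbitrary: w')
  case (Cons l w)
  then show ?case by (cases l) (auto split: if_splits)
qed simp

lemma active_words:
  "w' \<in> set (words J v w bs) \<Longrightarrow> length (filter active w') = length bs + length (filter active w)"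
proof (induction bs arbitrary: w')
  case (Cons b bs)
  then obtain w1 where w1: "w1 \<in> set (words J v w bs)" "w' \<in> set (word_deriv (J b) (v b) w1)" by auto
  show ?case using Cons.IH[OF w1(1)] active_word_deriv[OF w1(2)] by simp
qed simp

text \<open>Each derivative picks an active letter and adds one, so the numbers of choices are
  bounded by consecutive integers. This count is the origin of the factor \<open>k!\<close> in the
  final estimate.\<close>

lemma length_words: "length (words J v w bs) \<le> fact (length (filter active w) + length bs)"
proof (induction bs)
  case Nil
  have "(1::nat) \<le> fact (length (filter active w))" by (rule fact_ge_1)
  then show ?case by simp
next
  case (Cons b bs)
  let ?N = "length (filter active w) + length bs"
  have "length (words J v w (b # bs)) = (\<Sum>w'\<leftarrow>words J v w bs. length (word_deriv (J b) (v b) w'))"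
    by (simp add: length_concat o_def)
  also have "\<dots> \<le> (\<Sum>w'\<leftarrow>words J v w bs. ?N)"
  proof (rule sum_list_mono)
    fix w' assume "w' \<in> set (words J v w bs)"
    from active_words[OF this] show "length (word_deriv (J b) (v b) w') \<le> ?N"
      using length_word_deriv[of "J b" "v b" w'] by simp
  qed
  also have "\<dots> = length (words J v w bs) * ?N" by (simp add: sum_list_triv)
  also have "\<dots> \<le> fact ?N * Suc ?N" using Cons by (intro mult_mono) auto
  also have "\<dots> = fact (length (filter active w) + length (b # bs))" by (simp add: mult.commute)
  finally show ?case .
qed

lemma active_bword: "length (filter active (bword cs (\<lambda>_. []) W)) = length cs"
  by (induction cs) (auto simp: bword_def chain_def)

text \<open>The balance of \<open>i\<close> and \<open>j\<close> over the variables turns the order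
  in \<open>bword_bound\<close> into exactly \<open>n * length bs\<close>, the same for every
  word.\<close>

lemma words_bound:
  fixes X :: "'a::euclidean_space \<Rightarrow> real list"
  assumes u: "jet_bound R a u" and a: "\<And>m. 0 \<le> a m" "mono a" and R: "0 \<le> R" and L: "0 \<le> L"
    and X: "\<And>c. c \<in> Basis \<Longrightarrow> length (X c) = n" "\<And>c x. c \<in> Basis \<Longrightarrow> x \<in> set (X c) \<Longrightarrow> \<bar>x\<bar> \<le> R"
    and v: "\<And>b. b \<in> set bs \<Longrightarrow> poly_norm R (- v b) \<le> L"
    and ij: "\<And>c. c \<in> Basis \<Longrightarrow> i c < n" "\<And>c. c \<in> Basis \<Longrightarrow> j c < n"
    and W: "\<And>c. c \<in> Basis \<Longrightarrow> W c = node_poly (take (j c) (X c) @ drop (Suc (i c)) (X c))"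
    and cs: "set cs \<subseteq> Basis" "distinct cs" "(\<Sum>c\<leftarrow>cs. i c) = (\<Sum>c\<leftarrow>cs. j c)"
  shows "\<bar>\<Sum>w\<leftarrow>words J v (bword cs (\<lambda>_. []) W) bs. run X w u 0\<bar>
     \<le> fact (length cs + length bs) * (L ^ length bs * a (n * length bs))"
proof -
  let ?ws = "words J v (bword cs (\<lambda>_. []) W) bs" and ?B = "L ^ length bs * a (n * length bs)"
  have B: "0 \<le> ?B" using L a by simp
  have "\<bar>run X w u 0\<bar> \<le> ?B" if "w \<in> set ?ws" for w
  proof -
    from words_bword[OF cs(2) that] obtain Q where Q: "w = bword cs Q W" "(\<Sum>c\<leftarrow>cs. length (Q c)) = length bs"
      "\<And>c. set (Q c) \<subseteq> (\<lambda>b. - v b) ` set bs" by blast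
    have "run X (bword cs Q W) u = (\<lambda>_. 0) \<or>
      (\<exists>r. r + (\<Sum>c\<leftarrow>cs. j c) = n * (\<Sum>c\<leftarrow>cs. length (Q c)) + (\<Sum>c\<leftarrow>cs. i c) \<and>
        jet_bound R (\<lambda>m. L ^ (\<Sum>c\<leftarrow>cs. length (Q c)) * a (m + r)) (run X (bword cs Q W) u))"
      by (rule bword_bound[OF u a R L X _ ij W cs(1)]) (use Q(3) v in auto)
    then show ?thesis
    proof (elim disjE exE conjE)
      fix r assume r: "r + (\<Sum>c\<leftarrow>cs. j c) = n * (\<Sum>c\<leftarrow>cs. length (Q c)) + (\<Sum>c\<leftarrow>cs. i c)"
        and b: "jet_bound R (\<lambda>m. L ^ (\<Sum>c\<leftarrow>cs. length (Q c)) * a (m + r)) (run X (bword cs Q W) u)"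
      have "r = n * length bs" using r cs(3) Q(2) by simp
      with jet_boundD[OF b, of "[]" 0] R show ?thesis by (simp add: Q)
    qed (use B in \<open>simp add: Q\<close>)
  qed
  then have "(\<Sum>w\<leftarrow>?ws. \<bar>run X w u 0\<bar>) \<le> (\<Sum>w\<leftarrow>?ws. ?B)"
    by (intro sum_list_mono)
  also have "\<dots> = real (length ?ws) * ?B" by (simp add: sum_list_triv)
  also have "\<dots> \<le> fact (length cs + length bs) * ?B"
  proof (rule mult_right_mono[OF _ B])
    have "real (length ?ws) \<le> real (fact (length cs + length bs))"
      using length_words[of J v "bword cs (\<lambda>_. []) W" bs] unfolding active_bword of_nat_le_iff .
    then show "real (length ?ws) \<le> fact (length cs + length bs)" by simp
  qed
  finally show ?thesis
    using sum_list_abs[of "map (\<lambda>w. run X w u 0) ?ws"] by (simp add: o_def)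
qed

section \<open>Elementary symmetric functions as coordinates\<close>

definition crank :: "'n::{finite,linorder} \<Rightarrow> nat" where
  "crank i = card {j. j \<le> i}"

lemma crank_bij: "bij_betw crank (UNIV :: 'n::{finite,linorder} set) {1..CARD('n)}"
proof -
  have less: "crank i < crank j" if "i < j" for i j :: 'n
  proof -
    have "{k. k \<le> i} \<noteq> {k. k \<le> j}" using that by (metis leD mem_Collect_eq order_refl)
    with that show ?thesis unfolding crank_def by (intro psubset_card_mono psubsetI) auto
  qed
  then have inj: "inj (crank :: 'n \<Rightarrow> nat)"
    by (metis (mono_tags) injI less_irrefl linorder_neqE)
  have "crank i \<in> {1..CARD('n)}" for i :: 'n
    unfolding crank_def by (auto simp: Suc_le_eq card_gt_0_iff intro!: card_mono)
  then have "range (crank :: 'n \<Rightarrow> nat) \<subseteq> {1..CARD('n)}" by auto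
  then have "range (crank :: 'n \<Rightarrow> nat) = {1..CARD('n)}"
    by (intro card_subset_eq) (use inj in \<open>auto simp: card_image\<close>)
  with inj show ?thesis by (simp add: bij_betw_def)
qed

lemma crank_pos: "1 \<le> crank i" and crank_le: "crank (i::'n::{finite,linorder}) \<le> CARD('n)"
  using bij_betwE[OF crank_bij] by auto

lemma crank_inj: "crank i = crank j \<longleftrightarrow> i = j"
  using crank_bij unfolding bij_betw_def by (metis injD)

lemma sigma_nth: "sigma x $ i = esym (crank i) x"
  by (simp add: sigma_def crank_def)

lemma vieta:
  fixes y :: "real ^ 'n::{finite,linorder}"
  shows "(\<Prod>l\<in>UNIV. t - y $ l) = t ^ CARD('n) + (\<Sum>i\<in>UNIV. (- 1) ^ crank i * sigma y $ i * t ^ (CARD('n) - crank i))"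
proof -
  let ?n = "CARD('n)"
  let ?g = "\<lambda>k. (- 1) ^ k * esym k y * t ^ (?n - k)"
  have "(\<Prod>l\<in>UNIV. t - y $ l) = (\<Prod>l\<in>UNIV. - (y $ l) + t)" by simp
  also have "\<dots> = (\<Sum>X\<in>Pow UNIV. (\<Prod>l\<in>X. - (y $ l)) * (\<Prod>l\<in>UNIV - X. t))"
    by (rule prod_add) simp
  also have "\<dots> = (\<Sum>X\<in>UNIV. (- 1) ^ card X * (\<Prod>l\<in>X. y $ l) * t ^ (?n - card X))"
    by (intro sum.cong) (auto simp: prod_uminus card_Diff_subset)
  also have "\<dots> = (\<Sum>k\<in>{0..?n}. \<Sum>X\<in>{X\<in>UNIV. card X = k}. (- 1) ^ card X * (\<Prod>l\<in>X. y $ l) * t ^ (?n - card X))"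
    by (rule sum.group[symmetric]) (auto simp: card_mono)
  also have "\<dots> = (\<Sum>k\<in>{0..?n}. ?g k)"
    by (intro sum.cong refl) (simp add: esym_def sum_distrib_left sum_distrib_right)
  also have "\<dots> = ?g 0 + (\<Sum>k\<in>{1..?n}. ?g k)"
    by (simp add: sum.atLeast_Suc_atMost)
  also have "(\<Sum>k\<in>{1..?n}. ?g k) = (\<Sum>i\<in>(UNIV::'n set). ?g (crank i))"
    by (rule sum.reindex_bij_betw[OF crank_bij, symmetric])
  also have "?g 0 = t ^ ?n"
    by (simp add: esym_def)
  finally show ?thesis by (simp add: sigma_nth)
qed

lemma sigma_eq_prod:
  fixes y :: "real ^ 'n::{finite,linorder}"
  assumes "sigma y' = sigma y + s *\<^sub>R axis i 1"
  shows "(\<Prod>l\<in>UNIV. t - y' $ l) = (\<Prod>l\<in>UNIV. t - y $ l) + s * ((- 1) ^ crank i * t ^ (CARD('n) - crank i))"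
proof -
  have "sigma y' $ k = sigma y $ k + (if k = i then s else 0)" for k
    unfolding assms by (simp add: axis_def)
  then have "(\<Sum>k\<in>UNIV. (- 1) ^ crank k * sigma y' $ k * t ^ (CARD('n) - crank k)) =
      (\<Sum>k\<in>UNIV. (- 1) ^ crank k * sigma y $ k * t ^ (CARD('n) - crank k) +
        (if k = i then s * ((- 1) ^ crank i * t ^ (CARD('n) - crank i)) else 0))"
    by (intro sum.cong) (auto simp: algebra_simps)
  then show ?thesis unfolding vieta by (simp add: sum.distrib)
qed

definition root_poly :: "real ^ 'n \<Rightarrow> real poly" where
  "root_poly y = (\<Prod>l\<in>UNIV. [:- (y $ l), 1:])"

lemma poly_root_poly: "poly (root_poly y) t = (\<Prod>l\<in>UNIV. t - y $ l)"
  by (simp add: root_poly_def poly_prod)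

lemma sum_single_mset: "finite A \<Longrightarrow> (\<Sum>l\<in>A. {#f l#}) = image_mset f (mset_set A)"
  by (induction A rule: finite_induct) auto

lemma proots_root_poly: "proots (root_poly y) = image_mset (($) y) (mset_set UNIV)"
  unfolding root_poly_def by (subst proots_prod) (auto simp: sum_single_mset)

lemma sigma_eq_permutes:
  fixes y :: "real ^ 'n::{finite,linorder}"
  assumes "sigma y = sigma y'"
  obtains p where "p permutes UNIV" "\<And>i. y $ i = y' $ p i"
proof -
  have "(\<Prod>l\<in>UNIV. t - y $ l) = (\<Prod>l\<in>UNIV. t - y' $ l)" for t
    unfolding vieta assms ..
  then have "root_poly y = root_poly y'"
    by (intro poly_ext) (simp add: poly_root_poly)
  then have "image_mset (($) y) (mset_set UNIV) = image_mset (($) y') (mset_set UNIV)"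
    by (metis proots_root_poly)
  from image_mset_eq_implies_permutes[OF _ this] show ?thesis using that by auto
qed

lemma continuous_on_sigma: "continuous_on S sigma"
  unfolding sigma_def esym_def by (intro continuous_intros)

lemma finite_separation:
  fixes f :: "'a \<Rightarrow> real"
  assumes "finite A" "\<And>x. x \<in> A \<Longrightarrow> 0 < f x"
  obtains d where "0 < d" "\<And>x. x \<in> A \<Longrightarrow> d \<le> f x"
proof
  show "0 < Min (insert 1 (f ` A))" using assms by (subst Min_gr_iff) auto
  show "Min (insert 1 (f ` A)) \<le> f x" if "x \<in> A" for x using assms that by (intro Min_le) auto
qed

text \<open>Roots that move by less than half their minimal distance cannot be permuted, so
  \<open>sigma\<close> is injective near \<open>y\<close>; invariance of domain then gives an open
  image and a continuous inverse.\<close>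

lemma sigma_local_homeomorphism:
  fixes y :: "real ^ 'n::{finite,linorder}"
  assumes "inj (($) y)" "0 < e"
  obtains U g where "open U" "y \<in> U" "open (sigma ` U)" "homeomorphism U (sigma ` U) sigma g"
    "\<forall>w\<in>U. inj (($) w)" "\<forall>w\<in>U. \<forall>i. \<bar>w $ i - y $ i\<bar> < e"
proof -
  let ?P = "{(i, j). i \<noteq> (j::'n)}"
  obtain d where d: "0 < d" "\<And>x. x \<in> ?P \<Longrightarrow> d \<le> \<bar>y $ fst x - y $ snd x\<bar>"
  proof (rule finite_separation)
    show "finite ?P" by (rule finite_subset[of _ UNIV]) auto
    show "0 < \<bar>y $ fst x - y $ snd x\<bar>" if "x \<in> ?P" for x
      using that assms(1) by (auto simp: inj_eq)
  qed blast
  have sep: "i = j" if "\<bar>y $ i - y $ j\<bar> < d" for i j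
    using d(2)[of "(i, j)"] that by auto
  define r where "r = min (d / 2) e"
  define U where "U = {w. \<forall>i. w $ i \<in> ball (y $ i) r}"
  have r: "0 < r" "2 * r \<le> d" "r \<le> e" using d(1) assms(2) by (auto simp: r_def)
  have U: "open U" unfolding U_def by (rule open_vector_box) simp
  have yU: "y \<in> U" using r by (simp add: U_def)
  have Ud: "\<bar>w $ i - y $ i\<bar> < r" if "w \<in> U" for w i
    using that by (auto simp: U_def dist_real_def abs_minus_commute)
  have inj: "inj_on sigma U"
  proof (rule inj_onI)
    fix w w' assume w: "w \<in> U" "w' \<in> U" "sigma w = sigma w'"
    obtain p where p: "\<And>i. w $ i = w' $ p i" using sigma_eq_permutes[OF w(3)] by metis
    have "p i = i" for i
    proof (rule sep[symmetric])
      show "\<bar>y $ i - y $ p i\<bar> < d"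
        using Ud[OF w(1), of i] Ud[OF w(2), of "p i"] p[of i] r by linarith
    qed
    with p show "w = w'" by (simp add: vec_eq_iff)
  qed
  have "\<forall>w\<in>U. inj (($) w)"
  proof (intro ballI injI)
    fix w i j assume "w \<in> U" "w $ i = w $ j"
    then show "i = j" using Ud[of w i] Ud[of w j] r by (intro sep) linarith
  qed
  moreover have "open (sigma ` U)"
    by (rule invariance_of_domain[OF continuous_on_sigma U inj])
  moreover obtain g where "homeomorphism U (sigma ` U) sigma g"
    using invariance_of_domain_homeomorphism[OF U continuous_on_sigma _ inj] by auto
  moreover have "\<forall>w\<in>U. \<forall>i. \<bar>w $ i - y $ i\<bar> < e"
    using Ud r(3) by (meson less_le_trans)
  ultimately show ?thesis using that U yU by blast
qed

text \<open>Cauchy's bound: for a root of modulus above 1, divide the root equation by its power of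
  order \<open>n - 1\<close>. It makes preimages of bounded sets under \<open>theta\<close>
  bounded.\<close>

lemma root_bound:
  fixes y :: "real ^ 'n::{finite,linorder}"
  shows "\<bar>y $ i\<bar> \<le> 1 + (\<Sum>k\<in>UNIV. \<bar>sigma y $ k\<bar>)"
proof (cases "\<bar>y $ i\<bar> \<le> 1")
  case True
  then show ?thesis by (intro order_trans[OF True]) (simp add: sum_nonneg)
next
  case False
  let ?n = "CARD('n)" and ?t = "y $ i"
  have "0 = (\<Prod>l\<in>UNIV. ?t - y $ l)" by (subst prod_zero) auto
  then have "?t ^ ?n = - (\<Sum>k\<in>UNIV. (- 1) ^ crank k * sigma y $ k * ?t ^ (?n - crank k))"
    unfolding vieta by linarith
  then have "\<bar>?t\<bar> ^ ?n = \<bar>\<Sum>k\<in>UNIV. (- 1) ^ crank k * sigma y $ k * ?t ^ (?n - crank k)\<bar>"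
    by (metis abs_minus_cancel power_abs)
  also have "\<dots> \<le> (\<Sum>k\<in>UNIV. \<bar>sigma y $ k\<bar> * \<bar>?t\<bar> ^ (?n - crank k))"
    by (rule order_trans[OF sum_abs]) (simp add: abs_mult power_abs)
  also have "\<dots> \<le> (\<Sum>k\<in>UNIV. \<bar>sigma y $ k\<bar> * \<bar>?t\<bar> ^ (?n - 1))"
    using False crank_pos by (intro sum_mono mult_left_mono power_increasing) (auto intro: diff_le_mono2)
  also have "\<dots> = \<bar>?t\<bar> ^ (?n - 1) * (\<Sum>k\<in>UNIV. \<bar>sigma y $ k\<bar>)"
    unfolding sum_distrib_left by (simp add: mult.commute)
  also have "\<bar>?t\<bar> ^ ?n = \<bar>?t\<bar> ^ (?n - 1) * \<bar>?t\<bar>"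
    by (metis power_minus_mult zero_less_card_finite)
  finally have "\<bar>?t\<bar> \<le> (\<Sum>k\<in>UNIV. \<bar>sigma y $ k\<bar>)"
    using False by (subst (asm) mult_le_cancel_left_pos) auto
  then show ?thesis by simp
qed

text \<open>A double root \<open>a\<close> gives a root polynomial \<open>(t - a)^2 * Q\<close>.
  Adding \<open>e * Q\<close> turns the square into \<open>(t - a)^2 + e\<close> without real zeros,
  so at most \<open>n - 2\<close> real roots are left.\<close>

lemma sigma_nonregular_perturb:
  fixes y :: "real ^ 'n::{finite,linorder}"
  assumes "\<not> inj (($) y)"
  obtains q :: "real ^ 'n::{finite,linorder}" where "\<And>e. 0 < e \<Longrightarrow> sigma y + e *\<^sub>R q \<notin> range sigma"
proof -
  let ?n = "CARD('n)"
  obtain a b where ab: "a \<noteq> b" "y $ a = y $ b" using assms by (auto simp: inj_def)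
  define Q where "Q = (\<Prod>l\<in>UNIV - {a, b}. [:- (y $ l), 1:])"
  have Q: "Q \<noteq> 0" by (auto simp: Q_def)
  have card: "card (UNIV - {a, b}) = ?n - 2" "2 \<le> ?n"
    using ab card_mono[of UNIV "{a, b}"] by (auto simp: card_Diff_subset)
  have dQ: "degree Q \<le> ?n - 2"
    unfolding Q_def using card degree_prod_sum_le[of "UNIV - {a, b}" "\<lambda>l. [:- (y $ l), 1:]"] by (simp add: o_def)
  have split: "root_poly y = [:- (y $ a), 1:]\<^sup>2 * Q"
    unfolding root_poly_def Q_def
    using prod.subset_diff[of "{a, b}" UNIV "\<lambda>l. [:- (y $ l), 1:]"] ab by (simp add: power2_eq_square mult.commute)
  \<comment> \<open>With the signs of \<open>vieta\<close>, moving \<open>sigma y\<close> along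
    \<open>q\<close> adds multiples of \<open>Q\<close> to the root polynomial.\<close>
  define q :: "real ^ 'n::{finite,linorder}" where "q = (\<chi> i. (- 1) ^ crank i * coeff Q (?n - crank i))"
  have Qsum: "(\<Sum>i\<in>UNIV. (- 1) ^ crank i * q $ i * t ^ (?n - crank i)) = poly Q t" for t
  proof -
    have "(\<Sum>i\<in>UNIV. (- 1) ^ crank i * q $ i * t ^ (?n - crank i)) = (\<Sum>i\<in>UNIV. coeff Q (?n - crank i) * t ^ (?n - crank (i::'n)))"
    proof (intro sum.cong refl)
      fix i :: 'n
      have "(- 1) ^ crank i * ((- 1) ^ crank i * x) = x" for x :: real
        by (simp flip: mult.assoc power_mult_distrib)
      then show "(- 1) ^ crank i * q $ i * t ^ (?n - crank i) = coeff Q (?n - crank i) * t ^ (?n - crank i)"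
        by (simp add: q_def)
    qed
    also have "\<dots> = (\<Sum>k\<in>{1..?n}. coeff Q (?n - k) * t ^ (?n - k))"
      by (rule sum.reindex_bij_betw[OF crank_bij])
    also have "\<dots> = (\<Sum>k<?n. coeff Q k * t ^ k)"
      by (rule sum.reindex_bij_witness[of _ "\<lambda>k. ?n - k" "\<lambda>k. ?n - k"]) auto
    also have "\<dots> = poly Q t"
    proof -
      have "poly Q t = (\<Sum>k\<le>degree Q. coeff Q k * t ^ k)" by (rule poly_altdef)
      also have "\<dots> = (\<Sum>k<?n. coeff Q k * t ^ k)"
        using dQ card by (intro sum.mono_neutral_left) (auto simp: coeff_eq_0)
      finally show ?thesis ..
    qed
    finally show ?thesis .
  qed
  have "sigma y + e *\<^sub>R q \<noteq> sigma u" if e: "0 < e" for e u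
  proof
    assume E: "sigma y + e *\<^sub>R q = sigma u"
    let ?q = "[:- (y $ a), 1:]\<^sup>2 + [:e:]"
    have pq: "poly ?q t > 0" for t
    proof -
      have "poly ?q t = (t - y $ a)\<^sup>2 + e" by (simp add: power2_eq_square algebra_simps)
      then show ?thesis using e zero_le_power2[of "t - y $ a"] by linarith
    qed
    have q0: "?q \<noteq> 0" using pq[of 0] by (metis less_irrefl poly_0)
    have "poly (root_poly u) t = poly (?q * Q) t" for t
    proof -
      have "poly (root_poly u) t = poly (root_poly y) t + e * poly Q t"
        unfolding poly_root_poly vieta E[symmetric] Qsum[symmetric]
        by (simp add: algebra_simps sum.distrib sum_distrib_left)
      then show ?thesis by (simp add: split algebra_simps)
    qed
    then have "root_poly u = ?q * Q" by (intro poly_ext) auto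
    then have "proots (root_poly u) = proots ?q + proots Q"
      using proots_mult[OF q0 Q] by simp
    moreover have "proots ?q = {#}"
      using pq set_count_proots[OF q0] by (auto simp flip: set_mset_eq_empty_iff) (metis less_irrefl)
    ultimately have "size (proots (root_poly u)) \<le> ?n - 2"
      using size_proots_le[of Q] dQ by simp
    then show False using card unfolding proots_root_poly by simp
  qed
  then show ?thesis using that by blast
qed

section \<open>Newton bases\<close>

text \<open>The sum is the coefficient of degree \<open>card A - 1\<close> of the Lagrange
  interpolation polynomial of \<open>p\<close> on \<open>A\<close>, and that polynomial is
  \<open>p\<close> itself by its degree.\<close>

lemma lagrange_sum:
  fixes p :: "real poly"
  assumes "finite A" "degree p < card A"
  shows "(\<Sum>a\<in>A. poly p a / (\<Prod>b\<in>A - {a}. a - b)) = coeff p (card A - 1)"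
proof -
  let ?l = "\<lambda>a. \<Prod>b\<in>A - {a}. [:- b, 1:]"
  let ?k = "\<lambda>a. poly p a / (\<Prod>b\<in>A - {a}. a - b)"
  define L where "L = (\<Sum>a\<in>A. smult (?k a) (?l a))"
  have deg: "degree (?l a) = card A - 1" and lead: "coeff (?l a) (card A - 1) = 1" if "a \<in> A" for a
  proof -
    show d: "degree (?l a) = card A - 1"
      by (subst degree_prod_eq_sum_degree) (use that assms(1) in auto)
    have "lead_coeff (?l a) = 1" by (subst lead_coeff_prod) auto
    then show "coeff (?l a) (card A - 1) = 1" by (simp add: d)
  qed
  have "degree L \<le> card A - 1"
    unfolding L_def by (rule degree_sum_le) (use assms deg in \<open>auto intro: order_trans[OF degree_smult_le]\<close>)
  then have "degree (p - L) \<le> card A - 1"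
    using assms by (intro degree_diff_le) auto
  then have deg': "degree (p - L) < card A" using assms(2) by linarith
  have root: "poly (p - L) a = 0" if "a \<in> A" for a
  proof -
    have "poly (?l b) a = 0" if "b \<in> A" "b \<noteq> a" for b
      unfolding poly_prod using \<open>a \<in> A\<close> that assms(1) by (intro prod_zero) auto
    then have "poly L a = ?k a * poly (?l a) a"
      unfolding L_def using that assms(1) by (simp add: poly_sum sum.remove)
    also have "\<dots> = poly p a"
      using assms(1) by (simp add: poly_prod)
    finally show ?thesis by simp
  qed
  have "p - L = 0"
  proof (rule ccontr)
    assume ne: "p - L \<noteq> 0"
    have "card A \<le> card {x. poly (p - L) x = 0}"
      by (rule card_mono[OF poly_roots_finite[OF ne]]) (use root in blast)
    also have "\<dots> \<le> degree (p - L)" by (rule card_poly_roots_bound[OF ne])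
    finally show False using deg' by simp
  qed
  then have "coeff p (card A - 1) = coeff L (card A - 1)" by simp
  also have "\<dots> = (\<Sum>a\<in>A. ?k a)"
    unfolding L_def coeff_sum coeff_smult by (intro sum.cong refl) (simp only: lead mult_1_right)
  finally show ?thesis ..
qed

lemma ddiff_distinct:
  fixes u :: "'a::euclidean_space \<Rightarrow> real"
  assumes "c \<in> Basis"
  shows "distinct xs \<Longrightarrow> xs \<noteq> [] \<Longrightarrow> smooth u \<Longrightarrow>
    ddiff c xs u z = (\<Sum>a\<in>set xs. u (upd c a z) / (\<Prod>b\<in>set xs - {a}. a - b))"
proof (induction xs arbitrary: u)
  case (Cons a xs)
  show ?case
  proof (cases "xs = []")
    case True
    then show ?thesis by (simp add: ddiff_single ev_def)
  next
    case False
    let ?S = "set xs" and ?D = "\<lambda>b. \<Prod>d\<in>set xs - {b}. b - d"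
    have a: "a \<notin> ?S" using Cons.prems by simp
    have card: "card (insert a ?S) > 1" using a False by (simp add: card_gt_0_iff)
    have D: "(\<Prod>d\<in>insert a ?S - {b}. b - d) = (b - a) * ?D b" if "b \<in> ?S" for b
    proof -
      have "insert a ?S - {b} = insert a (?S - {b})" using a that by auto
      then show ?thesis using a by simp
    qed
    have Da: "insert a ?S - {a} = ?S" using a by auto
    have "(\<Sum>b\<in>insert a ?S. poly 1 b / (\<Prod>d\<in>insert a ?S - {b}. b - d)) = coeff 1 (card (insert a ?S) - 1)"
      by (rule lagrange_sum) (use card in auto)
    \<comment> \<open>\<open>lagrange_sum\<close> for the constant 1 collects the coefficients of
      \<open>u (upd c a z)\<close>, which occurs in every difference quotient.\<close>
    then have L: "(\<Sum>b\<in>?S. 1 / ((b - a) * ?D b)) = - 1 / (\<Prod>d\<in>?S. a - d)"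
      using a card False by (simp add: D Da eq_neg_iff_add_eq_0 add.commute)
    have "ddiff c (a # xs) u z = (\<Sum>b\<in>?S. dquot c a u (upd c b z) / ?D b)"
      using Cons.IH[of "dquot c a u"] Cons.prems False assms by (simp add: ddiff_Cons smooth_dquot)
    also have "\<dots> = (\<Sum>b\<in>?S. u (upd c b z) / ((b - a) * ?D b) - u (upd c a z) * (1 / ((b - a) * ?D b)))"
    proof (rule sum.cong)
      fix b assume "b \<in> ?S"
      then have ne: "b - a \<noteq> 0" using a by auto
      have "(b - a) * dquot c a u (upd c b z) = u (upd c b z) - u (upd c a z)"
        using dquot_eq[OF Cons.prems(3) assms, of "upd c b z" a] assms by simp
      then have "dquot c a u (upd c b z) = (u (upd c b z) - u (upd c a z)) / (b - a)"
        using ne by (simp add: eq_divide_eq mult.commute)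
      then show "dquot c a u (upd c b z) / ?D b = u (upd c b z) / ((b - a) * ?D b) - u (upd c a z) * (1 / ((b - a) * ?D b))"
        by (simp add: diff_divide_distrib)
    qed simp
    also have "\<dots> = (\<Sum>b\<in>?S. u (upd c b z) / ((b - a) * ?D b)) + u (upd c a z) / (\<Prod>d\<in>?S. a - d)"
      unfolding sum_subtractf sum_distrib_left[symmetric] L by simp
    also have "\<dots> = (\<Sum>b\<in>set (a # xs). u (upd c b z) / (\<Prod>d\<in>set (a # xs) - {b}. b - d))"
      using a by (simp add: D Da)
    finally show ?thesis .
  qed
qed simp

section \<open>Newton polynomials in the order of the index type\<close>

definition cpos :: "'n::{finite,linorder} \<Rightarrow> nat" where
  "cpos i = crank i - 1"

definition enum_list :: "'n::{finite,linorder} list" where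
  "enum_list = map (\<lambda>k. inv_into UNIV crank (Suc k)) [0..<CARD('n)]"

lemma crank_eq_cpos: "crank i = Suc (cpos i)"
  using crank_pos[of i] by (simp add: cpos_def)

lemma cpos_less: "cpos (i::'n::{finite,linorder}) < CARD('n)"
  using crank_le[of i] by (simp add: crank_eq_cpos)

lemma cpos_inj: "cpos i = cpos j \<longleftrightarrow> i = j"
  using crank_inj[of i j] by (simp add: crank_eq_cpos)

lemma uncrank_cpos: "inv_into UNIV crank (Suc (cpos i)) = i"
  using inv_into_f_f[OF bij_betw_imp_inj_on[OF crank_bij], of i] by (simp add: crank_eq_cpos)

lemma cpos_uncrank:
  assumes "k < CARD('n::{finite,linorder})"
  shows "cpos (inv_into (UNIV :: 'n set) crank (Suc k)) = k"
proof -
  have "Suc k \<in> range (crank :: 'n \<Rightarrow> nat)" using crank_bij assms by (auto simp: bij_betw_def)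
  from f_inv_into_f[OF this] show ?thesis by (simp add: cpos_def)
qed

lemma length_enum: "length (enum_list :: 'n::{finite,linorder} list) = CARD('n)"
  by (simp add: enum_list_def)

lemma distinct_enum: "distinct (enum_list :: 'n::{finite,linorder} list)"
proof -
  have "inj_on (\<lambda>k. inv_into (UNIV :: 'n set) crank (Suc k)) {0..<CARD('n)}"
    by (rule inj_on_inverseI[where g = cpos]) (simp add: cpos_uncrank)
  then show ?thesis by (simp add: enum_list_def distinct_map)
qed

lemma set_take_enum:
  assumes "k \<le> CARD('n)"
  shows "set (take k (enum_list :: 'n::{finite,linorder} list)) = {l. cpos l < k}"
proof -
  let ?u = "\<lambda>k. inv_into (UNIV :: 'n set) crank (Suc k)"
  have "set (take k (enum_list :: 'n list)) = ?u ` {0..<k}"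
    using assms by (simp add: enum_list_def take_map)
  also have "\<dots> = {l. cpos l < k}"
  proof (rule set_eqI)
    fix l
    have "l \<in> ?u ` {0..<k}" if "cpos l < k"
      by (rule image_eqI[of _ _ "cpos l"]) (use that uncrank_cpos[of l] in auto)
    moreover have "cpos l < k" if "l \<in> ?u ` {0..<k}"
    proof -
      from that obtain m where "m < k" "l = ?u m" by auto
      then show ?thesis using assms by (simp add: cpos_uncrank)
    qed
    ultimately show "l \<in> ?u ` {0..<k} \<longleftrightarrow> l \<in> {l. cpos l < k}" by blast
  qed
  finally show ?thesis .
qed

lemma set_enum: "set (enum_list :: 'n::{finite,linorder} list) = UNIV"
proof -
  have "set (enum_list :: 'n list) = {l. cpos l < CARD('n)}"
    using set_take_enum[where ?'n = 'n, of "CARD('n)"] length_enum[where ?'n = 'n] by simp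
  then show ?thesis by (simp add: cpos_less)
qed

lemma set_drop_enum:
  assumes "k \<le> CARD('n)"
  shows "set (drop k (enum_list :: 'n::{finite,linorder} list)) = {l. k \<le> cpos l}"
proof -
  have "distinct (take k (enum_list :: 'n list) @ drop k enum_list)"
    unfolding append_take_drop_id by (rule distinct_enum)
  then have d: "{l. cpos l < k} \<inter> set (drop k (enum_list :: 'n list)) = {}"
    unfolding distinct_append set_take_enum[OF assms] by (elim conjE)
  have "set (take k (enum_list :: 'n list) @ drop k enum_list) = UNIV"
    unfolding append_take_drop_id by (rule set_enum)
  then have u: "{l. cpos l < k} \<union> set (drop k (enum_list :: 'n list)) = UNIV"
    unfolding set_append set_take_enum[OF assms] .
  have "set (drop k (enum_list :: 'n list)) = - {l. cpos l < k}"
    by (rule compl_unique[OF d u, symmetric])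
  also have "\<dots> = {l. k \<le> cpos l}" by (simp add: Compl_eq not_less)
  finally show ?thesis .
qed

lemma poly_node_poly_map:
  "distinct ls \<Longrightarrow> poly (node_poly (map f ls)) t = (\<Prod>l\<in>set ls. t - f l)"
  by (induction ls) auto

lemma card_cpos_less: "card {l::'n::{finite,linorder}. cpos l < k} = k" if "k \<le> CARD('n)"
proof -
  have "card (set (take k (enum_list :: 'n list))) = k"
    using that by (subst distinct_card) (auto simp: distinct_enum length_enum)
  then show ?thesis using set_take_enum[OF that] by simp
qed

lemma card_cpos_ge: "card {l::'n::{finite,linorder}. k \<le> cpos l} = CARD('n) - k" if "k \<le> CARD('n)"
proof -
  have "card (set (drop k (enum_list :: 'n list))) = CARD('n) - k"
    using that by (subst distinct_card) (auto simp: distinct_enum length_enum)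
  then show ?thesis using set_drop_enum[OF that] by simp
qed

text \<open>For \<open>k = i\<close>, \<open>lower_newton\<close> and \<open>upper_newton\<close>
  together contain every node but the \<open>i\<close>-th, so their product is monic of degree
  \<open>n - 1\<close>. This degree is what \<open>lagrange_sum\<close> detects.\<close>

definition lower_newton :: "('n::{finite,linorder} \<Rightarrow> real) \<Rightarrow> 'n \<Rightarrow> real poly" where
  "lower_newton f k = (\<Prod>l | cpos l < cpos k. [:- f l, 1:])"

definition upper_newton :: "('n::{finite,linorder} \<Rightarrow> real) \<Rightarrow> 'n \<Rightarrow> real poly" where
  "upper_newton f i = (\<Prod>l | cpos i < cpos l. [:- f l, 1:])"

lemma degree_newton:
  fixes f :: "'n::{finite,linorder} \<Rightarrow> real"
  shows "degree (lower_newton f k) = cpos k" "degree (upper_newton f i) = CARD('n) - 1 - cpos i"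
    "lead_coeff (lower_newton f k) = 1" "lead_coeff (upper_newton f i) = 1"
proof -
  show "degree (lower_newton f k) = cpos k"
    unfolding lower_newton_def using card_cpos_less[where ?'n = 'n, of "cpos k"] cpos_less[of k]
    by (subst degree_prod_eq_sum_degree) auto
  have "card {l::'n. cpos i < cpos l} = CARD('n) - Suc (cpos i)"
    using card_cpos_ge[where ?'n = 'n, of "Suc (cpos i)"] cpos_less[of i] by (simp add: Suc_le_eq)
  then show "degree (upper_newton f i) = CARD('n) - 1 - cpos i"
    unfolding upper_newton_def by (subst degree_prod_eq_sum_degree) auto
qed (simp_all add: lower_newton_def upper_newton_def lead_coeff_prod)

lemma permutes_cpos_increasing:
  fixes p :: "'n::{finite,linorder} \<Rightarrow> 'n"
  assumes "p permutes UNIV" "\<And>i. cpos i \<le> cpos (p i)"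
  shows "p = id"
proof
  fix i
  have "(\<Sum>i\<in>(UNIV :: 'n set). cpos i) = (\<Sum>i\<in>UNIV. cpos (p i))"
    using sum.permute[OF assms(1), of cpos] by (simp add: o_def)
  from sum_mono_inv[OF this assms(2), of i] show "p i = id i" by (simp add: cpos_inj)
qed

text \<open>By \<open>lagrange_sum\<close> the sum is a coefficient of degree \<open>n - 1\<close>,
  while the product is monic of degree \<open>n - 1 - (cpos i - cpos k)\<close>. The pairing is thus
  triangular with unit diagonal, however \<open>f\<close> and \<open>x\<close> are related.\<close>

lemma newton_pairing:
  fixes x f :: "'n::{finite,linorder} \<Rightarrow> real"
  assumes x: "inj x" and k: "cpos k \<le> cpos i"
  shows "(\<Sum>l\<in>UNIV. poly (lower_newton f k * upper_newton f i) (x l) / (\<Prod>m\<in>UNIV - {l}. x l - x m)) = (if k = i then 1 else 0)"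
proof -
  let ?p = "lower_newton f k * upper_newton f i"
  have ne: "lower_newton f k \<noteq> 0" "upper_newton f i \<noteq> 0"
    using degree_newton(3)[of f k] degree_newton(4)[of f i] by auto
  have deg: "degree ?p = CARD('n) - 1 - (cpos i - cpos k)"
    using degree_mult_eq[OF ne] degree_newton(1,2)[of f] cpos_less[of i] k by simp
  have lead: "lead_coeff ?p = 1" by (simp only: lead_coeff_mult degree_newton(3,4) mult_1)
  have inj: "inj_on x S" for S using x by (rule inj_on_subset) auto
  have "(\<Sum>l\<in>UNIV. poly ?p (x l) / (\<Prod>m\<in>UNIV - {l}. x l - x m)) = (\<Sum>a\<in>range x. poly ?p a / (\<Prod>b\<in>range x - {a}. a - b))"
  proof (subst sum.reindex[OF x], unfold o_def, rule sum.cong)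
    fix l
    have "range x - {x l} = x ` (UNIV - {l})" using x by (auto simp: inj_eq)
    then have "(\<Prod>b\<in>range x - {x l}. x l - b) = (\<Prod>m\<in>UNIV - {l}. x l - x m)"
      by (simp add: prod.reindex[OF inj] o_def)
    then show "poly ?p (x l) / (\<Prod>m\<in>UNIV - {l}. x l - x m) = poly ?p (x l) / (\<Prod>b\<in>range x - {x l}. x l - b)" by simp
  qed simp
  also have "\<dots> = coeff ?p (CARD('n) - 1)"
    using lagrange_sum[of "range x" ?p] deg x by (simp add: card_image)
  also have "\<dots> = (if k = i then 1 else 0)"
  proof (cases "k = i")
    case True
    then show ?thesis using deg lead by simp
  next
    case False
    then have "cpos k < cpos i" using k cpos_inj[of k i] by simp
    then show ?thesis using False deg cpos_less[of i] by (auto intro: coeff_eq_0)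
  qed
  finally show ?thesis .
qed

text \<open>The determinant of the monic Newton polynomials at the values \<open>w\<close>, a
  Vandermonde determinant in disguise. It is written out to match the signed sum over permutations
  in the representation.\<close>

definition alt :: "('n::{finite,linorder} \<Rightarrow> real) \<Rightarrow> ('n \<Rightarrow> real) \<Rightarrow> real" where
  "alt f w = (\<Sum>p | p permutes UNIV. of_int (sign p) * (\<Prod>i\<in>UNIV. poly (lower_newton f (p i)) (w i)))"

lemma alt_eq_0:
  assumes "\<not> inj w"
  shows "alt f w = 0"
proof -
  let ?A = "\<chi> i k. poly (lower_newton f k) (w i)"
  obtain i j where ij: "i \<noteq> j" "w i = w j" using assms by (auto simp: inj_def)
  have "row i ?A = row j ?A" using ij by (simp add: row_def)
  from det_identical_rows[OF ij(1) this] show ?thesis by (simp add: alt_def det_def)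
qed

text \<open>Exchanging the sums turns the left side into the determinant of the pairings of
  \<open>newton_pairing\<close>. By triangularity only the identity permutation contributes.\<close>

lemma alt_total:
  fixes x f :: "'n::{finite,linorder} \<Rightarrow> real"
  assumes x: "inj x"
  shows "(\<Sum>t\<in>UNIV. alt f (\<lambda>i. x (t i)) *
    (\<Prod>i\<in>UNIV. poly (upper_newton f i) (x (t i)) / (\<Prod>m\<in>UNIV - {t i}. x (t i) - x m))) = 1"
proof -
  let ?c = "\<lambda>i l. poly (upper_newton f i) (x l) / (\<Prod>m\<in>UNIV - {l}. x l - x m)"
  let ?B = "\<lambda>i k. \<Sum>l\<in>UNIV. poly (lower_newton f k) (x l) * ?c i l"
  have "(\<Sum>t\<in>UNIV. alt f (\<lambda>i. x (t i)) * (\<Prod>i\<in>UNIV. ?c i (t i))) =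
    (\<Sum>t\<in>UNIV. \<Sum>p | p permutes UNIV. of_int (sign p) * (\<Prod>i\<in>UNIV. poly (lower_newton f (p i)) (x (t i)) * ?c i (t i)))"
    unfolding alt_def sum_distrib_right prod.distrib by (simp only: mult.assoc)
  also have "\<dots> = (\<Sum>p | p permutes UNIV. \<Sum>t\<in>UNIV. of_int (sign p) * (\<Prod>i\<in>UNIV. poly (lower_newton f (p i)) (x (t i)) * ?c i (t i)))"
    by (rule sum.swap)
  also have "\<dots> = (\<Sum>p | p permutes UNIV. of_int (sign p) * (\<Prod>i\<in>UNIV. ?B i (p i)))"
  proof (rule sum.cong[OF refl])
    fix p :: "'n \<Rightarrow> 'n"
    have "(\<Prod>i\<in>UNIV. ?B i (p i)) = (\<Sum>t\<in>UNIV. \<Prod>i\<in>UNIV. poly (lower_newton f (p i)) (x (t i)) * ?c i (t i))"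
      using prod_sum_PiE[of "UNIV :: 'n set" "\<lambda>_. UNIV :: 'n set" "\<lambda>i l. poly (lower_newton f (p i)) (x l) * ?c i l"]
      by (simp add: PiE_UNIV_domain)
    then show "(\<Sum>t\<in>UNIV. of_int (sign p) * (\<Prod>i\<in>UNIV. poly (lower_newton f (p i)) (x (t i)) * ?c i (t i))) =
       of_int (sign p) * (\<Prod>i\<in>UNIV. ?B i (p i))"
      by (simp add: sum_distrib_left)
  qed
  also have "\<dots> = (\<Sum>p\<in>{id}. of_int (sign p) * (\<Prod>i\<in>UNIV. ?B i (p i)))"
  proof (rule sum.mono_neutral_right)
    show "\<forall>p\<in>{p. p permutes UNIV} - {id}. of_int (sign p) * (\<Prod>i\<in>UNIV. ?B i (p i)) = 0"
    proof
      fix p :: "'n \<Rightarrow> 'n" assume "p \<in> {p. p permutes UNIV} - {id}"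
      then have "\<not> (\<forall>i. cpos i \<le> cpos (p i))" using permutes_cpos_increasing[of p] by auto
      then obtain i where i: "cpos (p i) < cpos i" by (auto simp: not_le)
      then have "p i \<noteq> i" by auto
      then have "?B i (p i) = 0" using newton_pairing[OF x, of "p i" i f] i by simp
      then have "(\<Prod>i\<in>UNIV. ?B i (p i)) = 0" by (intro prod_zero) auto
      then show "of_int (sign p) * (\<Prod>i\<in>UNIV. ?B i (p i)) = 0" by simp
    qed
  qed (auto simp: permutes_id)
  also have "\<dots> = 1"
    using newton_pairing[OF x, of _ _ f] by (simp add: sign_id)
  finally show ?thesis .
qed

section \<open>Symmetric functions as sums of words\<close>

type_synonym ('n, 'p) blocks = "real ^ 'n ^ 'p"

definition coord :: "'p::finite \<Rightarrow> 'n::finite \<Rightarrow> real ^ 'n ^ 'p" where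
  "coord j i = axis j (axis i 1)"

lemma coord_Basis [simp]: "coord j i \<in> Basis"
  by (auto simp: coord_def Basis_vec_def)

lemma Basis_coord: "(Basis :: (real ^ 'n ^ 'p) set) = (\<lambda>(j, i). coord j i) ` UNIV"
  by (auto simp: coord_def Basis_vec_def image_iff)

lemma inner_coord [simp]: "z \<bullet> coord j i = z $ j $ i"
  by (simp add: coord_def inner_axis)

lemma coord_eq_iff [simp]: "coord j i = coord j' i' \<longleftrightarrow> j = j' \<and> i = i'"
  by (auto simp: coord_def axis_eq_axis)

definition blk :: "real ^ 'n ^ 'p \<Rightarrow> 'p::finite" where
  "blk c = (SOME j. \<exists>i. c = coord j i)"

definition idx :: "real ^ 'n ^ 'p::finite \<Rightarrow> 'n::finite" where
  "idx c = (SOME i. \<exists>j. c = coord j i)"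

lemma blk_coord [simp]: "blk (coord j i) = j"
  unfolding blk_def by (rule some_equality) auto

lemma idx_coord [simp]: "idx (coord j i) = i"
  unfolding idx_def by (rule some_equality) auto

lemma coord_blk_idx: "c \<in> Basis \<Longrightarrow> coord (blk c) (idx c) = c"
  by (auto simp: Basis_coord)

lemma upd_coord: "upd (coord j i) a z $ j' $ i' = (if j' = j \<and> i' = i then a else z $ j' $ i')"
  using upd_inner[of "coord j i" "coord j' i'" a z] by auto

lemma prod_Basis_coord:
  fixes h :: "real ^ 'n ^ 'p \<Rightarrow> real"
  shows "(\<Prod>c\<in>Basis. h c) = (\<Prod>j\<in>UNIV. \<Prod>i\<in>UNIV. h (coord j i))"
proof -
  have "inj (\<lambda>(j :: 'p, i :: 'n). coord j i)" by (auto intro!: injI)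
  then have "(\<Prod>c\<in>Basis. h c) = (\<Prod>(j, i)\<in>UNIV. h (coord j i))"
    unfolding Basis_coord by (simp add: prod.reindex case_prod_unfold)
  also have "\<dots> = (\<Prod>j\<in>UNIV. \<Prod>i\<in>UNIV. h (coord j i))"
    by (simp add: prod.cartesian_product)
  finally show ?thesis .
qed

definition nodes :: "('n::{finite,linorder}, 'p::finite) blocks \<Rightarrow> ('n, 'p) blocks \<Rightarrow> real list" where
  "nodes x c = map (($) (x $ blk c)) enum_list"

definition regular :: "('n::{finite,linorder}, 'p::finite) blocks \<Rightarrow> bool" where
  "regular x \<longleftrightarrow> (\<forall>j. inj (($) (x $ j)))"

lemma sum_inj_denominators:
  fixes f :: "'n::finite \<Rightarrow> real"
  assumes "inj f"
  shows "(\<Sum>a\<in>range f. h a / (\<Prod>b\<in>range f - {a}. a - b)) = (\<Sum>l\<in>UNIV. h (f l) / (\<Prod>m\<in>UNIV - {l}. f l - f m))"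
proof (subst sum.reindex[OF assms], unfold o_def, rule sum.cong)
  fix l
  have inj: "inj_on f S" for S using assms by (rule inj_on_subset) auto
  have "range f - {f l} = f ` (UNIV - {l})" using assms by (auto simp: inj_eq)
  then have "(\<Prod>b\<in>range f - {f l}. f l - b) = (\<Prod>m\<in>UNIV - {l}. f l - f m)"
    by (simp add: prod.reindex[OF inj] o_def)
  then show "h (f l) / (\<Prod>b\<in>range f - {f l}. f l - b) = h (f l) / (\<Prod>m\<in>UNIV - {l}. f l - f m)" by simp
qed simp

lemma ddiff_enum:
  fixes f :: "'n::{finite,linorder} \<Rightarrow> real"
  assumes "c \<in> Basis" "inj f" "smooth u"
  shows "ddiff c (map f enum_list) u z = (\<Sum>l\<in>UNIV. u (upd c (f l) z) / (\<Prod>m\<in>UNIV - {l}. f l - f m))"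
proof -
  have "distinct (map f enum_list)"
    using inj_on_subset[OF assms(2) subset_UNIV] by (simp add: distinct_map distinct_enum)
  moreover have "map f enum_list \<noteq> []" using length_enum[where ?'n = 'n] by (metis length_0_conv length_map zero_less_card_finite less_irrefl)
  ultimately have "ddiff c (map f enum_list) u z =
    (\<Sum>a\<in>range f. u (upd c a z) / (\<Prod>b\<in>range f - {a}. a - b))"
    using ddiff_distinct[OF assms(1) _ _ assms(3)] by (simp add: set_enum)
  then show ?thesis using sum_inj_denominators[OF assms(2)] by simp
qed

definition denom :: "('n::{finite,linorder}, 'p::finite) blocks \<Rightarrow> ('n, 'p) blocks \<Rightarrow> 'n \<Rightarrow> real" where
  "denom x c l = (\<Prod>m\<in>UNIV - {l}. x $ blk c $ l - x $ blk c $ m)"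

definition repl :: "('n::{finite,linorder}, 'p::finite) blocks \<Rightarrow> ('n, 'p) blocks set \<Rightarrow> (('n, 'p) blocks \<Rightarrow> 'n) \<Rightarrow>
    ('n, 'p) blocks \<Rightarrow> ('n, 'p) blocks" where
  "repl x S t z = (\<chi> j i. if coord j i \<in> S then x $ j $ t (coord j i) else z $ j $ i)"

lemma sum_PiE_insert:
  fixes G :: "('a \<Rightarrow> 'b::finite) \<Rightarrow> real"
  assumes "c \<notin> S"
  shows "(\<Sum>t\<in>PiE (insert c S) (\<lambda>_. UNIV). G t) = (\<Sum>l\<in>UNIV. \<Sum>g\<in>PiE S (\<lambda>_. UNIV). G (g(c := l)))"
proof -
  have "(\<Sum>t\<in>PiE (insert c S) (\<lambda>_. UNIV). G t) =
      (\<Sum>(l, g)\<in>UNIV \<times> PiE S (\<lambda>_. UNIV). G (g(c := l)))"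
    unfolding PiE_insert_eq using inj_combinator[OF assms, of "\<lambda>_. UNIV"]
    by (subst sum.reindex) (auto simp: case_prod_unfold o_def)
  then show ?thesis by (simp add: sum.cartesian_product)
qed

text \<open>Each divided difference expands by \<open>ddiff_enum\<close>, and the variables choose
  their nodes independently. So \<open>t\<close> runs over all choices, including those that repeat
  a node within a block.\<close>

lemma run_regular:
  fixes x :: "('n::{finite,linorder}, 'p::finite) blocks"
  assumes x: "regular x" and u: "smooth u"
  shows "distinct cs \<Longrightarrow> set cs \<subseteq> Basis \<Longrightarrow> run (nodes x) (bword cs (\<lambda>_. []) W) u z =
    (\<Sum>t\<in>PiE (set cs) (\<lambda>_. UNIV). (\<Prod>c\<in>set cs. poly (W c) (x $ blk c $ t c) / denom x c (t c)) * u (repl x (set cs) t z))"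
proof (induction cs arbitrary: z)
  case Nil
  then show ?case by (simp add: bword_def repl_def)
next
  case (Cons c cs)
  have c: "c \<in> Basis" "c \<notin> set cs" using Cons.prems by auto
  let ?f = "($) (x $ blk c)"
  let ?r = "run (nodes x) (bword cs (\<lambda>_. []) W) u"
  let ?V = "\<lambda>z. poly (W c) (z \<bullet> c) * ?r z"
  let ?h = "\<lambda>c l. poly (W c) (x $ blk c $ l) / denom x c l"
  have r: "smooth ?r" using u Cons.prems by (intro smooth_run) (auto simp: lvar_bword)
  have V: "smooth ?V" by (rule smooth_poly[OF r c(1)])
  have inj: "inj ?f" using x by (simp add: regular_def)
  have rep: "repl x (insert c (set cs)) (g(c := l)) z = repl x (set cs) g (upd c (?f l) z)" for g l
  proof -
    have "(if coord j i \<in> insert c (set cs) then x $ j $ (g(c := l)) (coord j i) else z $ j $ i) =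
        (if coord j i \<in> set cs then x $ j $ g (coord j i) else upd c (?f l) z $ j $ i)" for j i
    proof (cases "coord j i = c")
      case True
      then show ?thesis using c by (auto simp: upd_coord)
    next
      case False
      then show ?thesis using upd_inner[OF c(1) coord_Basis[of j i], of "?f l" z] by auto
    qed
    then show ?thesis by (simp only: repl_def)
  qed
  have "run (nodes x) (bword (c # cs) (\<lambda>_. []) W) u z = ddiff c (map ?f enum_list) ?V z"
    by (simp add: bword_def chain_def nodes_def)
  also have "\<dots> = (\<Sum>l\<in>UNIV. ?V (upd c (?f l) z) / denom x c l)"
    unfolding ddiff_enum[OF c(1) inj V] denom_def ..
  also have "\<dots> = (\<Sum>l\<in>UNIV. ?h c l * ?r (upd c (?f l) z))"
    using c by simp
  also have "\<dots> = (\<Sum>l\<in>UNIV. \<Sum>g\<in>PiE (set cs) (\<lambda>_. UNIV).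
      ?h c l * ((\<Prod>c\<in>set cs. ?h c (g c)) * u (repl x (set cs) g (upd c (?f l) z))))"
    using Cons.IH Cons.prems by (simp add: sum_distrib_left)
  also have "\<dots> = (\<Sum>l\<in>UNIV. \<Sum>g\<in>PiE (set cs) (\<lambda>_. UNIV).
      (\<Prod>d\<in>insert c (set cs). ?h d ((g(c := l)) d)) * u (repl x (insert c (set cs)) (g(c := l)) z))"
  proof (intro sum.cong refl)
    fix l g
    have "(\<Prod>d\<in>set cs. ?h d ((g(c := l)) d)) = (\<Prod>d\<in>set cs. ?h d (g d))"
      by (rule prod.cong) (use c(2) in auto)
    then show "?h c l * ((\<Prod>c\<in>set cs. ?h c (g c)) * u (repl x (set cs) g (upd c (?f l) z))) =
      (\<Prod>d\<in>insert c (set cs). ?h d ((g(c := l)) d)) * u (repl x (insert c (set cs)) (g(c := l)) z)"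
      unfolding rep using c(2) by simp
  qed
  also have "\<dots> = (\<Sum>t\<in>PiE (insert c (set cs)) (\<lambda>_. UNIV).
      (\<Prod>d\<in>insert c (set cs). ?h d (t d)) * u (repl x (insert c (set cs)) t z))"
    by (rule sum_PiE_insert[OF c(2), symmetric])
  finally show ?case by simp
qed

text \<open>The slices give the form required by \<open>chain_weight_bound\<close>, with
  \<open>i = cpos (idx c)\<close> and \<open>j = cpos (\<pi> (blk c) (idx c))\<close>; as a
  polynomial this is \<open>lower_newton\<close> times \<open>upper_newton\<close>.\<close>

definition newton_weight :: "('n::{finite,linorder}, 'p::finite) blocks \<Rightarrow> ('p \<Rightarrow> 'n \<Rightarrow> 'n) \<Rightarrow> ('n, 'p) blocks \<Rightarrow> real poly" where
  "newton_weight y \<pi> c = node_poly (take (cpos (\<pi> (blk c) (idx c))) (nodes y c) @ drop (Suc (cpos (idx c))) (nodes y c))"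

lemma poly_newton_weight:
  "poly (newton_weight y \<pi> (coord j i)) t =
    poly (lower_newton (($) (y $ j)) (\<pi> j i)) t * poly (upper_newton (($) (y $ j)) i) t"
proof -
  have 1: "distinct (take k enum_list)" "distinct (drop k enum_list)" for k
    by (simp_all add: distinct_enum)
  have 2: "{l. Suc (cpos i) \<le> cpos l} = {l. cpos i < cpos l}" by (simp add: Suc_le_eq)
  show ?thesis
    unfolding newton_weight_def nodes_def poly_node_poly_append take_map drop_map blk_coord idx_coord
      poly_node_poly_map[OF 1(1)] poly_node_poly_map[OF 1(2)]
      set_take_enum[OF less_imp_le[OF cpos_less]] set_drop_enum[OF Suc_leI[OF cpos_less]] 2
    by (simp add: lower_newton_def upper_newton_def poly_prod)
qed

definition block_perms :: "('p::finite \<Rightarrow> 'n::finite \<Rightarrow> 'n) set" where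
  "block_perms = {\<pi>. \<forall>j. \<pi> j permutes UNIV}"

definition block_sign :: "('p::finite \<Rightarrow> 'n::finite \<Rightarrow> 'n) \<Rightarrow> real" where
  "block_sign \<pi> = (\<Prod>j\<in>UNIV. of_int (sign (\<pi> j)))"

lemma block_perms_PiE: "block_perms = PiE UNIV (\<lambda>_. {p. p permutes UNIV})"
  by (auto simp: block_perms_def PiE_UNIV_domain)

text \<open>The signed sum over \<open>\<pi>\<close> turns the weights into products of
  \<open>alt\<close>. These vanish unless every \<open>t j\<close> is injective, and then invariance
  gives the value \<open>f x\<close>; the remaining total is 1 by \<open>alt_total\<close>. The
  point \<open>y\<close> stays arbitrary.\<close>

lemma representation:
  fixes x y :: "('n::{finite,linorder}, 'p::finite) blocks"
  assumes x: "regular x" and f: "smooth f" and inv: "prod_sym_invariant f"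
    and cs: "distinct cs" "set cs = Basis"
  shows "(\<Sum>\<pi>\<in>block_perms. block_sign \<pi> * run (nodes x) (bword cs (\<lambda>_. []) (newton_weight y \<pi>)) f 0) = f x"
proof -
  let ?q = "\<lambda>j k w. poly (lower_newton (($) (y $ j)) k) (w::real)"
  let ?c = "\<lambda>j i l. poly (upper_newton (($) (y $ j)) i) (x $ j $ l) / (\<Prod>m\<in>UNIV - {l}. x $ j $ l - x $ j $ m)"
  let ?P = "\<lambda>t. (\<chi> j i. x $ j $ t j i) :: ('n, 'p) blocks"
  have A: "run (nodes x) (bword cs (\<lambda>_. []) (newton_weight y \<pi>)) f 0 =
      (\<Sum>t\<in>UNIV. (\<Prod>j\<in>UNIV. \<Prod>i\<in>UNIV. ?q j (\<pi> j i) (x $ j $ t j i) * ?c j i (t j i)) * f (?P t))" for \<pi>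
  proof -
    let ?H = "\<lambda>t. (\<Prod>c\<in>Basis. poly (newton_weight y \<pi> c) (x $ blk c $ t c) / denom x c (t c)) * f (repl x Basis t 0)"
    let ?G = "\<lambda>t. (\<Prod>j\<in>UNIV. \<Prod>i\<in>UNIV. ?q j (\<pi> j i) (x $ j $ t j i) * ?c j i (t j i)) * f (?P t)"
    have "run (nodes x) (bword cs (\<lambda>_. []) (newton_weight y \<pi>)) f 0 = (\<Sum>t\<in>PiE Basis (\<lambda>_. UNIV). ?H t)"
      using run_regular[OF x f cs(1), of "newton_weight y \<pi>" 0] cs by simp
    also have "\<dots> = (\<Sum>t\<in>UNIV. ?G t)"
    proof (rule sum.reindex_bij_witness[of _ "\<lambda>t. restrict (\<lambda>c. t (blk c) (idx c)) Basis" "\<lambda>t j i. t (coord j i)"])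
      fix t :: "('n, 'p) blocks \<Rightarrow> 'n" assume t: "t \<in> PiE Basis (\<lambda>_. UNIV)"
      show "restrict (\<lambda>c. t (coord (blk c) (idx c))) Basis = t"
        using t by (auto simp: coord_blk_idx PiE_def extensional_def fun_eq_iff)
      have "repl x Basis t 0 = ?P (\<lambda>j i. t (coord j i))" by (simp add: repl_def)
      then show "?G (\<lambda>j i. t (coord j i)) = ?H t"
        by (simp add: prod_Basis_coord poly_newton_weight denom_def)
    qed (auto simp: fun_eq_iff)
    finally show ?thesis .
  qed
  have B: "(\<Sum>\<pi>\<in>block_perms. block_sign \<pi> * (\<Prod>j\<in>UNIV. \<Prod>i\<in>UNIV. ?q j (\<pi> j i) (x $ j $ t j i) * ?c j i (t j i))) =
      (\<Prod>j\<in>UNIV. alt (($) (y $ j)) (\<lambda>i. x $ j $ t j i) * (\<Prod>i\<in>UNIV. ?c j i (t j i)))" for t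
  proof -
    have "(\<Sum>\<pi>\<in>block_perms. block_sign \<pi> * (\<Prod>j\<in>UNIV. \<Prod>i\<in>UNIV. ?q j (\<pi> j i) (x $ j $ t j i) * ?c j i (t j i))) =
      (\<Sum>\<pi>\<in>block_perms. (\<Prod>j\<in>UNIV. of_int (sign (\<pi> j)) * (\<Prod>i\<in>UNIV. ?q j (\<pi> j i) (x $ j $ t j i))) * (\<Prod>j\<in>UNIV. \<Prod>i\<in>UNIV. ?c j i (t j i)))"
      by (simp only: block_sign_def prod.distrib mult.assoc)
    also have "\<dots> = (\<Sum>\<pi>\<in>block_perms. \<Prod>j\<in>UNIV. of_int (sign (\<pi> j)) * (\<Prod>i\<in>UNIV. ?q j (\<pi> j i) (x $ j $ t j i))) * (\<Prod>j\<in>UNIV. \<Prod>i\<in>UNIV. ?c j i (t j i))"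
      by (simp only: sum_distrib_right)
    also have "(\<Sum>\<pi>\<in>block_perms. \<Prod>j\<in>UNIV. of_int (sign (\<pi> j)) * (\<Prod>i\<in>UNIV. ?q j (\<pi> j i) (x $ j $ t j i))) =
       (\<Prod>j\<in>UNIV. \<Sum>p | p permutes UNIV. of_int (sign p) * (\<Prod>i\<in>UNIV. ?q j (p i) (x $ j $ t j i)))"
      unfolding block_perms_PiE by (rule prod_sum_PiE[symmetric]) auto
    finally show ?thesis by (simp only: alt_def prod.distrib)
  qed
  have "(\<Sum>\<pi>\<in>block_perms. block_sign \<pi> * run (nodes x) (bword cs (\<lambda>_. []) (newton_weight y \<pi>)) f 0) =
    (\<Sum>\<pi>\<in>block_perms. \<Sum>t\<in>UNIV. (block_sign \<pi> * (\<Prod>j\<in>UNIV. \<Prod>i\<in>UNIV. ?q j (\<pi> j i) (x $ j $ t j i) * ?c j i (t j i))) * f (?P t))"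
    unfolding A sum_distrib_left by (simp only: mult.assoc)
  also have "\<dots> = (\<Sum>t\<in>UNIV. \<Sum>\<pi>\<in>block_perms. (block_sign \<pi> * (\<Prod>j\<in>UNIV. \<Prod>i\<in>UNIV. ?q j (\<pi> j i) (x $ j $ t j i) * ?c j i (t j i))) * f (?P t))"
    by (rule sum.swap)
  also have "\<dots> = (\<Sum>t\<in>UNIV. (\<Prod>j\<in>UNIV. alt (($) (y $ j)) (\<lambda>i. x $ j $ t j i) * (\<Prod>i\<in>UNIV. ?c j i (t j i))) * f (?P t))"
    unfolding sum_distrib_right[symmetric] B ..
  also have "\<dots> = (\<Sum>t\<in>UNIV. (\<Prod>j\<in>UNIV. alt (($) (y $ j)) (\<lambda>i. x $ j $ t j i) * (\<Prod>i\<in>UNIV. ?c j i (t j i))) * f x)"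
  proof (rule sum.cong[OF refl])
    fix t :: "'p \<Rightarrow> 'n \<Rightarrow> 'n"
    show "(\<Prod>j\<in>UNIV. alt (($) (y $ j)) (\<lambda>i. x $ j $ t j i) * (\<Prod>i\<in>UNIV. ?c j i (t j i))) * f (?P t) =
      (\<Prod>j\<in>UNIV. alt (($) (y $ j)) (\<lambda>i. x $ j $ t j i) * (\<Prod>i\<in>UNIV. ?c j i (t j i))) * f x"
    proof (cases "\<forall>j. inj (t j)")
      case True
      then have "\<forall>j. t j permutes UNIV" by (auto intro!: inj_imp_permutes)
      then have "f (?P t) = f x" using inv by (simp add: prod_sym_invariant_def)
      then show ?thesis by simp
    next
      case False
      then obtain j where "\<not> inj (t j)" by blast
      then have "\<not> inj (\<lambda>i. x $ j $ t j i)" by (auto simp: inj_def) metis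
      then have "alt (($) (y $ j)) (\<lambda>i. x $ j $ t j i) = 0" by (rule alt_eq_0)
      then have "(\<Prod>j\<in>UNIV. alt (($) (y $ j)) (\<lambda>i. x $ j $ t j i) * (\<Prod>i\<in>UNIV. ?c j i (t j i))) = 0"
        by (intro prod_zero) auto
      then show ?thesis by simp
    qed
  qed
  also have "\<dots> = (\<Sum>t\<in>PiE UNIV (\<lambda>_. UNIV). \<Prod>j\<in>UNIV. alt (($) (y $ j)) (\<lambda>i. x $ j $ t j i) * (\<Prod>i\<in>UNIV. ?c j i (t j i))) * f x"
    by (simp add: sum_distrib_right PiE_UNIV_domain)
  also have "(\<Sum>t\<in>PiE UNIV (\<lambda>_. UNIV). \<Prod>j\<in>UNIV. alt (($) (y $ j)) (\<lambda>i. x $ j $ t j i) * (\<Prod>i\<in>UNIV. ?c j i (t j i))) =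
    (\<Prod>j\<in>UNIV. \<Sum>t\<in>UNIV. alt (($) (y $ j)) (\<lambda>i. x $ j $ t i) * (\<Prod>i\<in>UNIV. ?c j i (t i)))"
    by (rule prod_sum_PiE[symmetric]) auto
  also have "\<dots> = 1"
    by (rule prod.neutral) (use x alt_total in \<open>auto simp: regular_def\<close>)
  finally show ?thesis by simp
qed

section \<open>Differentiation in the elementary symmetric functions\<close>

definition block_dirs :: "('n::{finite,linorder}, 'p::finite) blocks \<Rightarrow> ('n, 'p) blocks set" where
  "block_dirs b = {c. blk c = blk b}"

text \<open>By \<open>vieta\<close>, the change of the root polynomial per unit of the elementary
  symmetric function belonging to \<open>b\<close>.\<close>

definition dir_poly :: "('n::{finite,linorder}, 'p::finite) blocks \<Rightarrow> real poly" where
  "dir_poly b = monom ((- 1) ^ crank (idx b)) (CARD('n) - crank (idx b))"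

lemma poly_nodes:
  fixes x :: "('n::{finite,linorder}, 'p::finite) blocks"
  shows "poly (node_poly (nodes x c)) t = (\<Prod>l\<in>UNIV. t - x $ blk c $ l)"
  by (simp add: nodes_def poly_node_poly_map distinct_enum set_enum)

lemma theta_nth: "theta x $ j = sigma (x $ j)"
  by (simp add: theta_def)

text \<open>The line through \<open>theta x\<close> in direction \<open>b\<close> is lifted to the
  roots by the local inverse of \<open>sigma\<close> in one block. The lift is claimed to be
  continuous; what moves linearly is its node polynomial, as in
  \<open>run_has_derivative\<close>.\<close>

lemma regular_curve:
  fixes x :: "('n::{finite,linorder}, 'p::finite) blocks"
  assumes x: "regular x" and b: "b \<in> Basis"
  obtains S \<xi> where "open S" "(0::real) \<in> S" "\<xi> 0 = x" "\<forall>s\<in>S. regular (\<xi> s)"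
    "\<forall>s\<in>S. theta (\<xi> s) = theta x + s *\<^sub>R b"
    "\<forall>s j. j \<noteq> blk b \<longrightarrow> \<xi> s $ j = x $ j"
    "\<forall>j i. continuous_on S (\<lambda>s. \<xi> s $ j $ i)"
proof -
  define j where "j = blk b"
  define i where "i = idx b"
  have b: "b = coord j i" using coord_blk_idx[OF b] by (simp add: j_def i_def)
  have "inj (($) (x $ j))" using x by (simp add: regular_def)
  then obtain U g where U: "open U" "x $ j \<in> U" "open (sigma ` U)"
    "homeomorphism U (sigma ` U) sigma g" "\<forall>w\<in>U. inj (($) w)" "\<forall>w\<in>U. \<forall>i. \<bar>w $ i - x $ j $ i\<bar> < 1"
    by (rule sigma_local_homeomorphism[OF _ zero_less_one])
  let ?p = "\<lambda>s::real. sigma (x $ j) + s *\<^sub>R axis i 1"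
  define S where "S = ?p -` (sigma ` U)"
  define \<xi> where "\<xi> s = (\<chi> k. if k = j then g (?p s) else x $ k)" for s
  have cp: "continuous_on A ?p" for A by (intro continuous_intros)
  have gU: "g (?p s) \<in> U" "sigma (g (?p s)) = ?p s" if "s \<in> S" for s
    using U(4) that unfolding S_def homeomorphism_def by auto
  have "open S" unfolding S_def by (rule open_vimage[OF U(3) cp])
  moreover have "0 \<in> S" using U(2) by (simp add: S_def)
  moreover have "\<xi> 0 = x"
  proof (rule vec_eq_iff[THEN iffD2], rule allI)
    fix k
    have "g (sigma (x $ j)) = x $ j" using homeomorphism_apply1[OF U(4,2)] .
    then show "\<xi> 0 $ k = x $ k" by (simp add: \<xi>_def)
  qed
  moreover have "regular (\<xi> s)" if "s \<in> S" for s
    using x bspec[OF U(5) gU(1)[OF that]] by (simp add: regular_def \<xi>_def)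
  moreover have "theta (\<xi> s) = theta x + s *\<^sub>R b" if "s \<in> S" for s
  proof (rule vec_eq_iff[THEN iffD2], rule allI)
    fix k
    have "(s *\<^sub>R b) $ k = (if k = j then s *\<^sub>R axis i 1 else 0)"
      by (simp add: b coord_def axis_def)
    then show "theta (\<xi> s) $ k = (theta x + s *\<^sub>R b) $ k"
      unfolding vector_add_component theta_nth using gU(2)[OF that] by (simp add: \<xi>_def)
  qed
  moreover have "\<forall>s k. k \<noteq> blk b \<longrightarrow> \<xi> s $ k = x $ k"
    by (simp add: \<xi>_def j_def)
  moreover have "continuous_on S (\<lambda>s. \<xi> s $ k $ l)" for k l
  proof (cases "k = j")
    case True
    have "continuous_on S (\<lambda>s. g (?p s))"
      by (rule continuous_on_compose2[OF _ cp, of "sigma ` U"]) (use U(4) in \<open>auto simp: homeomorphism_def S_def\<close>)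
    then have "continuous_on S (\<lambda>s. g (?p s) $ l)" by (intro continuous_intros)
    then show ?thesis by (simp add: \<xi>_def True)
  qed (simp add: \<xi>_def)
  ultimately show ?thesis by (intro that[of S \<xi>]) blast+
qed

lemma cont_nodes_nodes:
  fixes \<xi> :: "'q::topological_space \<Rightarrow> ('n::{finite,linorder}, 'p::finite) blocks"
  assumes "\<And>j i. continuous_on S (\<lambda>s. \<xi> s $ j $ i)"
  shows "cont_nodes S (\<lambda>s. nodes (\<xi> s))"
  unfolding cont_nodes_def
proof
  fix c :: "('n, 'p) blocks"
  let ?fs = "map (\<lambda>l s. \<xi> s $ blk c $ l) enum_list"
  have "?fs \<noteq> []" using length_enum[where ?'n = 'n] by (metis length_0_conv length_map zero_less_card_finite less_irrefl)
  then show "\<exists>fs. fs \<noteq> [] \<and> (\<forall>f\<in>set fs. continuous_on S f) \<and> (\<forall>p. nodes (\<xi> p) c = map (\<lambda>f. f p) fs)"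
    using assms by (intro exI[of _ ?fs]) (auto simp: nodes_def)
qed

text \<open>The formula for \<open>pds bs F\<close> at \<open>theta x\<close>, with \<open>y\<close>
  in the weights and \<open>x\<close> in the nodes. It also makes sense, and is continuous in
  \<open>x\<close>, where roots coincide.\<close>

definition lifted_deriv :: "('n::{finite,linorder}, 'p::finite) blocks list \<Rightarrow> (('n, 'p) blocks \<Rightarrow> real) \<Rightarrow>
    ('n, 'p) blocks \<Rightarrow> ('n, 'p) blocks list \<Rightarrow> ('n, 'p) blocks \<Rightarrow> real" where
  "lifted_deriv cs f y bs x = (\<Sum>\<pi>\<in>block_perms. block_sign \<pi> *
     (\<Sum>w\<leftarrow>words block_dirs dir_poly (bword cs (\<lambda>_. []) (newton_weight y \<pi>)) bs. run (nodes x) w f 0))"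

lemma words_lvar_Basis:
  assumes "set cs = Basis" "w \<in> set (words J v (bword cs Q W) bs)"
  shows "lvar ` set w \<subseteq> Basis"
  using words_lvar[OF assms(2)] assms(1) by (simp add: lvar_bword)

lemma sum_list_concat_map: "(\<Sum>w\<leftarrow>concat (map g ws). h w) = (\<Sum>w\<leftarrow>ws. \<Sum>w'\<leftarrow>g w. (h w' :: real))"
  by (induction ws) auto

lemma lifted_deriv_has_derivative:
  fixes \<xi> :: "real \<Rightarrow> ('n::{finite,linorder}, 'p::finite) blocks"
  assumes f: "smooth f" and cs: "set cs = Basis" and S: "open S" "0 \<in> S" and b: "b \<in> Basis"
    and \<xi>: "\<And>s. s \<in> S \<Longrightarrow> theta (\<xi> s) = theta (\<xi> 0) + s *\<^sub>R b"
      "\<And>s j. s \<in> S \<Longrightarrow> j \<noteq> blk b \<Longrightarrow> \<xi> s $ j = \<xi> 0 $ j"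
      "\<And>j i. continuous_on S (\<lambda>s. \<xi> s $ j $ i)"
  shows "((\<lambda>s. lifted_deriv cs f y bs (\<xi> s)) has_real_derivative lifted_deriv cs f y (b # bs) (\<xi> 0)) (at 0)"
proof -
  have R: "((\<lambda>s. run (nodes (\<xi> s)) w f 0) has_real_derivative
     (\<Sum>w'\<leftarrow>word_deriv (block_dirs b) (dir_poly b) w. run (nodes (\<xi> 0)) w' f 0)) (at 0)"
    if w: "lvar ` set w \<subseteq> Basis" for w
  proof (rule run_has_derivative[OF f w S cont_nodes_nodes[OF \<xi>(3)]])
    fix c :: "('n, 'p) blocks" and s :: real
    assume s: "s \<in> S" and c: "c \<in> Basis"
    show "nodes (\<xi> s) c = nodes (\<xi> 0) c" if "c \<notin> block_dirs b"
      using \<xi>(2)[OF s, of "blk c"] that by (simp add: nodes_def block_dirs_def)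
    assume "c \<in> block_dirs b"
    then have bc: "blk c = blk b" by (simp add: block_dirs_def)
    have "sigma (\<xi> s $ blk b) = sigma (\<xi> 0 $ blk b) + s *\<^sub>R axis (idx b) 1"
    proof -
      have "theta (\<xi> s) $ blk b = (theta (\<xi> 0) + s *\<^sub>R coord (blk b) (idx b)) $ blk b"
        unfolding coord_blk_idx[OF b] \<xi>(1)[OF s] ..
      then show ?thesis by (simp add: theta_nth coord_def)
    qed
    from sigma_eq_prod[OF this]
    show "\<forall>t. poly (node_poly (nodes (\<xi> s) c)) t = poly (node_poly (nodes (\<xi> 0) c)) t + s * poly (dir_poly b) t"
      by (simp add: poly_nodes bc dir_poly_def poly_monom)
  qed
  show ?thesis
    unfolding lifted_deriv_def
  proof (intro DERIV_sum DERIV_cmult)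
    fix \<pi> :: "'p \<Rightarrow> 'n \<Rightarrow> 'n"
    let ?ws = "words block_dirs dir_poly (bword cs (\<lambda>_. []) (newton_weight y \<pi>)) bs"
    have "((\<lambda>s. \<Sum>w\<leftarrow>?ws. run (nodes (\<xi> s)) w f 0) has_real_derivative
      (\<Sum>w\<leftarrow>?ws. \<Sum>w'\<leftarrow>word_deriv (block_dirs b) (dir_poly b) w. run (nodes (\<xi> 0)) w' f 0)) (at 0)"
      by (intro DERIV_sum_list R words_lvar_Basis[OF cs])
    then show "((\<lambda>s. \<Sum>w\<leftarrow>?ws. run (nodes (\<xi> s)) w f 0) has_real_derivative
      (\<Sum>w\<leftarrow>words block_dirs dir_poly (bword cs (\<lambda>_. []) (newton_weight y \<pi>)) (b # bs). run (nodes (\<xi> 0)) w f 0)) (at 0)"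
      by (simp add: sum_list_concat_map)
  qed
qed

text \<open>Induction from the representation: along a lifted line the derivative of the formula is
  the formula with one more direction. Since \<open>y\<close> is constant in this differentiation
  and arbitrary, it may be set to \<open>x\<close> afterwards.\<close>

lemma pds_at_regular:
  fixes f F :: "('n::{finite,linorder}, 'p::finite) blocks \<Rightarrow> real"
  assumes f: "smooth f" and inv: "prod_sym_invariant f" and F: "\<And>x. f x = F (theta x)"
    and cs: "distinct cs" "set cs = Basis" and bs: "bs \<in> lists Basis" and x: "regular x"
  shows "pds bs F (theta x) = lifted_deriv cs f y bs x"
    and "b \<in> Basis \<Longrightarrow> (\<lambda>t. pds bs F (theta x + t *\<^sub>R b)) differentiable (at 0)"
proof -
  have step: "((\<lambda>t. pds bs F (theta x + t *\<^sub>R b)) has_real_derivative lifted_deriv cs f y (b # bs) x) (at 0)"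
    if IH: "\<And>x. regular x \<Longrightarrow> pds bs F (theta x) = lifted_deriv cs f y bs x" and b: "b \<in> Basis" and x: "regular x" for bs b x
  proof -
    from x b obtain S \<xi> where S: "open S" "(0::real) \<in> S" and \<xi>: "\<xi> 0 = x" "\<forall>s\<in>S. regular (\<xi> s)"
    "\<forall>s\<in>S. theta (\<xi> s) = theta x + s *\<^sub>R b"
    "\<forall>s j. j \<noteq> blk b \<longrightarrow> \<xi> s $ j = x $ j"
    "\<forall>j i. continuous_on S (\<lambda>s. \<xi> s $ j $ i)" by (rule regular_curve)
    have D: "((\<lambda>s. lifted_deriv cs f y bs (\<xi> s)) has_real_derivative lifted_deriv cs f y (b # bs) x) (at 0)"
      using lifted_deriv_has_derivative[OF f cs(2) S b, of \<xi> y bs] \<xi> by simp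
    have E: "lifted_deriv cs f y bs (\<xi> s) = pds bs F (theta x + s *\<^sub>R b)" if "s \<in> S" for s
      using IH[of "\<xi> s"] \<xi>(2,3) that by simp
    show ?thesis by (rule has_field_derivative_transform_within_open[OF D S E])
  qed
  have main: "pds bs F (theta x) = lifted_deriv cs f y bs x" if "bs \<in> lists Basis" "regular x" for bs x
    using that
  proof (induction bs arbitrary: x)
    case Nil
    then show ?case
      using representation[OF Nil(1) f inv cs, of y] F[of x] by (simp add: lifted_deriv_def)
  next
    case (Cons b bs)
    from step[OF Cons.IH Cons.hyps(1) Cons.prems] show ?case
      by (simp add: pd_def DERIV_imp_deriv)
  qed
  show "pds bs F (theta x) = lifted_deriv cs f y bs x" by (rule main[OF bs x])
  show "(\<lambda>t. pds bs F (theta x + t *\<^sub>R b)) differentiable (at 0)" if "b \<in> Basis"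
    using step[OF main[OF bs] that x] real_differentiable_def by blast
qed

lemma continuous_lifted_deriv:
  fixes f :: "('n::{finite,linorder}, 'p::finite) blocks \<Rightarrow> real"
  assumes f: "smooth f" and cs: "set cs = Basis"
  shows "continuous_on UNIV (lifted_deriv cs f y bs)"
proof -
  have "continuous_on UNIV (\<lambda>x. run (nodes x) w f 0)" if "lvar ` set w \<subseteq> Basis" for w
  proof (rule smooth_fam_compose0[where g = "\<lambda>x. x" and h = "\<lambda>_. 0" and S = UNIV])
    show "smooth_fam UNIV (\<lambda>x. run (nodes x) w f)"
      by (rule smooth_fam_run[OF smooth_fam_const[OF f] that cont_nodes_nodes]) (intro continuous_intros)
  qed (auto intro: continuous_intros)
  then show ?thesis
    unfolding lifted_deriv_def using words_lvar_Basis[OF cs]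
    by (intro continuous_intros continuous_on_sum_list) blast
qed

lemma regular_dense:
  fixes h :: "('n::{finite,linorder}, 'p::finite) blocks \<Rightarrow> real"
  assumes h: "continuous_on UNIV h" and 0: "\<And>x. regular x \<Longrightarrow> h x = 0"
  shows "h x = 0"
proof -
  let ?y = "\<lambda>s::real. \<chi> j i. x $ j $ i + s * real (cpos i)"
  \<comment> \<open>For each pair of coordinates at most one \<open>s\<close> makes them collide.
    Triples with \<open>i = l\<close> contribute just \<open>0 / 0 = 0\<close>, and the exceptional
    set is finite.\<close>
  let ?B = "(\<lambda>(j, i, l). (x $ j $ i - x $ j $ l) / (real (cpos l) - real (cpos i))) ` UNIV"
  have reg: "regular (?y s)" if "s \<notin> ?B" for s
    unfolding regular_def
  proof (intro allI injI)
    fix j i l assume e: "?y s $ j $ i = ?y s $ j $ l"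
    show "i = l"
    proof (rule ccontr)
      assume "i \<noteq> l"
      then have "real (cpos l) - real (cpos i) \<noteq> 0" using cpos_inj[of l i] by auto
      then have "s = (x $ j $ i - x $ j $ l) / (real (cpos l) - real (cpos i))"
        using e by (simp add: field_simps)
      then show False
        using that rangeI[of "\<lambda>(j, i, l). (x $ j $ i - x $ j $ l) / (real (cpos l) - real (cpos i))" "(j, i, l)"] by simp
    qed
  qed
  have c: "continuous_on UNIV (\<lambda>s. h (?y s))"
    by (rule continuous_on_compose2[OF h]) (intro continuous_intros, auto)
  have "closed ((\<lambda>s. h (?y s)) -` {0})"
    using c closed_vimage by blast
  moreover have "- ?B \<subseteq> (\<lambda>s. h (?y s)) -` {0}" using reg 0 by auto
  ultimately have "closure (- ?B) \<subseteq> (\<lambda>s. h (?y s)) -` {0}" by (simp add: closure_minimal)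
  moreover have "closure (- ?B) = UNIV"
    using empty_interior_finite[of ?B] by (simp add: closure_complement)
  ultimately have "h (?y 0) = 0" by blast
  moreover have "?y 0 = x" by (simp add: vec_eq_iff)
  ultimately show ?thesis by simp
qed

section \<open>Existence of the extension\<close>

lemma continuous_on_theta: "continuous_on S theta"
  unfolding theta_def sigma_def esym_def by (intro continuous_intros)

text \<open>\<open>root_bound\<close> bounds the preimages of a convergent sequence, so a
  subsequence of them converges inside \<open>C\<close>.\<close>

lemma closed_theta_image:
  fixes C :: "('n::{finite,linorder}, 'p::finite) blocks set"
  assumes "closed C"
  shows "closed (theta ` C)"
  unfolding closed_sequential_limits
proof (intro allI impI, elim conjE)
  fix y l assume y: "\<forall>n. y n \<in> theta ` C" and l: "y \<longlonglongrightarrow> l"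
  from y have "\<forall>n. \<exists>c. c \<in> C \<and> y n = theta c" by blast
  from choice[OF this] obtain c where "\<forall>n. c n \<in> C \<and> y n = theta (c n)" ..
  then have c: "\<And>n. c n \<in> C" "\<And>n. y n = theta (c n)" by blast+
  obtain B where B: "\<And>n. norm (y n) \<le> B"
    using convergent_imp_bounded[OF l] by (auto simp: bounded_iff)
  have "norm (c n) \<le> (\<Sum>j\<in>(UNIV::'p set). \<Sum>i\<in>(UNIV::'n set). 1 + (\<Sum>k\<in>(UNIV::'n set). B))" for n
  proof -
    have "\<bar>c n $ j $ i\<bar> \<le> 1 + (\<Sum>k\<in>(UNIV::'n set). B)" for j i
    proof -
      have "\<bar>sigma (c n $ j) $ k\<bar> \<le> B" for k
        using component_le_norm_cart[of "sigma (c n $ j)" k] Finite_Cartesian_Product.norm_nth_le[of "theta (c n)" j] B[of n] c(2)[of n]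
        by (simp add: theta_nth)
      then have "(\<Sum>k\<in>UNIV. \<bar>sigma (c n $ j) $ k\<bar>) \<le> (\<Sum>k\<in>(UNIV::'n set). B)" by (intro sum_mono)
      then show ?thesis using root_bound[of "c n $ j" i] by linarith
    qed
    then have "(\<Sum>i\<in>UNIV. \<bar>c n $ j $ i\<bar>) \<le> (\<Sum>i\<in>(UNIV::'n set). 1 + (\<Sum>k\<in>(UNIV::'n set). B))" for j
      by (rule sum_mono)
    then have "norm (c n $ j) \<le> (\<Sum>i\<in>(UNIV::'n set). 1 + (\<Sum>k\<in>(UNIV::'n set). B))" for j
      using norm_le_l1_cart[of "c n $ j"] order_trans by blast
    then have "(\<Sum>j\<in>UNIV. norm (c n $ j)) \<le> (\<Sum>j\<in>(UNIV::'p set). \<Sum>i\<in>(UNIV::'n set). 1 + (\<Sum>k\<in>(UNIV::'n set). B))"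
      by (rule sum_mono)
    moreover have "norm (c n) \<le> (\<Sum>j\<in>UNIV. norm (c n $ j))"
      unfolding norm_vec_def[of "c n"] by (rule L2_set_le_sum) simp
    ultimately show ?thesis by linarith
  qed
  then have "bounded (range c)" by (auto simp: bounded_iff)
  from bounded_imp_convergent_subsequence[OF this] obtain x r where r: "strict_mono r" "(c \<circ> r) \<longlonglongrightarrow> x" by blast
  have "x \<in> C"
    by (rule closed_sequentially[OF assms _ r(2)]) (simp add: c)
  moreover have "(\<lambda>n. theta ((c \<circ> r) n)) \<longlonglongrightarrow> theta x"
    by (rule continuous_on_tendsto_compose[OF continuous_on_theta[of UNIV] r(2)]) auto
  moreover have "(\<lambda>n. theta ((c \<circ> r) n)) \<longlonglongrightarrow> l"
    using LIMSEQ_subseq_LIMSEQ[OF l r(1)] c(2) by (simp add: o_def)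
  ultimately show "l \<in> theta ` C" using LIMSEQ_unique by blast
qed

text \<open>A continuous closed map is a quotient map onto its image, so continuity can be tested
  after composition with \<open>theta\<close>.\<close>

lemma continuous_on_theta_range:
  fixes h :: "('n::{finite,linorder}, 'p::finite) blocks \<Rightarrow> real"
  assumes "continuous_on UNIV h" "\<And>x. g (theta x) = h x"
  shows "continuous_on (range theta) g"
proof -
  have A: "closed (range (theta :: ('n, 'p) blocks \<Rightarrow> _))"
    by (rule closed_theta_image) simp
  have "closed (g -` B \<inter> range theta)" if "closed B" for B
  proof -
    have "g -` B \<inter> range theta = theta ` (h -` B)" using assms(2) by auto
    then show ?thesis using closed_theta_image closed_vimage[OF that assms(1)] by simp
  qed
  then show ?thesis using continuous_on_closed_vimage[OF A] by blast
qed

lemma sigma_permute: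
  fixes v :: "real ^ 'n::{finite,linorder}"
  assumes "p permutes UNIV"
  shows "sigma (\<chi> i. v $ p i) = sigma v"
proof -
  have "esym k (\<chi> i. v $ p i) = esym k v" for k
  proof -
    have inj: "inj p" and surj: "surj p" using permutes_inj[OF assms] permutes_surj[OF assms] by auto
    have "bij_betw (image p) {S. card S = k} {S. card S = k}"
    proof (rule bij_betwI[where g = "image (inv p)"])
      show "image p \<in> {S. card S = k} \<rightarrow> {S. card S = k}"
        using inj by (auto simp: card_image inj_on_subset)
      show "image (inv p) \<in> {S. card S = k} \<rightarrow> {S. card S = k}"
        using surj_imp_inj_inv[OF surj] by (auto simp: card_image inj_on_subset)
    qed (simp_all add: image_image inv_f_f[OF inj] surj_f_inv_f[OF surj])
    from sum.reindex_bij_betw[OF this, of "\<lambda>S. \<Prod>i\<in>S. v $ i"]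
    have "esym k v = (\<Sum>S\<in>{S. card S = k}. \<Prod>i\<in>p ` S. v $ i)" by (simp add: esym_def)
    also have "\<dots> = esym k (\<chi> i. v $ p i)"
      unfolding esym_def using inj by (intro sum.cong refl) (simp add: prod.reindex inj_on_subset)
    finally show ?thesis ..
  qed
  then show ?thesis by (simp add: sigma_def)
qed

lemma theta_permute:
  assumes "\<And>j. p j permutes UNIV"
  shows "theta (\<chi> j. \<chi> i. x $ j $ p j i) = theta x"
  by (simp add: theta_def sigma_permute[OF assms])

lemma theta_eq_permutes:
  fixes x x' :: "('n::{finite,linorder}, 'p::finite) blocks"
  assumes "theta x = theta x'"
  obtains p where "\<And>j. p j permutes UNIV" "x = (\<chi> j. \<chi> i. x' $ j $ p j i)"
proof -
  have "\<exists>q. q permutes UNIV \<and> (\<forall>i. x $ j $ i = x' $ j $ q i)" for j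
  proof -
    have "sigma (x $ j) = sigma (x' $ j)" using assms theta_nth by metis
    then obtain q where "q permutes UNIV" "\<And>i. x $ j $ i = x' $ j $ q i" by (metis sigma_eq_permutes)
    then show ?thesis by blast
  qed
  then have "\<forall>j. \<exists>q. q permutes UNIV \<and> (\<forall>i. x $ j $ i = x' $ j $ q i)" by blast
  from choice[OF this] obtain p where p: "\<forall>j. p j permutes UNIV \<and> (\<forall>i. x $ j $ i = x' $ j $ p j i)" ..
  then have "x = (\<chi> j. \<chi> i. x' $ j $ p j i)" by (simp add: vec_eq_iff)
  with p show ?thesis by (intro that[of p]) auto
qed

text \<open>At a double root \<open>sigma_nonregular_perturb\<close> leaves the image by arbitrarily
  small steps.\<close>

lemma interior_theta_regular:
  fixes x :: "('n::{finite,linorder}, 'p::finite) blocks"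
  assumes "theta x \<in> interior (range theta)"
  shows "regular x"
proof (rule ccontr)
  assume "\<not> regular x"
  then obtain j where "\<not> inj (($) (x $ j))" by (auto simp: regular_def)
  then obtain q :: "real ^ 'n::{finite,linorder}" where q: "\<And>e. 0 < e \<Longrightarrow> sigma (x $ j) + e *\<^sub>R q \<notin> range sigma"
    using sigma_nonregular_perturb by blast
  let ?y = "\<lambda>e. theta x + e *\<^sub>R axis j q"
  have "isCont ?y 0" by (intro continuous_intros)
  moreover have "?y 0 \<in> interior (range theta)" using assms by simp
  ultimately have "\<forall>\<^sub>F e in at 0. ?y e \<in> interior (range theta)"
    unfolding isCont_def by (rule topological_tendstoD[OF _ open_interior])
  then obtain d where d: "0 < d" "\<And>e. e \<noteq> 0 \<Longrightarrow> dist e 0 < d \<Longrightarrow> ?y e \<in> interior (range theta)"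
    by (auto simp: eventually_at)
  have "?y (d / 2) \<in> range theta" using d(2)[of "d / 2"] d(1) interior_subset by auto
  then obtain z where "?y (d / 2) = theta z" by auto
  then have "?y (d / 2) $ j = sigma (z $ j)" by (simp add: theta_nth)
  then have "sigma (x $ j) + (d / 2) *\<^sub>R q = sigma (z $ j)" by (simp add: theta_nth axis_def)
  with q[of "d / 2"] d(1) show False by auto
qed

lemma regular_permute:
  assumes "regular x" "\<And>j. p j permutes UNIV"
  shows "regular (\<chi> j. \<chi> i. x $ j $ p j i)"
  unfolding regular_def
proof
  fix j
  have "inj (($) (x $ j) \<circ> p j)"
    using assms permutes_inj[OF assms(2)[of j]] by (intro inj_compose) (auto simp: regular_def)
  then show "inj (($) ((\<chi> j. \<chi> i. x $ j $ p j i) $ j))" by (simp add: inj_on_def)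
qed

text \<open>At regular points both sides are the derivative of \<^term>\<open>F\<close>, and regular points are dense.\<close>

lemma lifted_deriv_eq:
  fixes f F :: "('n::{finite,linorder}, 'p::finite) blocks \<Rightarrow> real"
  assumes f: "smooth f" and inv: "prod_sym_invariant f" and F: "\<And>x. f x = F (theta x)"
    and cs: "distinct cs" "set cs = Basis" and bs: "bs \<in> lists Basis" and xx': "theta x = theta x'"
  shows "lifted_deriv cs f y bs x = lifted_deriv cs f y' bs x'"
proof -
  obtain p where p: "\<And>j. p j permutes UNIV" "x = (\<chi> j. \<chi> i. x' $ j $ p j i)"
    using theta_eq_permutes[OF xx'] by metis
  let ?p = "\<lambda>z. (\<chi> j. \<chi> i. z $ j $ p j i) :: ('n, 'p) blocks"
  have "lifted_deriv cs f y bs (?p x') - lifted_deriv cs f y' bs x' = 0"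
  proof (rule regular_dense)
    have "continuous_on UNIV ?p" by (intro continuous_intros)
    then show "continuous_on UNIV (\<lambda>z. lifted_deriv cs f y bs (?p z) - lifted_deriv cs f y' bs z)"
      by (intro continuous_on_diff continuous_on_compose2[OF continuous_lifted_deriv[OF f cs(2)]]
          continuous_lifted_deriv[OF f cs(2)]) auto
    fix z :: "('n, 'p) blocks" assume z: "regular z"
    have "theta (?p z) = theta z" by (rule theta_permute[OF p(1)])
    then show "lifted_deriv cs f y bs (?p z) - lifted_deriv cs f y' bs z = 0"
      using pds_at_regular(1)[OF f inv F cs bs regular_permute[OF z, of p, OF p(1)], where y = y]
        pds_at_regular(1)[OF f inv F cs bs z, where y = y'] by simp
  qed
  then show ?thesis unfolding p(2)[symmetric] by simp
qed

text \<open>Here weights and nodes finally share the point \<open>x\<close>, so nodes cancel and the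
  loss is exactly \<open>n\<close> derivatives per direction.\<close>

lemma lifted_deriv_bound:
  fixes f :: "('n::{finite,linorder}, 'p::finite) blocks \<Rightarrow> real"
  assumes u: "jet_bound R a f" and a: "\<And>m. 0 \<le> a m" "mono a" and R: "0 \<le> R"
    and cs: "distinct cs" "set cs = Basis" and bs: "bs \<in> lists Basis"
    and x: "\<And>j i. \<bar>x $ j $ i\<bar> \<le> R"
    and L: "\<And>b :: ('n, 'p) blocks. b \<in> Basis \<Longrightarrow> poly_norm R (- dir_poly b) \<le> L" "0 \<le> L"
  shows "\<bar>lifted_deriv cs f x bs x\<bar> \<le> real (card (block_perms :: ('p \<Rightarrow> 'n \<Rightarrow> 'n) set)) *
    (fact (length cs + length bs) * (L ^ length bs * a (CARD('n) * length bs)))"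
proof -
  let ?B = "fact (length cs + length bs) * (L ^ length bs * a (CARD('n) * length bs))"
  have "\<bar>block_sign \<pi> * (\<Sum>w\<leftarrow>words block_dirs dir_poly (bword cs (\<lambda>_. []) (newton_weight x \<pi>)) bs. run (nodes x) w f 0)\<bar> \<le> ?B"
    if \<pi>: "\<pi> \<in> block_perms" for \<pi> :: "'p \<Rightarrow> 'n \<Rightarrow> 'n"
  proof -
    have "\<bar>of_int (sign (p :: 'n \<Rightarrow> 'n)) :: real\<bar> = 1" for p
      by (simp add: sign_def)
    then have "\<bar>block_sign \<pi>\<bar> = 1" by (simp add: block_sign_def abs_prod)
    moreover have "\<bar>\<Sum>w\<leftarrow>words block_dirs dir_poly (bword cs (\<lambda>_. []) (newton_weight x \<pi>)) bs. run (nodes x) w f 0\<bar> \<le> ?B"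
    proof (rule words_bound[OF u a R L(2), where i = "\<lambda>c. cpos (idx c)" and j = "\<lambda>c. cpos (\<pi> (blk c) (idx c))"])
      \<comment> \<open>The offsets balance because each \<open>\<pi> j\<close> only permutes the
        positions in its block.\<close>
      have "(\<Sum>c\<leftarrow>cs. cpos (idx c)) = (\<Sum>c\<in>(Basis :: ('n, 'p) blocks set). cpos (idx c))"
        using cs by (simp add: sum_list_distinct_conv_sum_set)
      also have "\<dots> = (\<Sum>(j, i)\<in>(UNIV :: ('p \<times> 'n) set). cpos (i :: 'n))"
        unfolding Basis_coord by (subst sum.reindex) (auto intro!: injI simp: case_prod_unfold)
      also have "\<dots> = (\<Sum>j\<in>(UNIV :: 'p set). \<Sum>i\<in>(UNIV :: 'n set). cpos i)"
        unfolding sum.cartesian_product UNIV_Times_UNIV ..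
      also have "\<dots> = (\<Sum>j\<in>(UNIV :: 'p set). \<Sum>i\<in>(UNIV :: 'n set). cpos (\<pi> j i))"
      proof (rule sum.cong[OF refl])
        fix j
        have "\<pi> j permutes UNIV" using \<pi> by (simp add: block_perms_def)
        from sum.permute[OF this, of cpos] show "(\<Sum>i\<in>(UNIV :: 'n set). cpos i) = (\<Sum>i\<in>(UNIV :: 'n set). cpos (\<pi> j i))"
          by (simp add: o_def)
      qed
      also have "\<dots> = (\<Sum>(j, i)\<in>(UNIV :: ('p \<times> 'n) set). cpos (\<pi> j i))"
        unfolding sum.cartesian_product UNIV_Times_UNIV ..
      also have "\<dots> = (\<Sum>c\<in>(Basis :: ('n, 'p) blocks set). cpos (\<pi> (blk c) (idx c)))"
        unfolding Basis_coord by (subst sum.reindex) (auto intro!: injI simp: case_prod_unfold)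
      also have "\<dots> = (\<Sum>c\<leftarrow>cs. cpos (\<pi> (blk c) (idx c)))"
        using cs by (simp add: sum_list_distinct_conv_sum_set)
      finally show "(\<Sum>c\<leftarrow>cs. cpos (idx c)) = (\<Sum>c\<leftarrow>cs. cpos (\<pi> (blk c) (idx c)))" .
      show "poly_norm R (- dir_poly b) \<le> L" if "b \<in> set bs" for b
        using that bs by (intro L(1)) auto
    qed (use x cs in \<open>auto simp: nodes_def length_enum newton_weight_def cpos_less\<close>)
    ultimately show ?thesis by (simp add: abs_mult)
  qed
  then show ?thesis
    unfolding lifted_deriv_def
    by (intro order_trans[OF sum_abs] order_trans[OF sum_bounded_above[of _ _ ?B]]) auto
qed

lemma fact_add_le: "(fact (m + n) :: real) \<le> 2 ^ (m + n) * fact m * fact n"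
proof -
  have "real ((m + n) choose m) \<le> 2 ^ (m + n)"
    using of_nat_mono[OF binomial_le_pow2[of "m + n" m], where ?'a = real] by simp
  then have "fact m * fact n * real ((m + n) choose m) \<le> fact m * fact n * 2 ^ (m + n)"
    by (intro mult_left_mono) auto
  moreover have "fact m * fact n * real ((m + n) choose m) = (fact (m + n) :: real)"
  proof -
    have "fact m * fact n * ((m + n) choose m) = (fact (m + n) :: nat)"
      using binomial_fact_lemma[of m "m + n"] by simp
    from arg_cong[OF this, of real] show ?thesis by simp
  qed
  ultimately have "fact (m + n) \<le> (fact m * fact n * 2 ^ (m + n) :: real)" by linarith
  then show ?thesis by (simp only: mult_ac)
qed

text \<open>A geometric bound for multinomial coefficients, splitting off one direction at a time
  with \<open>fact_add_le\<close>. It converts the factorials of \<open>CM_on\<close> into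
  \<open>weight\<close>.\<close>

lemma fact_length_le_weight:
  fixes bs :: "'a::euclidean_space list"
  assumes "bs \<in> lists Basis"
  shows "(fact (length bs) :: real) \<le> (2 ^ DIM('a)) ^ length bs * weight bs"
proof -
  let ?k = "\<lambda>c. count_list bs c"
  have *: "(fact (\<Sum>c\<in>B. ?k c) :: real) \<le> (2 ^ card B) ^ (\<Sum>c\<in>B. ?k c) * (\<Prod>c\<in>B. fact (?k c))" if "finite B" for B
    using that
  proof (induction B rule: finite_induct)
    case (insert b B)
    let ?s = "\<Sum>c\<in>B. ?k c"
    have "(fact (?k b + ?s) :: real) \<le> 2 ^ (?k b + ?s) * fact (?k b) * fact ?s" by (rule fact_add_le)
    also have "\<dots> \<le> 2 ^ (?k b + ?s) * fact (?k b) * ((2 ^ card B) ^ ?s * (\<Prod>c\<in>B. fact (?k c)))"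
      by (intro mult_left_mono insert.IH) auto
    also have "\<dots> \<le> 2 ^ (?k b + ?s) * fact (?k b) * ((2 ^ card B) ^ (?k b + ?s) * (\<Prod>c\<in>B. fact (?k c)))"
      by (intro mult_left_mono mult_right_mono power_increasing) (auto intro: prod_nonneg)
    also have "\<dots> = (2 ^ card (insert b B)) ^ (?k b + ?s) * (fact (?k b) * (\<Prod>c\<in>B. fact (?k c)))"
      using insert.hyps by (simp add: power_mult_distrib)
    finally show ?case using insert.hyps by simp
  qed simp
  have "length bs = (\<Sum>c\<in>Basis. ?k c)"
    using sum_count_set[of bs Basis] assms by (simp add: in_lists_conv_set subset_iff)
  with *[of Basis] show ?thesis by (simp add: weight_def)
qed

theorem extension_exists:
  fixes M N :: "nat \<Rightarrow> real" and f :: "('n::{finite,linorder}, 'p::finite) blocks \<Rightarrow> real"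
  assumes Mpos: "\<And>k. M k > 0" and Npos: "\<And>k. N k > 0" and Minc: "\<And>k. M k \<le> M (Suc k)"
    and bdd: "\<And>k. M (k * CARD('n)) \<le> B ^ k * N k" and B: "0 < B"
    and inv: "prod_sym_invariant f" and CM: "CM_on M UNIV f"
  shows "\<exists>F. CN_closed N (range theta) F \<and> (\<forall>x. f x = F (theta x))"
proof -
  let ?n = "CARD('n)" and ?A = "range (theta :: ('n, 'p) blocks \<Rightarrow> _)"
  have f: "smooth f" using CM by (simp add: CM_on_def)
  obtain cs :: "('n, 'p) blocks list" where cs: "distinct cs" "set cs = Basis"
    using finite_distinct_list[OF finite_Basis] by metis
  define pre where "pre y = (SOME x :: ('n, 'p) blocks. theta x = y)" for y
  have pre: "theta (pre (theta x)) = theta x" for x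
    unfolding pre_def by (rule someI) simp
  define F where "F y = f (pre y)" for y
  \<comment> \<open>The weight point \<open>0\<close> is a placeholder: by
    \<open>lifted_deriv_eq\<close> the value does not depend on it, and the estimate below uses the
    preimage instead.\<close>
  define G where "G bs y = lifted_deriv cs f 0 bs (pre y)" for bs y
  have F: "f x = F (theta x)" for x
  proof -
    obtain p where p: "\<And>j. p j permutes UNIV" "pre (theta x) = (\<chi> j. \<chi> i. x $ j $ p j i)"
      using theta_eq_permutes[OF pre] by metis
    then show ?thesis using inv by (simp add: F_def prod_sym_invariant_def)
  qed
  have G: "G bs (theta x) = lifted_deriv cs f y bs x" if "bs \<in> lists Basis" for bs x y
    unfolding G_def by (rule lifted_deriv_eq[OF f inv F cs that pre])
  have G_cont: "continuous_on ?A (G bs)" if "bs \<in> lists Basis" for bs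
    by (rule continuous_on_theta_range[OF continuous_lifted_deriv[OF f cs(2)] G[OF that]])
  have int: "\<exists>x. y = theta x \<and> regular x" if "y \<in> interior ?A" for y
  proof -
    from that interior_subset obtain x where "y = theta x" by blast
    with that interior_theta_regular show ?thesis by blast
  qed
  have G_int: "G bs y = pds bs F y" if "bs \<in> lists Basis" "y \<in> interior ?A" for bs y
    using int[OF that(2)] pds_at_regular(1)[OF f inv F cs that(1)] G[OF that(1)] by metis
  have "smooth_on (interior ?A) F"
    unfolding smooth_on_def
  proof (intro ballI conjI)
    fix bs :: "('n, 'p) blocks list" assume bs: "bs \<in> lists Basis"
    have "continuous_on (interior ?A) (G bs)"
      using G_cont[OF bs] interior_subset by (rule continuous_on_subset)
    then show "continuous_on (interior ?A) (pds bs F)"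
      by (rule continuous_on_eq) (rule G_int[OF bs])
    fix b y :: "('n, 'p) blocks" assume b: "b \<in> Basis" and "y \<in> interior ?A"
    from int[OF this(2)] pds_at_regular(2)[OF f inv F cs bs _ b]
    show "(\<lambda>t. pds bs F (y + t *\<^sub>R b)) differentiable at 0" by blast
  qed
  moreover have "\<exists>C>0. \<exists>\<rho>>0. \<forall>bs\<in>lists Basis. \<forall>y\<in>K. \<bar>G bs y\<bar> \<le> C * \<rho> ^ length bs * fact (length bs) * N (length bs)"
    if K: "compact K" "K \<subseteq> ?A" for K
  proof -
    obtain D where D: "0 < D" "\<And>y. y \<in> K \<Longrightarrow> norm y \<le> D"
      using compact_imp_bounded[OF K(1)] by (auto simp: bounded_pos)
    define R where "R = 1 + (\<Sum>k\<in>(UNIV :: 'n set). D)"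
    have R: "0 \<le> R" using D by (simp add: R_def)
    have xR: "\<bar>x $ j $ i\<bar> \<le> R" if "theta x \<in> K" for x j i
    proof -
      have "\<bar>sigma (x $ j) $ k\<bar> \<le> D" for k
        using component_le_norm_cart[of "sigma (x $ j)" k] Finite_Cartesian_Product.norm_nth_le[of "theta x" j] D(2)[OF that]
        by (simp add: theta_nth)
      then have "(\<Sum>k\<in>UNIV. \<bar>sigma (x $ j) $ k\<bar>) \<le> (\<Sum>k\<in>(UNIV :: 'n set). D)" by (intro sum_mono)
      then show ?thesis using root_bound[of "x $ j" i] by (simp add: R_def)
    qed
    let ?Box = "cbox (\<chi> j i. - R) (\<chi> j i. R) :: ('n, 'p) blocks set"
    from CM compact_cbox[of "\<chi> j i. - R" "\<chi> j i. R"]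
    obtain C \<rho> where C: "0 < C" "0 < \<rho>" "\<And>bs z. bs \<in> lists Basis \<Longrightarrow> z \<in> ?Box \<Longrightarrow>
      \<bar>pds bs f z\<bar> \<le> C * \<rho> ^ length bs * fact (length bs) * M (length bs)"
      unfolding CM_on_def by (metis subset_UNIV)
    \<comment> \<open>\<open>q\<close> absorbs \<open>\<rho>\<close> and the passage from
      \<open>fact\<close> to \<open>weight\<close>; the maximum with 1 makes \<open>a\<close>
      increasing.\<close>
    define q where "q = max 1 \<rho> * 2 ^ DIM(('n, 'p) blocks)"
    have q: "1 \<le> q" unfolding q_def by (metis max.cobounded1 mult_mono' one_le_numeral one_le_power mult_1 zero_le_one)
    define a where "a m = C * q ^ m * M m" for m
    have a0: "0 \<le> a m" for m using C(1) q Mpos[of m] by (simp add: a_def)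
    have am: "mono a"
    proof (rule incseq_SucI)
      fix m
      have "q ^ m * M m \<le> q ^ Suc m * M (Suc m)"
        by (rule mult_mono) (use q Minc[of m] Mpos[of m] in \<open>auto intro: power_increasing\<close>)
      then show "a m \<le> a (Suc m)" using C(1) by (simp add: a_def mult.assoc)
    qed
    have jb: "jet_bound R a f"
    proof (rule jet_boundI[OF f])
      fix bs :: "('n, 'p) blocks list" and z :: "('n, 'p) blocks"
      assume bs: "bs \<in> lists Basis" and z: "\<And>c. c \<in> Basis \<Longrightarrow> \<bar>z \<bullet> c\<bar> \<le> R"
      let ?m = "length bs"
      have zB: "z \<in> ?Box"
      proof -
        have "\<bar>z $ j $ i\<bar> \<le> R" for j i using z[of "coord j i"] by simp
        then show ?thesis by (auto simp: mem_box Basis_coord abs_le_iff minus_le_iff)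
      qed
      have "\<bar>pds bs f z\<bar> \<le> (C * \<rho> ^ ?m * M ?m) * fact ?m"
        using C(3)[OF bs zB] by (simp add: mult_ac)
      also have "\<dots> \<le> (C * \<rho> ^ ?m * M ?m) * ((2 ^ DIM(('n, 'p) blocks)) ^ ?m * weight bs)"
        using C Mpos[of ?m] by (intro mult_left_mono fact_length_le_weight[OF bs]) (simp add: less_imp_le)
      also have "\<dots> = (\<rho> * 2 ^ DIM(('n, 'p) blocks)) ^ ?m * (weight bs * (C * M ?m))"
        by (simp add: power_mult_distrib mult_ac)
      also have "\<dots> \<le> q ^ ?m * (weight bs * (C * M ?m))"
        using C Mpos[of ?m] weight_pos[of bs] unfolding q_def by (intro mult_right_mono power_mono) (auto simp: less_imp_le)
      finally show "\<bar>pds bs f z\<bar> \<le> weight bs * a ?m" by (simp add: a_def mult_ac)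
    qed
    define L where "L = 1 + (\<Sum>b\<in>(Basis :: ('n, 'p) blocks set). poly_norm R (- dir_poly b))"
    have L1: "poly_norm R (- dir_poly b) \<le> L" if "b \<in> Basis" for b :: "('n, 'p) blocks"
      unfolding L_def using member_le_sum[OF that, of "\<lambda>b. poly_norm R (- dir_poly b)"] poly_norm_nonneg[OF R] by fastforce
    have L0: "0 < L" unfolding L_def using poly_norm_nonneg[OF R] by (simp add: sum_nonneg add_pos_nonneg)
    let ?c = "real (card (block_perms :: ('p \<Rightarrow> 'n \<Rightarrow> 'n) set))" and ?l = "length cs"
    \<comment> \<open>The powers of 2 come from \<open>fact_add_le\<close>, \<open>L\<close> from
      the inserted multipliers, \<open>q ^ ?n\<close> from \<open>a\<close> at order
      \<open>?n * k\<close>, and \<open>B\<close> from the growth condition.\<close>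
    let ?C = "(?c + 1) * 2 ^ ?l * fact ?l * C" and ?r = "2 * L * q ^ ?n * B"
    have "\<bar>G bs y\<bar> \<le> ?C * ?r ^ length bs * fact (length bs) * N (length bs)" if bs: "bs \<in> lists Basis" and y: "y \<in> K" for bs y
    proof -
      let ?k = "length bs"
      obtain x where x: "y = theta x" using y K(2) by auto
      have "\<bar>G bs y\<bar> = \<bar>lifted_deriv cs f x bs x\<bar>" unfolding x by (simp only: G[OF bs, where y = x])
      also have "\<dots> \<le> ?c * (fact (?l + ?k) * (L ^ ?k * a (?n * ?k)))"
        by (rule lifted_deriv_bound[OF jb a0 am R cs bs _ L1]) (use xR[of x] y x L0 in simp_all)
      also have "\<dots> \<le> (?c + 1) * ((2 ^ (?l + ?k) * fact ?l * fact ?k) * (L ^ ?k * (C * q ^ (?n * ?k) * (B ^ ?k * N ?k))))"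
      proof (intro mult_mono fact_add_le)
        have "M (?n * ?k) \<le> B ^ ?k * N ?k" using bdd[of ?k] by (simp add: mult.commute)
        then show "a (?n * ?k) \<le> C * q ^ (?n * ?k) * (B ^ ?k * N ?k)"
          unfolding a_def using C(1) q by (intro mult_left_mono) auto
      qed (use L0 a0 in auto)
      also have "\<dots> = ?C * (2 ^ ?k * L ^ ?k * q ^ (?n * ?k) * B ^ ?k) * fact ?k * N ?k"
        by (simp only: power_add mult_ac)
      also have "2 ^ ?k * L ^ ?k * q ^ (?n * ?k) * B ^ ?k = ?r ^ ?k"
        by (simp only: power_mult_distrib power_mult)
      finally show ?thesis .
    qed
    moreover have "0 < ?C" "0 < ?r" using C(1) L0 q B by (simp_all add: add_nonneg_pos)
    ultimately show ?thesis by (intro exI[of _ ?C] conjI exI[of _ ?r] ballI)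
  qed
  ultimately have "CN_closed N ?A F"
    unfolding CN_closed_def by (intro conjI exI[of _ G] ballI allI impI G_cont G_int) simp_all
  with F show ?thesis by blast
qed

section \<open>A function with large derivatives at a point\<close>

text \<open>The bound holds for \<open>r < j\<close> and for \<open>r \<ge> j\<close> because \<open>m j / m r\<close> is a product of ratios
  on one side of \<open>\<mu> j\<close>.\<close>

lemma log_convex_ratio_bound:
  fixes m \<mu> :: "nat \<Rightarrow> real"
  assumes pos: "\<And>k. 0 < m k" and mu: "\<And>k. m (Suc k) = m k * \<mu> k" and inc: "mono \<mu>" and mpos: "\<And>k. 0 < \<mu> k"
  shows "m j * \<mu> j ^ r \<le> m r * \<mu> j ^ j"
proof (cases "j \<le> r")
  case True
  then obtain d where r: "r = j + d" by (metis le_iff_add)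
  have "m j * \<mu> j ^ d \<le> m (j + d)"
  proof (induction d)
    case (Suc d)
    have "m j * \<mu> j ^ Suc d = (m j * \<mu> j ^ d) * \<mu> j" by simp
    also have "\<dots> \<le> m (j + d) * \<mu> (j + d)"
      using Suc pos[of "j + d"] mpos[of j] monoD[OF inc, of j "j + d"] by (intro mult_mono) (auto simp: less_imp_le)
    finally show ?case by (simp add: mu)
  qed simp
  then have "(m j * \<mu> j ^ d) * \<mu> j ^ j \<le> m (j + d) * \<mu> j ^ j"
    using mpos[of j] by (intro mult_right_mono) auto
  then show ?thesis by (simp add: r power_add mult_ac)
next
  case False
  then obtain d where j: "j = r + d" by (metis le_iff_add nat_le_linear)
  have "m (r + e) \<le> m r * \<mu> j ^ e" if "e \<le> d" for e
    using that
  proof (induction e)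
    case (Suc e)
    have "m (r + Suc e) = m (r + e) * \<mu> (r + e)" by (simp add: mu)
    also have "\<dots> \<le> (m r * \<mu> j ^ e) * \<mu> j"
      using Suc pos[of "r + e"] mpos[of "r + e"] mpos[of j] pos[of r] monoD[OF inc, of "r + e" j] j
      by (intro mult_mono) (auto simp: less_imp_le)
    finally show ?case by (simp add: mult_ac)
  qed simp
  from this[of d] have "m j * \<mu> j ^ r \<le> (m r * \<mu> j ^ d) * \<mu> j ^ r"
    unfolding j using mpos[of "r + d"] by (intro mult_right_mono) auto
  then show ?thesis by (simp add: j power_add mult_ac)
qed

text \<open>\<open>h t = \<Sum>j. m\<^sub>j (2 \<mu>\<^sub>j)\<^sup>-\<^sup>j (cos + sin) (2 \<mu>\<^sub>j t)\<close> with \<open>m\<^sub>k = k! M\<^sub>k\<close>: at \<open>0\<close> all summands of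
  the \<open>r\<close>-th derivative have the same sign.\<close>

lemma extremal_function:
  fixes M :: "nat \<Rightarrow> real"
  assumes Mpos: "\<And>k. M k > 0" and Mlc: "log_convex M"
  obtains H :: "nat \<Rightarrow> real \<Rightarrow> real" where
    "\<forall>r t. (H r has_real_derivative H (Suc r) t) (at t)"
    "\<forall>r t. \<bar>H r t\<bar> \<le> 4 * 2 ^ r * fact r * M r"
    "\<forall>r. fact r * M r \<le> \<bar>H r 0\<bar>"
proof -
  define m where "m k = fact k * M k" for k
  define \<mu> where "\<mu> k = m (Suc k) / m k" for k
  have pos: "0 < m k" for k using Mpos by (simp add: m_def)
  have mu: "m (Suc k) = m k * \<mu> k" for k using pos[of k] by (simp add: \<mu>_def)
  have mpos: "0 < \<mu> k" for k using pos by (simp add: \<mu>_def)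
  have "\<mu> k \<le> \<mu> (Suc k)" for k
  proof -
    have "(M (Suc k))\<^sup>2 \<le> M k * M (Suc (Suc k))"
      using Mlc[unfolded log_convex_def, rule_format, of "Suc k"] by simp
    moreover have "real (Suc k) \<le> real (Suc (Suc k))" by simp
    ultimately have "real (Suc k) * (M (Suc k))\<^sup>2 \<le> real (Suc (Suc k)) * (M k * M (Suc (Suc k)))"
      by (intro mult_mono) auto
    then have "fact k * fact (Suc k) * (real (Suc k) * (M (Suc k))\<^sup>2) \<le> fact k * fact (Suc k) * (real (Suc (Suc k)) * (M k * M (Suc (Suc k))))"
      by (intro mult_left_mono) (auto simp del: fact_Suc)
    then have "m (Suc k) * m (Suc k) \<le> m (Suc (Suc k)) * m k"
      by (simp add: m_def power2_eq_square mult_ac)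
    then show ?thesis using pos[of k] pos[of "Suc k"] by (simp add: \<mu>_def divide_le_eq pos_le_divide_eq mult_ac)
  qed
  then have inc: "mono \<mu>" by (rule incseq_SucI)
  \<comment> \<open>Differentiating \<open>cos + sin\<close> shifts the phase by a quarter period;
    at 0 the values are \<open>1\<close> or \<open>-1\<close> and never 0, unlike for
    \<open>cos\<close> or \<open>sin\<close> alone.\<close>
  define cs where "cs r x = cos (x + real r * pi / 2) + sin (x + real r * pi / 2)" for r :: nat and x :: real
  have cs_deriv: "(cs r has_real_derivative cs (Suc r) x) (at x)" for r x
  proof -
    have e: "x + real (Suc r) * pi / 2 = (x + real r * pi / 2) + pi / 2" by (simp add: field_simps)
    have "cs (Suc r) x = - sin (x + real r * pi / 2) + cos (x + real r * pi / 2)"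
      unfolding cs_def e by (simp add: cos_add sin_add)
    then show ?thesis unfolding cs_def by (auto intro!: derivative_eq_intros)
  qed
  have cs_le: "\<bar>cs r x\<bar> \<le> 2" for r x
    using abs_cos_le_one[of "x + real r * pi / 2"] abs_sin_le_one[of "x + real r * pi / 2"] unfolding cs_def by linarith
  have cs_0: "\<bar>cs r 0\<bar> = 1" for r
  proof -
    have "(cs r 0)\<^sup>2 = 1 + sin (2 * (real r * pi / 2))"
      unfolding cs_def sin_double using sin_cos_squared_add[of "real r * pi / 2"]
      by (simp add: power2_sum)
    also have "sin (2 * (real r * pi / 2)) = 0" using sin_npi[of r] by simp
    finally show ?thesis by (simp add: abs_square_eq_1 power2_eq_1_iff abs_if)
  qed
  \<comment> \<open>The amplitude of the \<open>j\<close>-th summand in the \<open>r\<close>-th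
    derivative. \<open>log_convex_ratio_bound\<close> alone gives no decay in \<open>j\<close>;
    doubling the frequency yields \<open>(1 / 2) ^ j\<close> at the price of
    \<open>2 ^ r\<close>.\<close>
  define A where "A r j = m j * (2 * \<mu> j) ^ r / (2 * \<mu> j) ^ j" for r j
  have A0: "0 \<le> A r j" for r j unfolding A_def using pos[of j] mpos[of j] by simp
  have Ar: "A r r = m r" for r unfolding A_def using mpos[of r] by simp
  have A_le: "A r j \<le> m r * 2 ^ r * (1 / 2) ^ j" for r j
  proof -
    have "A r j = (m j * \<mu> j ^ r) / \<mu> j ^ j * (2 ^ r * (1 / 2) ^ j)"
      unfolding A_def by (simp add: power_mult_distrib power_divide mult_ac)
    also have "\<dots> \<le> m r * (2 ^ r * (1 / 2) ^ j)"
      using log_convex_ratio_bound[where m = m and \<mu> = \<mu>, OF pos mu inc mpos, of j r] mpos[of j]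
      by (intro mult_right_mono) (auto simp: divide_le_eq)
    finally show ?thesis by (simp add: mult.assoc)
  qed
  have sumA: "summable (\<lambda>j. m r * 2 ^ r * (1 / 2 :: real) ^ j)" for r
    by (intro summable_mult summable_geometric) simp
  have sumA2: "summable (\<lambda>j. 2 * (m r * 2 ^ r * (1 / 2 :: real) ^ j))" for r
    by (rule summable_mult[OF sumA])
  have sumA': "summable (A r)" for r
    by (rule summable_comparison_test'[OF sumA[of r], of 0]) (use A_le A0 in auto)
  define f where "f r j t = A r j * cs r (2 * \<mu> j * t)" for r j t
  have f_le: "norm (f r j t) \<le> 2 * (m r * 2 ^ r * (1 / 2) ^ j)" for r j t
  proof -
    have "norm (f r j t) \<le> A r j * 2"
      unfolding f_def using A0 cs_le by (simp add: abs_mult mult_left_mono)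
    then show ?thesis using A_le[of r j] by linarith
  qed
  have sumf: "summable (\<lambda>j. f r j t)" for r t
    by (rule summable_comparison_test'[OF sumA2[of r], of 0]) (rule f_le)
  have f_deriv: "(f r j has_real_derivative f (Suc r) j t) (at t)" for r j t
  proof -
    have "((\<lambda>t. cs r (2 * \<mu> j * t)) has_real_derivative cs (Suc r) (2 * \<mu> j * t) * (2 * \<mu> j)) (at t)"
      by (rule DERIV_chain2[OF cs_deriv]) (auto intro!: derivative_eq_intros)
    from DERIV_cmult[OF this, of "A r j"] show ?thesis
      unfolding f_def A_def by (simp add: mult_ac)
  qed
  define H where "H r t = (\<Sum>j. f r j t)" for r t
  have H1: "(H r has_real_derivative H (Suc r) t) (at t)" for r t
  proof -
    have U: "uniform_limit UNIV (\<lambda>n t. \<Sum>j<n. f (Suc r) j t) (H (Suc r)) sequentially"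
      unfolding H_def[abs_def] by (rule Weierstrass_m_test[OF f_le sumA2])
    have "\<exists>g. \<forall>x\<in>UNIV. (\<lambda>j. f r j x) sums g x \<and> (g has_real_derivative H (Suc r) x) (at x within UNIV)"
      by (rule has_field_derivative_series[where ?x0.0 = 0, OF convex_UNIV f_deriv U UNIV_I sumf])
    then obtain g where g: "\<forall>x\<in>UNIV. (\<lambda>j. f r j x) sums g x \<and> (g has_real_derivative H (Suc r) x) (at x within UNIV)" ..
    then have "g = H r" unfolding H_def by (auto simp: sums_iff fun_eq_iff)
    with g show ?thesis by simp
  qed
  have H2: "\<bar>H r t\<bar> \<le> 4 * 2 ^ r * fact r * M r" for r t
  proof -
    have "norm (H r t) \<le> (\<Sum>j. 2 * (m r * 2 ^ r * (1 / 2 :: real) ^ j))"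
      unfolding H_def by (rule norm_suminf_le[OF f_le sumA2])
    also have "\<dots> = 2 * (m r * 2 ^ r * (\<Sum>j. (1 / 2 :: real) ^ j))"
      by (simp add: suminf_mult summable_geometric)
    also have "(\<Sum>j. (1 / 2 :: real) ^ j) = 2"
      by (simp add: suminf_geometric)
    finally show ?thesis by (simp add: m_def mult_ac)
  qed
  have H3: "fact r * M r \<le> \<bar>H r 0\<bar>" for r
  proof -
    have "H r 0 = cs r 0 * (\<Sum>j. A r j)"
      unfolding H_def f_def using suminf_mult[OF sumA'[of r], of "cs r 0"] by (simp add: mult.commute)
    then have "\<bar>H r 0\<bar> = (\<Sum>j. A r j)"
      using suminf_nonneg[OF sumA'[of r] A0] cs_0[of r] by (simp add: abs_mult)
    moreover have "sum (A r) {r} \<le> (\<Sum>j. A r j)"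
      by (rule sum_le_suminf[OF sumA']) (use A0 in auto)
    ultimately show ?thesis by (simp add: Ar m_def)
  qed
  show ?thesis using H1 H2 H3 by (intro that[of H] allI)
qed

section \<open>Forward differences\<close>

fun fdiff :: "real \<Rightarrow> nat \<Rightarrow> (real \<Rightarrow> real) \<Rightarrow> real \<Rightarrow> real" where
  "fdiff h 0 f a = f a"
| "fdiff h (Suc k) f a = fdiff h k f (a + h) - fdiff h k f a"

lemma fdiff_add: "fdiff h k (\<lambda>t. f t + g t) a = fdiff h k f a + fdiff h k g a"
  by (induction k arbitrary: a) auto

lemma fdiff_cmult: "fdiff h k (\<lambda>t. c * f t) a = c * fdiff h k f a"
  by (induction k arbitrary: a) (auto simp: right_diff_distrib)

lemma fdiff_zero: "fdiff h k (\<lambda>t. 0) a = 0"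
  by (induction k arbitrary: a) auto

lemma fdiff_sum: "finite I \<Longrightarrow> fdiff h k (\<lambda>t. \<Sum>i\<in>I. f i t) a = (\<Sum>i\<in>I. fdiff h k (f i) a)"
  by (induction I rule: finite_induct) (auto simp: fdiff_add fdiff_zero)

lemma fdiff_shift: "fdiff h k (\<lambda>t. f (t + h)) a = fdiff h k f (a + h)"
  by (induction k arbitrary: a) auto

lemma fdiff_Suc': "fdiff h (Suc k) f a = fdiff h k (\<lambda>t. f (t + h) - f t) a"
  using fdiff_add[of h k "\<lambda>t. f (t + h)" "\<lambda>t. (- 1) * f t" a] fdiff_cmult[of h k "- 1" f a]
  by (simp add: fdiff_shift)

lemma fdiff_bound:
  "0 \<le> h \<Longrightarrow> (\<And>t. a \<le> t \<Longrightarrow> t \<le> a + real k * h \<Longrightarrow> \<bar>f t\<bar> \<le> B) \<Longrightarrow> \<bar>fdiff h k f a\<bar> \<le> 2 ^ k * B"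
proof (induction k arbitrary: a)
  case (Suc k)
  have "\<bar>fdiff h k f (a + h)\<bar> \<le> 2 ^ k * B" "\<bar>fdiff h k f a\<bar> \<le> 2 ^ k * B"
    using Suc.prems by (intro Suc.IH; simp add: algebra_simps)+
  then show ?case by (simp add: abs_le_iff)
qed simp

text \<open>One difference is moved inside by \<open>fdiff_Suc'\<close>; the induction hypothesis
  for \<open>\<phi> m (t + h) - \<phi> m t\<close> and the mean value theorem then supply the
  point.\<close>

lemma fdiff_mean_value:
  assumes "0 < h"
    and "\<And>m t. m < k \<Longrightarrow> a \<le> t \<Longrightarrow> t \<le> a + real k * h \<Longrightarrow> (\<phi> m has_real_derivative \<phi> (Suc m) t) (at t)"
  shows "\<exists>t. a \<le> t \<and> t \<le> a + real k * h \<and> fdiff h k (\<phi> 0) a = h ^ k * \<phi> k t"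
  using assms(2)
proof (induction k arbitrary: \<phi>)
  case (Suc k)
  let ?\<psi> = "\<lambda>m t. \<phi> m (t + h) - \<phi> m t"
  have "(?\<psi> m has_real_derivative ?\<psi> (Suc m) t) (at t)" if "m < k" "a \<le> t" "t \<le> a + real k * h" for m t
  proof -
    have "(\<phi> m has_real_derivative \<phi> (Suc m) (t + h)) (at (t + h))" "(\<phi> m has_real_derivative \<phi> (Suc m) t) (at t)"
      using that assms(1) by (intro Suc.prems; simp add: algebra_simps)+
    then show ?thesis by (intro DERIV_diff) (simp_all add: DERIV_shift)
  qed
  from Suc.IH[of ?\<psi>, OF this] obtain t where t: "a \<le> t" "t \<le> a + real k * h"
    "fdiff h k (?\<psi> 0) a = h ^ k * (\<phi> k (t + h) - \<phi> k t)" by blast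
  have "\<exists>z>t. z < t + h \<and> \<phi> k (t + h) - \<phi> k t = (t + h - t) * \<phi> (Suc k) z"
    by (rule MVT2) (use t assms(1) Suc.prems in \<open>auto simp: algebra_simps\<close>)
  then obtain z where z: "t < z" "z < t + h" "\<phi> k (t + h) - \<phi> k t = h * \<phi> (Suc k) z" by auto
  then have "fdiff h (Suc k) (\<phi> 0) a = h ^ Suc k * \<phi> (Suc k) z"
    unfolding fdiff_Suc' t(3) by simp
  moreover have "a \<le> z" "z \<le> a + real (Suc k) * h" using t z by (auto simp: algebra_simps)
  ultimately show ?case by blast
qed auto

lemma fdiff_poly:
  assumes "0 < h" "degree p \<le> k"
  shows "fdiff h k (poly p) a = h ^ k * (fact k * coeff p k)"
proof -
  let ?d = "\<lambda>m. (pderiv ^^ m) p"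
  have "(poly (?d m) has_real_derivative poly (?d (Suc m)) t) (at t)" for m t
    by (simp add: poly_DERIV)
  then obtain t where "fdiff h k (poly (?d 0)) a = h ^ k * poly (?d k) t"
    using fdiff_mean_value[OF assms(1), of k a "\<lambda>m. poly (?d m)"] by blast
  moreover have "?d k = [:fact k * coeff p k:]"
  proof (rule poly_eqI)
    fix i
    show "coeff (?d k) i = coeff [:fact k * coeff p k:] i"
      using assms(2) by (cases i) (auto simp: coeff_higher_pderiv pochhammer_fact coeff_eq_0)
  qed
  ultimately show ?thesis by simp
qed

section \<open>Power sums along the last elementary symmetric function\<close>

lemma poly_pderiv_root_poly:
  "poly (pderiv (root_poly u)) (u $ l) = (\<Prod>m\<in>UNIV - {l}. u $ l - u $ m)"
proof -
  have "poly (pderiv (root_poly u)) (u $ l) = (\<Sum>a\<in>UNIV. \<Prod>m\<in>UNIV - {a}. u $ l - u $ m)"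
    by (simp add: root_poly_def pderiv_prod poly_sum poly_prod pderiv_pCons)
  also have "\<dots> = (\<Prod>m\<in>UNIV - {l}. u $ l - u $ m) + (\<Sum>a\<in>UNIV - {l}. \<Prod>m\<in>UNIV - {a}. u $ l - u $ m)"
    by (rule sum.remove) auto
  also have "(\<Sum>a\<in>UNIV - {l}. \<Prod>m\<in>UNIV - {a}. u $ l - u $ m) = 0"
    by (intro sum.neutral ballI prod_zero) auto
  finally show ?thesis by simp
qed

lemma root_poly_monic:
  "degree (root_poly (w :: real ^ 'n)) = CARD('n)" "coeff (root_poly w) CARD('n) = 1"
proof -
  show d: "degree (root_poly w) = CARD('n)"
    unfolding root_poly_def by (subst degree_prod_eq_sum_degree) auto
  have "lead_coeff (root_poly w) = 1" unfolding root_poly_def lead_coeff_prod by simp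
  then show "coeff (root_poly w) CARD('n) = 1" by (simp add: d)
qed

definition shifted_roots :: "real ^ 'n \<Rightarrow> real \<Rightarrow> real ^ 'n \<Rightarrow> real \<Rightarrow> bool" where
  "shifted_roots w c u s \<longleftrightarrow> inj (($) u) \<and> root_poly u = root_poly w + [:s * c:]"

text \<open>The divided difference of \<open>t ^ d\<close> at the coordinates of \<open>u\<close>:
  the complete homogeneous symmetric polynomial of degree \<open>d - (n - 1)\<close>, and 0 for
  smaller \<open>d\<close>.\<close>

definition bary_power :: "real ^ 'n \<Rightarrow> nat \<Rightarrow> real" where
  "bary_power u d = (\<Sum>l\<in>UNIV. u $ l ^ d / (\<Prod>m\<in>UNIV - {l}. u $ l - u $ m))"

lemma bary_power_low:
  fixes u :: "real ^ 'n"
  assumes "inj (($) u)" "d < CARD('n)"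
  shows "bary_power u d = (if d = CARD('n) - 1 then 1 else 0)"
proof -
  have "bary_power u d = (\<Sum>a\<in>range (($) u). poly (monom 1 d) a / (\<Prod>b\<in>range (($) u) - {a}. a - b))"
    unfolding bary_power_def sum_inj_denominators[OF assms(1)] by (simp add: poly_monom)
  also have "\<dots> = coeff (monom 1 d) (card (range (($) u)) - 1)"
    by (rule lagrange_sum) (use assms in \<open>auto simp: card_image degree_monom_eq\<close>)
  finally show ?thesis using assms by (simp add: card_image)
qed

text \<open>The root equation gives a linear recurrence in \<open>d\<close>, where \<open>s\<close>
  enters only through the term \<open>n\<close> steps back, with factor \<open>- c\<close>. So each
  power of \<open>s\<close> uses up degree \<open>n\<close>, starting from degree
  \<open>n - 1\<close>, and when \<open>d\<close> is exhausted exactly only that term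
  contributes.\<close>

lemma bary_power_poly:
  fixes w :: "real ^ 'n"
  shows "\<exists>A. (\<forall>u s. shifted_roots w c u s \<longrightarrow> bary_power u d = poly A s) \<and>
    (\<forall>k. coeff A k \<noteq> 0 \<longrightarrow> CARD('n) * k + (CARD('n) - 1) \<le> d) \<and>
    (\<forall>k. d = CARD('n) * k + (CARD('n) - 1) \<longrightarrow> coeff A k = (- c) ^ k)"
proof (induction d rule: less_induct)
  case (less d)
  let ?n = "CARD('n)"
  let ?P = "\<lambda>d A. (\<forall>u s. shifted_roots w c u s \<longrightarrow> bary_power u d = poly A s) \<and>
    (\<forall>k. coeff A k \<noteq> 0 \<longrightarrow> ?n * k + (?n - 1) \<le> d) \<and>
    (\<forall>k. d = ?n * k + (?n - 1) \<longrightarrow> coeff A k = (- c) ^ k)"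
  have n: "0 < ?n" by simp
  show ?case
  proof (cases "d < ?n")
    case True
    let ?A = "[:if d = ?n - 1 then 1 else 0:] :: real poly"
    have c0: "coeff ?A k = (if k = 0 \<and> d = ?n - 1 then 1 else 0)" for k by (cases k) auto
    have k0: "k = 0" if "d = ?n * k + (?n - 1)" for k
    proof (rule ccontr)
      assume "k \<noteq> 0"
      then have "?n \<le> ?n * k" by simp
      then show False using that True n by linarith
    qed
    have 3: "coeff ?A k = (- c) ^ k" if "d = ?n * k + (?n - 1)" for k
      using k0[OF that] that unfolding c0 by simp
    have 2: "?n * k + (?n - 1) \<le> d" if "coeff ?A k \<noteq> 0" for k
      using that unfolding c0 by (simp split: if_splits)
    have 1: "bary_power u d = poly ?A s" if "shifted_roots w c u s" for u s
      using that bary_power_low[OF _ True, of u] by (simp add: shifted_roots_def)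
    show ?thesis by (intro exI[of _ ?A] conjI allI impI 1 2 3)
  next
    case False
    have "\<forall>e. \<exists>A. e < d \<longrightarrow> ?P e A" using less.IH by blast
    then obtain A where "\<forall>e. e < d \<longrightarrow> ?P e (A e)" by (rule choice[THEN exE])
    then have AA: "?P e (A e)" if "e < d" for e using that by blast
    have A: "bary_power u e = poly (A e) s" if "e < d" "shifted_roots w c u s" for e u s
      using conjunct1[OF AA[OF that(1)]] that(2) by blast
    have A1: "?n * k + (?n - 1) \<le> e" if "e < d" "coeff (A e) k \<noteq> 0" for e k
      using conjunct1[OF conjunct2[OF AA[OF that(1)]]] that(2) by blast
    have A2: "coeff (A e) k = (- c) ^ k" if "e < d" "e = ?n * k + (?n - 1)" for e k
      using conjunct2[OF conjunct2[OF AA[OF that(1)]]] that(2) by blast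
    define q where "q m = coeff (root_poly w) m" for m
    define B where "B = - (\<Sum>m<?n. smult (q m) (A (d - ?n + m))) - pCons 0 (smult c (A (d - ?n)))"
    have lt: "d - ?n + m < d" if "m < ?n" for m using that False by linarith
    have lt0: "d - ?n < d" using False n by linarith
    have coB: "coeff B k = - (\<Sum>m<?n. q m * coeff (A (d - ?n + m)) k) - (case k of 0 \<Rightarrow> 0 | Suc k' \<Rightarrow> c * coeff (A (d - ?n)) k')" for k
      by (cases k) (simp_all add: B_def coeff_sum)
    have "bary_power u d = poly B s" if v: "shifted_roots w c u s" for u s
    proof -
      have root: "u $ l ^ ?n = - (\<Sum>m<?n. q m * u $ l ^ m) - s * c" for l
      proof -
        have "0 = poly (root_poly u) (u $ l)" unfolding poly_root_poly by (subst prod_zero) auto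
        also have "\<dots> = poly (root_poly w) (u $ l) + s * c" using v by (simp add: shifted_roots_def)
        also have "poly (root_poly w) (u $ l) = (\<Sum>m\<le>?n. q m * u $ l ^ m)"
          unfolding poly_altdef root_poly_monic q_def ..
        also have "\<dots> = (\<Sum>m<?n. q m * u $ l ^ m) + u $ l ^ ?n"
          by (simp add: q_def root_poly_monic flip: lessThan_Suc_atMost)
        finally show ?thesis by linarith
      qed
      let ?D = "\<lambda>l. \<Prod>m\<in>UNIV - {l}. u $ l - u $ m"
      have "bary_power u d = (\<Sum>l\<in>UNIV. - (\<Sum>m<?n. q m * (u $ l ^ (d - ?n + m) / ?D l)) - s * c * (u $ l ^ (d - ?n) / ?D l))"
        unfolding bary_power_def
      proof (rule sum.cong[OF refl])
        fix l
        have "u $ l ^ d = u $ l ^ (d - ?n) * u $ l ^ ?n" using False by (simp flip: power_add)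
        also have "\<dots> = - (\<Sum>m<?n. q m * u $ l ^ (d - ?n + m)) - s * c * u $ l ^ (d - ?n)"
          unfolding root by (simp add: right_diff_distrib sum_distrib_left power_add mult_ac)
        finally show "u $ l ^ d / ?D l = - (\<Sum>m<?n. q m * (u $ l ^ (d - ?n + m) / ?D l)) - s * c * (u $ l ^ (d - ?n) / ?D l)"
          by (simp add: diff_divide_distrib sum_divide_distrib)
      qed
      also have "\<dots> = - (\<Sum>m<?n. q m * bary_power u (d - ?n + m)) - s * c * bary_power u (d - ?n)"
        unfolding sum_subtractf sum_negf bary_power_def sum_distrib_left by (subst sum.swap) simp
      also have "\<dots> = poly B s"
        using A[OF lt v] A[OF lt0 v] by (simp add: B_def poly_sum)
      finally show ?thesis .
    qed
    moreover have "?n * k + (?n - 1) \<le> d" if "coeff B k \<noteq> 0" for k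
    proof (rule ccontr)
      assume *: "\<not> ?n * k + (?n - 1) \<le> d"
      have "coeff (A (d - ?n + m)) k = 0" if "m < ?n" for m
        using A1[OF lt[OF that], of k] lt[OF that] * by linarith
      moreover have "(case k of 0 \<Rightarrow> 0 | Suc k' \<Rightarrow> c * coeff (A (d - ?n)) k') = 0"
      proof (cases k)
        case (Suc k')
        have "\<not> ?n * k' + (?n - 1) \<le> d - ?n" using * False Suc by simp
        then show ?thesis using A1[OF lt0, of k'] Suc by auto
      qed simp
      ultimately show False using that coB[of k] by simp
    qed
    moreover have "coeff B k = (- c) ^ k" if dk: "d = ?n * k + (?n - 1)" for k
    proof -
      have "coeff (A (d - ?n + m)) k = 0" if "m < ?n" for m
        using A1[OF lt[OF that], of k] lt[OF that] dk by linarith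
      moreover obtain k' where k: "k = Suc k'" using dk False n by (cases k) auto
      moreover have "coeff (A (d - ?n)) k' = (- c) ^ k'"
        by (rule A2[OF lt0]) (simp add: dk k)
      ultimately show ?thesis using coB[of k] by simp
    qed
    ultimately show ?thesis by blast
  qed
qed

text \<open>Write \<open>u $ l ^ r\<close> as itself times \<open>P' / P'\<close>, with
  \<open>P'\<close> the derivative of the root polynomial. Shifting the constant term leaves
  \<open>P'\<close> unchanged, so the power sum is a combination of \<open>bary_power\<close> values
  with coefficients independent of \<open>s\<close>. The factor \<open>n\<close> is the leading
  coefficient of \<open>P'\<close>.\<close>

lemma power_sum_poly:
  fixes w :: "real ^ 'n" and c :: real
  obtains B :: "nat \<Rightarrow> real poly" where
    "\<forall>u s r. shifted_roots w c u s \<longrightarrow> (\<Sum>l\<in>UNIV. u $ l ^ r) = poly (B r) s"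
    "\<forall>r k. coeff (B r) k \<noteq> 0 \<longrightarrow> CARD('n) * k \<le> r"
    "\<forall>k. coeff (B (CARD('n) * k)) k = CARD('n) * (- c) ^ k"
proof -
  let ?n = "CARD('n)"
  have n: "0 < ?n" by simp
  have "\<forall>d. \<exists>A. (\<forall>u s. shifted_roots w c u s \<longrightarrow> bary_power u d = poly A s) \<and>
    (\<forall>k. coeff A k \<noteq> 0 \<longrightarrow> ?n * k + (?n - 1) \<le> d) \<and>
    (\<forall>k. d = ?n * k + (?n - 1) \<longrightarrow> coeff A k = (- c) ^ k)"
    by (rule allI, rule bary_power_poly)
  then obtain A where AA: "\<forall>d. (\<forall>u s. shifted_roots w c u s \<longrightarrow> bary_power u d = poly (A d) s) \<and>
    (\<forall>k. coeff (A d) k \<noteq> 0 \<longrightarrow> ?n * k + (?n - 1) \<le> d) \<and>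
    (\<forall>k. d = ?n * k + (?n - 1) \<longrightarrow> coeff (A d) k = (- c) ^ k)"
    by (rule choice[THEN exE])
  have A: "bary_power u d = poly (A d) s" if "shifted_roots w c u s" for d u s
    using conjunct1[OF spec[OF AA, of d]] that by blast
  have A1: "?n * k + (?n - 1) \<le> d" if "coeff (A d) k \<noteq> 0" for d k
    using conjunct1[OF conjunct2[OF spec[OF AA, of d]]] that by blast
  have A2: "coeff (A d) k = (- c) ^ k" if "d = ?n * k + (?n - 1)" for d k
    using conjunct2[OF conjunct2[OF spec[OF AA, of d]]] that by blast
  define p where "p m = coeff (pderiv (root_poly w)) m" for m
  define B where "B r = (\<Sum>m<?n. smult (p m) (A (r + m)))" for r
  have dp: "degree (pderiv (root_poly w)) = ?n - 1"
    by (simp add: degree_pderiv root_poly_monic)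
  show ?thesis
  proof (rule that[of B]; intro allI impI)
    fix u :: "real ^ 'n" and s r assume v: "shifted_roots w c u s"
    let ?D = "\<lambda>l. \<Prod>m\<in>UNIV - {l}. u $ l - u $ m"
    have D: "?D l = (\<Sum>m<?n. p m * u $ l ^ m)" for l
    proof -
      have "?D l = poly (pderiv (root_poly u)) (u $ l)" by (simp only: poly_pderiv_root_poly)
      also have "pderiv (root_poly u) = pderiv (root_poly w)"
        using v by (simp add: shifted_roots_def pderiv_add pderiv_pCons)
      also have "poly (pderiv (root_poly w)) (u $ l) = (\<Sum>m\<le>?n - 1. p m * u $ l ^ m)"
        unfolding poly_altdef dp p_def ..
      also have "{..?n - 1} = {..<?n}" using n by (metis Suc_pred' lessThan_Suc_atMost)
      finally show ?thesis .
    qed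
    have D0: "?D l \<noteq> 0" for l
      using v by (auto simp: shifted_roots_def inj_eq)
    have "(\<Sum>l\<in>UNIV. u $ l ^ r) = (\<Sum>l\<in>UNIV. \<Sum>m<?n. p m * (u $ l ^ (r + m) / ?D l))"
    proof (rule sum.cong[OF refl])
      fix l
      have "u $ l ^ r = u $ l ^ r * (\<Sum>m<?n. p m * u $ l ^ m) / ?D l" using D[of l] D0[of l] by simp
      also have "\<dots> = (\<Sum>m<?n. p m * (u $ l ^ (r + m) / ?D l))"
        by (simp add: sum_distrib_left sum_divide_distrib power_add mult_ac)
      finally show "u $ l ^ r = (\<Sum>m<?n. p m * (u $ l ^ (r + m) / ?D l))" .
    qed
    also have "\<dots> = (\<Sum>m<?n. p m * bary_power u (r + m))"
      unfolding bary_power_def sum_distrib_left by (rule sum.swap)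
    also have "\<dots> = poly (B r) s"
      using A[OF v] by (simp add: B_def poly_sum)
    finally show "(\<Sum>l\<in>UNIV. u $ l ^ r) = poly (B r) s" .
  next
    fix r k assume nz: "coeff (B r) k \<noteq> 0"
    have "\<exists>m<?n. coeff (A (r + m)) k \<noteq> 0"
    proof (rule ccontr)
      assume "\<not> ?thesis"
      then have "coeff (B r) k = 0" by (simp add: B_def coeff_sum)
      with nz show False by simp
    qed
    then obtain m where "m < ?n" "coeff (A (r + m)) k \<noteq> 0" by blast
    with A1[of "r + m" k] show "?n * k \<le> r" by linarith
  next
    fix k
    have z: "p m * coeff (A (?n * k + m)) k = 0" if "m \<in> {..<?n} - {?n - 1}" for m
    proof -
      have "\<not> ?n * k + (?n - 1) \<le> ?n * k + m" using that by auto
      then have "coeff (A (?n * k + m)) k = 0" using A1[of "?n * k + m" k] by blast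
      then show ?thesis by simp
    qed
    have "coeff (B (?n * k)) k = (\<Sum>m<?n. p m * coeff (A (?n * k + m)) k)"
      by (simp add: B_def coeff_sum)
    also have "\<dots> = p (?n - 1) * coeff (A (?n * k + (?n - 1))) k + (\<Sum>m\<in>{..<?n} - {?n - 1}. p m * coeff (A (?n * k + m)) k)"
      by (rule sum.remove) (use n in auto)
    also have "(\<Sum>m\<in>{..<?n} - {?n - 1}. p m * coeff (A (?n * k + m)) k) = 0"
      by (rule sum.neutral) (use z in blast)
    also have "coeff (A (?n * k + (?n - 1))) k = (- c) ^ k" by (rule A2) simp
    also have "p (?n - 1) = ?n"
      using root_poly_monic(2)[of w] n by (simp add: p_def coeff_pderiv)
    finally show "coeff (B (?n * k)) k = ?n * (- c) ^ k" by simp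
  qed
qed

lemma sigma_scale:
  fixes u :: "real ^ 'n::{finite,linorder}"
  shows "sigma (e *\<^sub>R u) $ i = e ^ crank i * sigma u $ i"
proof -
  have "(\<Prod>l\<in>S. (e *\<^sub>R u) $ l) = e ^ crank i * (\<Prod>l\<in>S. u $ l)" if "card S = crank i" for S
    using that by (simp add: prod.distrib)
  then show ?thesis by (simp add: sigma_nth esym_def sum_distrib_left)
qed

lemma regular_interior:
  fixes x :: "('n::{finite,linorder}, 'p::finite) blocks"
  assumes "regular x"
  shows "theta x \<in> interior (range theta)"
proof -
  have "\<exists>V. open V \<and> sigma (x $ j) \<in> V \<and> V \<subseteq> range sigma" for j
  proof -
    have "inj (($) (x $ j))" using assms by (simp add: regular_def)
    then obtain U g where "open U" "x $ j \<in> U" "open (sigma ` U)"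
      "homeomorphism U (sigma ` U) sigma g" "\<forall>w\<in>U. inj (($) w)" "\<forall>w\<in>U. \<forall>i. \<bar>w $ i - x $ j $ i\<bar> < 1"
      by (rule sigma_local_homeomorphism[OF _ zero_less_one])
    then show ?thesis by (intro exI[of _ "sigma ` U"]) auto
  qed
  then have "\<forall>j. \<exists>V. open V \<and> sigma (x $ j) \<in> V \<and> V \<subseteq> range sigma" by blast
  then obtain V where V: "\<forall>j. open (V j) \<and> sigma (x $ j) \<in> V j \<and> V j \<subseteq> range sigma"
    by (rule choice[THEN exE])
  show ?thesis
  proof (rule interiorI)
    show "open {y. \<forall>j. y $ j \<in> V j}" using V by (intro open_vector_box) blast
    show "theta x \<in> {y. \<forall>j. y $ j \<in> V j}" using V by (simp add: theta_nth)
    show "{y. \<forall>j. y $ j \<in> V j} \<subseteq> range theta"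
    proof
      fix y assume "y \<in> {y. \<forall>j. y $ j \<in> V j}"
      then have "\<forall>j. \<exists>z. y $ j = sigma z" using V by blast
      then obtain z where "\<forall>j. y $ j = sigma (z j)" by (rule choice[THEN exE])
      then have "y = theta (\<chi> j. z j)" by (simp add: vec_eq_iff theta_nth)
      then show "y \<in> range theta" by blast
    qed
  qed
qed

text \<open>Mixed derivatives vanish: a derivative list reaches the \<open>i\<close>-th summand only
  if all its directions are \<open>coord j0 i\<close>.\<close>

lemma symmetric_sum_CM:
  fixes H :: "nat \<Rightarrow> real \<Rightarrow> real" and j0 :: "'p::finite"
  assumes d: "\<And>r t. (H r has_real_derivative H (Suc r) t) (at t)"
    and b: "\<And>r t. \<bar>H r t\<bar> \<le> 4 * 2 ^ r * fact r * M r" and Mpos: "\<And>k. M k > 0"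
  defines "f \<equiv> \<lambda>x :: ('n::{finite,linorder}, 'p) blocks. \<Sum>i\<in>UNIV. H 0 (x $ j0 $ i)"
  shows "prod_sym_invariant f" "CM_on M UNIV f"
proof -
  show "prod_sym_invariant f"
    unfolding prod_sym_invariant_def
  proof (intro allI impI)
    fix \<pi> :: "'p \<Rightarrow> 'n \<Rightarrow> 'n" and x :: "('n, 'p) blocks" assume "\<forall>j. \<pi> j permutes UNIV"
    then have "\<pi> j0 permutes UNIV" by blast
    from sum.permute[OF this, of "\<lambda>i. H 0 (x $ j0 $ i)"]
    show "f (\<chi> j i. x $ j $ \<pi> j i) = f x" by (simp add: f_def o_def)
  qed
  let ?D = "\<lambda>(bs :: ('n, 'p) blocks list) x. \<Sum>i\<in>UNIV. if set bs \<subseteq> {coord j0 i} then H (length bs) (x $ j0 $ i) else 0"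
  have cH: "continuous_on UNIV (H r)" for r
    using d by (intro DERIV_continuous_on) (auto intro: DERIV_subset)
  have "smooth_fam (UNIV :: real set) (\<lambda>_. f)" and D: "\<And>bs. bs \<in> lists Basis \<Longrightarrow> pds bs f = ?D bs"
  proof -
    have 1: "?D [] x = f x" for x by (simp add: f_def)
    have 2: "((\<lambda>t. ?D bs (z + t *\<^sub>R b)) has_real_derivative ?D (b # bs) z) (at 0)"
      if "b \<in> Basis" for bs b z
    proof (rule DERIV_sum)
      fix i
      have bi: "b $ j0 $ i = (if b = coord j0 i then 1 else 0)"
        using that inner_Basis[OF that coord_Basis[of j0 i]] by simp
      have e: "(z + t *\<^sub>R b) $ j0 $ i = z $ j0 $ i + t * b $ j0 $ i" for t by simp
      have "((\<lambda>t. H (length bs) (z $ j0 $ i + t * b $ j0 $ i)) has_real_derivative H (Suc (length bs)) (z $ j0 $ i + 0 * b $ j0 $ i) * b $ j0 $ i) (at 0)"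
        by (rule DERIV_chain2[OF d]) (auto intro!: derivative_eq_intros)
      then show "((\<lambda>t. if set bs \<subseteq> {coord j0 i} then H (length bs) ((z + t *\<^sub>R b) $ j0 $ i) else 0) has_real_derivative
        (if set (b # bs) \<subseteq> {coord j0 i} then H (length (b # bs)) (z $ j0 $ i) else 0)) (at 0)"
        unfolding e bi by (cases "set bs \<subseteq> {coord j0 i}"; cases "b = coord j0 i") auto
    qed
    have 3: "continuous_on (UNIV \<times> UNIV) (\<lambda>(p :: real, z). ?D bs z)" for bs
      unfolding case_prod_unfold
    proof (intro continuous_on_sum)
      fix i
      have "continuous_on (UNIV \<times> UNIV) (\<lambda>x :: real \<times> ('n, 'p) blocks. H (length bs) (snd x $ j0 $ i))"
        by (rule continuous_on_compose2[OF cH]) (intro continuous_intros, auto)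
      then show "continuous_on (UNIV \<times> UNIV) (\<lambda>x :: real \<times> ('n, 'p) blocks. if set bs \<subseteq> {coord j0 i} then H (length bs) (snd x $ j0 $ i) else 0)"
        by (cases "set bs \<subseteq> {coord j0 i}") auto
    qed
    note R = smooth_famI[where D = "\<lambda>_. ?D" and S = "UNIV :: real set" and u = "\<lambda>_. f"]
    show "smooth_fam (UNIV :: real set) (\<lambda>_. f)" by (rule R(1)[OF 1 2 3])
    show "pds bs f = ?D bs" if "bs \<in> lists Basis" for bs by (rule R(2)[OF 1 2 3 UNIV_I that])
  qed
  then have "smooth f" using smooth_iff_fam by blast
  moreover have "\<bar>pds bs f x\<bar> \<le> (4 * CARD('n)) * 2 ^ length bs * fact (length bs) * M (length bs)" if "bs \<in> lists Basis" for bs x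
  proof -
    have "\<bar>?D bs x\<bar> \<le> (\<Sum>i\<in>(UNIV :: 'n set). 4 * 2 ^ length bs * fact (length bs) * M (length bs))"
      by (rule order_trans[OF sum_abs], rule sum_mono) (use b[of "length bs"] Mpos[of "length bs"] in auto)
    then show ?thesis unfolding D[OF that] by (simp add: mult_ac)
  qed
  ultimately show "CM_on M UNIV f"
    unfolding CM_on_def by (intro conjI allI impI exI[of _ "4 * real CARD('n)"] exI[of _ 2]) auto
qed

section \<open>Necessity of the growth condition\<close>

lemma root_poly_shift:
  fixes u w :: "real ^ 'n::{finite,linorder}"
  assumes "inj (($) u)" "sigma u = sigma w + s *\<^sub>R axis i 1" "crank i = CARD('n)"
  shows "shifted_roots w ((- 1) ^ CARD('n)) u s"
proof -
  have "poly (root_poly u) t = poly (root_poly w + [:s * (- 1) ^ CARD('n):]) t" for t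
    using sigma_eq_prod[OF assms(2), of t] assms(3) by (simp add: poly_root_poly)
  then show ?thesis unfolding shifted_roots_def using assms(1) by (intro conjI poly_ext)
qed

lemma line_derivative:
  assumes "smooth_on A F" "y + (e * s) *\<^sub>R b \<in> A" "bs \<in> lists Basis" "b \<in> Basis"
  shows "((\<lambda>s. pds bs F (y + (e * s) *\<^sub>R b)) has_real_derivative e * pds (b # bs) F (y + (e * s) *\<^sub>R b)) (at s)"
proof -
  let ?y = "y + (e * s) *\<^sub>R b"
  have "(\<lambda>t. pds bs F (?y + t *\<^sub>R b)) differentiable (at 0)"
    using assms by (auto simp: smooth_on_def)
  then have D: "((\<lambda>t. pds bs F (?y + t *\<^sub>R b)) has_real_derivative pds (b # bs) F ?y) (at (e * (s - s)))"
    by (auto simp: pd_def DERIV_deriv_iff_real_differentiable)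
  have "((\<lambda>t. e * (t - s)) has_real_derivative e) (at s)"
    by (auto intro!: derivative_eq_intros)
  from DERIV_chain2[OF D this] show ?thesis by (simp add: algebra_simps)
qed

lemma le_if_le_add_eps:
  fixes a b E :: real
  assumes "0 \<le> E" "\<And>e. 0 < e \<Longrightarrow> e \<le> 1 \<Longrightarrow> a \<le> b + E * e"
  shows "a \<le> b"
proof (rule ccontr)
  assume "\<not> a \<le> b"
  define e where "e = min 1 ((a - b) / (2 * (E + 1)))"
  have e: "0 < e" "e \<le> 1" using \<open>\<not> a \<le> b\<close> assms(1) by (auto simp: e_def)
  have "(E + 1) * e \<le> (E + 1) * ((a - b) / (2 * (E + 1)))"
    using assms(1) by (intro mult_left_mono) (auto simp: e_def)
  also have "\<dots> = (a - b) / 2" using assms(1) by (simp add: field_simps)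
  finally have "(E + 1) * e \<le> (a - b) / 2" .
  moreover have "a \<le> b + E * e" using assms(2)[OF e] .
  ultimately show False using e(1) \<open>\<not> a \<le> b\<close> by (simp add: algebra_simps)
qed

text \<open>Along the last elementary symmetric function the \<open>k\<close>-th difference of \<open>F\<close> at scale \<open>\<epsilon>\<^sup>n\<close> sees
  only the Taylor coefficient of order \<open>kn\<close> of \<open>f\<close>: the power sum of degree \<open>r\<close> is a polynomial of
  degree at most \<open>r / n\<close> in \<open>\<sigma>\<^sub>n\<close>.\<close>

theorem extension_necessary:
  fixes M N :: "nat \<Rightarrow> real"
  assumes Mpos: "\<And>k. M k > 0" and Npos: "\<And>k. N k > 0" and Mlc: "log_convex M"
    and ext: "\<And>f :: ('n::{finite,linorder}, 'p::finite) blocks \<Rightarrow> real. prod_sym_invariant f \<Longrightarrow> CM_on M UNIV f \<Longrightarrow>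
      \<exists>F. CN_closed N (range theta) F \<and> (\<forall>x. f x = F (theta x))"
  shows "\<exists>C>0. \<exists>\<rho>>0. \<forall>k>0. M (CARD('n) * k) \<le> C * \<rho> ^ k * N k"
proof -
  let ?n = "CARD('n)"
  obtain H :: "nat \<Rightarrow> real \<Rightarrow> real" where
    H: "\<forall>r t. (H r has_real_derivative H (Suc r) t) (at t)"
      "\<forall>r t. \<bar>H r t\<bar> \<le> 4 * 2 ^ r * fact r * M r" "\<forall>r. fact r * M r \<le> \<bar>H r 0\<bar>"
    by (rule extremal_function[OF Mpos Mlc])
  note H = H[rule_format]
  define j0 :: 'p where "j0 = undefined"
  define f where "f x = (\<Sum>i\<in>UNIV. H 0 (x $ j0 $ i))" for x :: "('n, 'p) blocks"
  have "prod_sym_invariant f" "CM_on M UNIV f"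
    using symmetric_sum_CM[where H = H and M = M and ?j0.0 = j0, OF H(1,2) Mpos] by (simp_all add: f_def[abs_def])
  from ext[OF this] obtain F where F: "CN_closed N (range theta) F" "\<And>x. f x = F (theta x)" by blast
  let ?A = "range (theta :: ('n, 'p) blocks \<Rightarrow> _)"
  have smF: "smooth_on (interior ?A) F" using F(1) by (simp add: CN_closed_def)
  from F(1) obtain G where G: "\<forall>bs\<in>lists Basis. continuous_on ?A (G bs) \<and> (\<forall>y\<in>interior ?A. G bs y = pds bs F y)"
    "\<forall>K. compact K \<and> K \<subseteq> ?A \<longrightarrow> (\<exists>C>0. \<exists>\<rho>>0. \<forall>bs\<in>lists Basis. \<forall>y\<in>K.
      \<bar>G bs y\<bar> \<le> C * \<rho> ^ length bs * fact (length bs) * N (length bs))"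
    unfolding CN_closed_def by blast
  obtain i0 :: 'n where i0: "crank i0 = ?n"
  proof -
    have "?n \<in> crank ` (UNIV :: 'n set)" using crank_bij[where ?'n = 'n] by (simp add: bij_betw_def Suc_leI)
    then show ?thesis using that by auto
  qed
  define b :: "('n, 'p) blocks" where "b = coord j0 i0"
  have b: "b \<in> Basis" by (simp add: b_def)
  define w :: "real ^ 'n::{finite,linorder}" where "w = (\<chi> i. real (cpos i))"
  have winj: "inj (($) w)" by (rule injI) (simp add: w_def cpos_inj)
  obtain U g where U: "open U" "w \<in> U" "open (sigma ` U)"
    "homeomorphism U (sigma ` U) sigma g" "\<forall>u\<in>U. inj (($) u)" "\<forall>u\<in>U. \<forall>i. \<bar>u $ i - w $ i\<bar> < 1"
    by (rule sigma_local_homeomorphism[OF winj zero_less_one])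
  let ?p = "\<lambda>s::real. sigma w + s *\<^sub>R axis i0 1"
  have "open (?p -` (sigma ` U))" by (rule open_vimage[OF U(3)]) (intro continuous_intros)
  moreover have "0 \<in> ?p -` (sigma ` U)" using U(2) by simp
  ultimately obtain d where d: "0 < d" "cball 0 d \<subseteq> ?p -` (sigma ` U)"
    unfolding open_contains_cball by blast
  define u where "u s = g (?p s)" for s
  have u: "u s \<in> U" "sigma (u s) = ?p s" if "0 \<le> s" "s \<le> d" for s
  proof -
    have "?p s \<in> sigma ` U" using d(2) that by (auto simp: subset_iff)
    then show "u s \<in> U" "sigma (u s) = ?p s" using U(4) unfolding u_def homeomorphism_def by auto
  qed
  have uinj: "inj (($) (u s))" if "0 \<le> s" "s \<le> d" for s using U(5) u(1)[OF that] by blast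
  define R where "R = 1 + (\<Sum>i\<in>UNIV. \<bar>w $ i\<bar>)"
  have wR: "\<bar>w $ i\<bar> + 1 \<le> R" for i
    using member_le_sum[of i UNIV "\<lambda>i. \<bar>w $ i\<bar>"] by (simp add: R_def)
  have R: "1 \<le> R" by (simp add: R_def sum_nonneg)
  have uR: "\<bar>u s $ i\<bar> \<le> R" if "0 \<le> s" "s \<le> d" for s i
  proof -
    have "\<bar>u s $ i - w $ i\<bar> < 1" using U(6) u(1)[OF that] by blast
    then show ?thesis using wR[of i] by linarith
  qed
  \<comment> \<open>Scaling the roots by \<open>e\<close> multiplies the shift of the last
    elementary symmetric function by \<open>e ^ ?n\<close>. The other blocks are parked at a regular
    position.\<close>
  define X :: "real \<Rightarrow> real \<Rightarrow> ('n, 'p) blocks" where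
    "X e s = (\<chi> j. if j = j0 then e *\<^sub>R u s else e *\<^sub>R w)" for e s
  define Y :: "real \<Rightarrow> ('n, 'p) blocks" where "Y e = theta (\<chi> j. e *\<^sub>R w)" for e
  have thX: "theta (X e s) = Y e + (e ^ ?n * s) *\<^sub>R b" if "0 \<le> s" "s \<le> d" for e s
  proof (rule vec_eq_iff[THEN iffD2], rule allI)
    fix j
    show "theta (X e s) $ j = (Y e + (e ^ ?n * s) *\<^sub>R b) $ j"
    proof (cases "j = j0")
      case True
      have "sigma (e *\<^sub>R u s) $ i = (sigma (e *\<^sub>R w) + (e ^ ?n * s) *\<^sub>R axis i0 1) $ i" for i
        using u(2)[OF that] i0 by (cases "i = i0") (simp_all add: sigma_scale axis_def algebra_simps)
      then show ?thesis using True by (simp add: theta_nth X_def Y_def b_def coord_def vec_eq_iff)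
    next
      case False
      then show ?thesis by (simp add: theta_nth X_def Y_def b_def coord_def axis_def)
    qed
  qed
  have regX: "regular (X e s)" if "0 < e" "0 \<le> s" "s \<le> d" for e s
    unfolding regular_def
  proof
    fix j show "inj (($) (X e s $ j))"
      using that winj uinj[OF that(2,3)] by (cases "j = j0") (auto simp: X_def inj_def)
  qed
  \<comment> \<open>One compact set serves all \<open>0 < e \<le> 1\<close>, so \<open>C\<close> and
    \<open>\<rho>\<close> depend neither on \<open>e\<close> nor on \<open>k\<close>.\<close>
  define K where "K = theta ` (cbox (\<chi> j i. - R) (\<chi> j i. R) :: ('n, 'p) blocks set)"
  have K: "compact K" "K \<subseteq> ?A"
    unfolding K_def by (auto intro!: compact_continuous_image continuous_on_theta)
  from G(2)[rule_format, OF conjI, OF K]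
  obtain C \<rho> where C: "0 < C" "0 < \<rho>" "\<forall>bs\<in>lists Basis. \<forall>y\<in>K.
      \<bar>G bs y\<bar> \<le> C * \<rho> ^ length bs * fact (length bs) * N (length bs)"
    by (elim exE conjE)
  note C = C[rule_format]
  have inK: "theta (X e s) \<in> K" if "0 < e" "e \<le> 1" "0 \<le> s" "s \<le> d" for e s
  proof -
    have "\<bar>X e s $ j $ i\<bar> \<le> R" for j i
    proof -
      have "\<bar>e * t\<bar> \<le> R" if "\<bar>t\<bar> \<le> R" for t
        using that \<open>0 < e\<close> \<open>e \<le> 1\<close> mult_mono[of e 1 "\<bar>t\<bar>" R] by (simp add: abs_mult)
      then show ?thesis using uR[OF that(3,4), of i] wR[of i] by (simp add: X_def)
    qed
    then have "- R \<le> X e s $ j $ i \<and> X e s $ j $ i \<le> R" for j i by (metis abs_le_iff minus_le_iff)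
    then have "X e s \<in> cbox (\<chi> j i. - R) (\<chi> j i. R)"
      by (auto simp: mem_box Basis_coord)
    then show ?thesis by (simp add: K_def)
  qed
  obtain B :: "nat \<Rightarrow> real poly" where B:
    "\<forall>v s r. shifted_roots w ((- 1) ^ ?n) v s \<longrightarrow> (\<Sum>l\<in>UNIV. v $ l ^ r) = poly (B r) s"
    "\<forall>r k. coeff (B r) k \<noteq> 0 \<longrightarrow> ?n * k \<le> r"
    "\<forall>k. coeff (B (?n * k)) k = real ?n * (- ((- 1) ^ ?n)) ^ k"
    by (rule power_sum_poly[of w "(- 1) ^ ?n"])
  note B = B[rule_format]
  have "M (?n * k) \<le> C * \<rho> ^ k * N k" if k: "0 < k" for k
  proof -
    \<comment> \<open>The \<open>k\<close> steps fill the fixed interval from 0 to \<open>d\<close>;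
      the resulting \<open>h ^ k * fact k\<close> appears on both sides and cancels.\<close>
    define h where "h = d / real k"
    have h: "0 < h" "0 + real k * h = d" using d(1) k by (simp_all add: h_def)
    \<comment> \<open>The Taylor expansion is cut right after order \<open>?n * k\<close>, so its
      remainder is smaller by one factor \<open>e\<close>.\<close>
    define L where "L = Suc (?n * k)"
    define Q where "Q = real ?n * (4 * 2 ^ L * fact L * M L / fact L * R ^ L)"
    have Q: "0 \<le> Q" using Mpos[of L] R by (simp add: Q_def)
    have main: "real ?n * M (?n * k) * (h ^ k * fact k) \<le> C * \<rho> ^ k * N k * (h ^ k * fact k) + 2 ^ k * Q * e"
      if e: "0 < e" "e \<le> 1" for e
    proof -
      define \<phi> where "\<phi> m s = (e ^ ?n) ^ m * pds (replicate m b) F (Y e + (e ^ ?n * s) *\<^sub>R b)" for m s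
      have rb: "replicate m b \<in> lists Basis" for m using b by (auto simp: in_lists_conv_set)
      have int: "Y e + (e ^ ?n * s) *\<^sub>R b \<in> interior ?A" if "0 \<le> s" "s \<le> d" for s
        using regular_interior[OF regX[OF e(1) that]] thX[OF that, of e] by simp
      have "(\<phi> m has_real_derivative \<phi> (Suc m) t) (at t)" if "0 \<le> t" "t \<le> 0 + real k * h" for m t
        unfolding \<phi>_def
        using DERIV_cmult[OF line_derivative[OF smF int rb b], of t "(e ^ ?n) ^ m" m] that h(2) by (simp add: mult_ac)
      then obtain t where t: "0 \<le> t" "t \<le> d" "fdiff h k (\<phi> 0) 0 = h ^ k * \<phi> k t"
        using fdiff_mean_value[OF h(1), of k 0 \<phi>] h(2) by auto
      have "\<bar>pds (replicate k b) F (Y e + (e ^ ?n * t) *\<^sub>R b)\<bar> \<le> C * \<rho> ^ k * fact k * N k"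
      proof -
        have "G (replicate k b) (theta (X e t)) = pds (replicate k b) F (theta (X e t))"
          using G(1) rb regular_interior[OF regX[OF e(1) t(1,2)]] by blast
        then show ?thesis using C(3)[OF rb inK[OF e t(1,2)], of k] thX[OF t(1,2), of e] by simp
      qed
      then have "(e ^ ?n) ^ k * \<bar>pds (replicate k b) F (Y e + (e ^ ?n * t) *\<^sub>R b)\<bar> \<le> (e ^ ?n) ^ k * (C * \<rho> ^ k * fact k * N k)"
        using e by (intro mult_left_mono) auto
      then have "\<bar>\<phi> k t\<bar> \<le> (e ^ ?n) ^ k * (C * \<rho> ^ k * fact k * N k)"
        using e by (simp add: \<phi>_def abs_mult)
      then have upper: "\<bar>fdiff h k (\<phi> 0) 0\<bar> \<le> h ^ k * ((e ^ ?n) ^ k * (C * \<rho> ^ k * fact k * N k))"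
        unfolding t(3) using h(1) by (simp add: abs_mult mult_left_mono)
      define a where "a r = H r 0 / fact r * e ^ r" for r
      define T where "T s = (\<Sum>r<L. a r * poly (B r) s)" for s
      define E where "E s = \<phi> 0 s - T s" for s
      have E: "\<bar>E s\<bar> \<le> Q * e ^ L" if s: "0 \<le> s" "s \<le> 0 + real k * h" for s
      proof -
        have s': "0 \<le> s" "s \<le> d" using s h(2) by auto
        have "\<phi> 0 s = f (X e s)" using thX[OF s', of e] F(2)[of "X e s"] by (simp add: \<phi>_def)
        also have "\<dots> = (\<Sum>i\<in>UNIV. H 0 (e * u s $ i))" by (simp add: f_def X_def)
        finally have 1: "\<phi> 0 s = (\<Sum>i\<in>UNIV. H 0 (e * u s $ i))" .
        have "shifted_roots w ((- 1) ^ ?n) (u s) s"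
          by (rule root_poly_shift[OF uinj[OF s'] u(2)[OF s'] i0])
        note P = B(1)[OF this]
        have "T s = (\<Sum>r<L. \<Sum>i\<in>UNIV. H r 0 / fact r * (e * u s $ i) ^ r)"
          unfolding T_def a_def P[symmetric] sum_distrib_left power_mult_distrib by (simp only: mult.assoc)
        also have "\<dots> = (\<Sum>i\<in>UNIV. \<Sum>r<L. H r 0 / fact r * (e * u s $ i) ^ r)" by (rule sum.swap)
        finally have 2: "T s = (\<Sum>i\<in>UNIV. \<Sum>r<L. H r 0 / fact r * (e * u s $ i) ^ r)" .
        have "\<bar>H 0 (e * u s $ i) - (\<Sum>r<L. H r 0 / fact r * (e * u s $ i) ^ r)\<bar> \<le> 4 * 2 ^ L * fact L * M L / fact L * R ^ L * e ^ L" for i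
        proof -
          obtain c where c: "H 0 (e * u s $ i) = (\<Sum>r<L. H r 0 / fact r * (e * u s $ i) ^ r) + H L c / fact L * (e * u s $ i) ^ L"
            using Maclaurin_all_le[of H "H 0" "e * u s $ i" L] H(1) by blast
          have "\<bar>H L c / fact L * (e * u s $ i) ^ L\<bar> = \<bar>H L c\<bar> / fact L * (e ^ L * \<bar>u s $ i\<bar> ^ L)"
            using e by (simp add: abs_mult power_mult_distrib power_abs)
          also have "\<dots> \<le> 4 * 2 ^ L * fact L * M L / fact L * (e ^ L * R ^ L)"
            using H(2)[of L c] uR[OF s', of i] e Mpos[of L]
            by (intro mult_mono divide_right_mono mult_left_mono power_mono) (auto simp: less_imp_le)
          finally show ?thesis unfolding c by (simp add: mult_ac)
        qed
        then have "(\<Sum>i\<in>(UNIV :: 'n set). \<bar>H 0 (e * u s $ i) - (\<Sum>r<L. H r 0 / fact r * (e * u s $ i) ^ r)\<bar>) \<le>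
          (\<Sum>i\<in>(UNIV :: 'n set). 4 * 2 ^ L * fact L * M L / fact L * R ^ L * e ^ L)" by (rule sum_mono)
        also have "\<dots> = Q * e ^ L" by (simp add: Q_def)
        finally show ?thesis
          unfolding E_def 1 2 sum_subtractf[symmetric] by (rule order_trans[OF sum_abs])
      qed
      have "fdiff h k T 0 = (\<Sum>r<L. a r * (h ^ k * (fact k * coeff (B r) k)))"
      proof -
        have "degree (B r) \<le> k" if "r < L" for r
        proof (rule degree_le, intro allI impI, rule ccontr)
          fix m assume "k < m" and nz: "coeff (B r) m \<noteq> 0"
          have "?n * m \<le> ?n * k" using B(2)[OF nz] that unfolding L_def by linarith
          then show False using \<open>k < m\<close> by simp
        qed
        then show ?thesis
          unfolding T_def by (simp add: fdiff_sum fdiff_cmult fdiff_poly[OF h(1)])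
      qed
      \<comment> \<open>Below order \<open>?n * k\<close> the power sums have degree less than
        \<open>k\<close> in \<open>s\<close>, so their \<open>k\<close>-th differences
        vanish.\<close>
      also have "\<dots> = (\<Sum>r\<in>{?n * k}. a r * (h ^ k * (fact k * coeff (B r) k)))"
      proof (rule sum.mono_neutral_right)
        show "\<forall>r\<in>{..<L} - {?n * k}. a r * (h ^ k * (fact k * coeff (B r) k)) = 0"
        proof
          fix r assume "r \<in> {..<L} - {?n * k}"
          then have "\<not> ?n * k \<le> r" by (auto simp: L_def)
          then have "coeff (B r) k = 0" using B(2) by blast
          then show "a r * (h ^ k * (fact k * coeff (B r) k)) = 0" by simp
        qed
      qed (auto simp: L_def)
      also have "\<bar>\<dots>\<bar> = \<bar>H (?n * k) 0\<bar> / fact (?n * k) * e ^ (?n * k) * (h ^ k * fact k * ?n)"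
        using e h(1) by (simp add: a_def B(3) abs_mult power_abs)
      finally have Tval: "\<bar>fdiff h k T 0\<bar> = \<bar>H (?n * k) 0\<bar> / fact (?n * k) * e ^ (?n * k) * (h ^ k * fact k * ?n)" .
      have "M (?n * k) \<le> \<bar>H (?n * k) 0\<bar> / fact (?n * k)"
        using H(3)[of "?n * k"] by (simp add: pos_le_divide_eq mult.commute)
      then have "M (?n * k) * e ^ (?n * k) * (h ^ k * fact k * ?n) \<le> \<bar>fdiff h k T 0\<bar>"
        unfolding Tval using e h(1) by (intro mult_right_mono) auto
      also have "fdiff h k T 0 = fdiff h k (\<phi> 0) 0 - fdiff h k E 0"
        using fdiff_add[of h k T E 0] by (simp add: E_def)
      also have "\<bar>\<dots>\<bar> \<le> \<bar>fdiff h k (\<phi> 0) 0\<bar> + \<bar>fdiff h k E 0\<bar>" by (rule abs_triangle_ineq4)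
      also have "\<dots> \<le> h ^ k * ((e ^ ?n) ^ k * (C * \<rho> ^ k * fact k * N k)) + 2 ^ k * (Q * e ^ L)"
        by (rule add_mono[OF upper fdiff_bound[OF less_imp_le[OF h(1)] E]])
      also have "\<dots> = e ^ (?n * k) * (C * \<rho> ^ k * N k * (h ^ k * fact k) + 2 ^ k * Q * e)"
      proof -
        have "(e ^ ?n) ^ k = e ^ (?n * k)" "e ^ L = e ^ (?n * k) * e" by (simp_all only: power_mult L_def power_Suc2)
        then show ?thesis by (simp only: distrib_left mult_ac)
      qed
      finally have "e ^ (?n * k) * (real ?n * M (?n * k) * (h ^ k * fact k)) \<le> e ^ (?n * k) * (C * \<rho> ^ k * N k * (h ^ k * fact k) + 2 ^ k * Q * e)"
        by (simp only: mult_ac)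
      \<comment> \<open>Dividing by \<open>e ^ (?n * k)\<close> leaves an error linear in
        \<open>e\<close>, with \<open>Q\<close> independent of \<open>e\<close>.\<close>
      then show ?thesis using e by (subst (asm) mult_le_cancel_left_pos) auto
    qed
    have "real ?n * M (?n * k) * (h ^ k * fact k) \<le> C * \<rho> ^ k * N k * (h ^ k * fact k)"
      by (rule le_if_le_add_eps[OF _ main]) (use Q in auto)
    then have "real ?n * M (?n * k) \<le> C * \<rho> ^ k * N k"
      using h(1) by (subst (asm) mult_le_cancel_right_pos) auto
    moreover have "1 * M (?n * k) \<le> real ?n * M (?n * k)"
      using Mpos[of "?n * k"] by (intro mult_right_mono) (auto simp: Suc_leI)
    ultimately show ?thesis by simp
  qed
  then show ?thesis using C(1,2) by blast
qed

text \<open>Taking \<open>k\<close>-th roots absorbs the constant, because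
  \<open>C \<le> max 1 C ^ k\<close> for \<open>k > 0\<close>.\<close>

lemma powr_root_bound_iff:
  fixes a :: "nat \<Rightarrow> real"
  assumes pos: "\<And>k. 0 < a k"
  shows "bdd_above {a k powr (1 / real k) | k. k > 0} \<longleftrightarrow> (\<exists>C>0. \<exists>\<rho>>0. \<forall>k>0. a k \<le> C * \<rho> ^ k)"
proof
  assume "bdd_above {a k powr (1 / real k) | k. k > 0}"
  then obtain B where B: "\<And>k. 0 < k \<Longrightarrow> a k powr (1 / real k) \<le> B"
    by (auto simp: bdd_above_def)
  have "a k \<le> 1 * (max 1 B) ^ k" if "0 < k" for k
  proof -
    have "a k = (a k powr (1 / real k)) ^ k"
      using pos[of k] that by (simp add: powr_realpow[symmetric] powr_powr)
    also have "\<dots> \<le> (max 1 B) ^ k" using B[OF that] by (intro power_mono) auto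
    finally show ?thesis by simp
  qed
  then show "\<exists>C>0. \<exists>\<rho>>0. \<forall>k>0. a k \<le> C * \<rho> ^ k"
    by (intro exI[of _ 1] conjI exI[of _ "max 1 B"]) auto
next
  assume "\<exists>C>0. \<exists>\<rho>>0. \<forall>k>0. a k \<le> C * \<rho> ^ k"
  then obtain C \<rho> where C: "0 < C" "0 < \<rho>" "\<And>k. 0 < k \<Longrightarrow> a k \<le> C * \<rho> ^ k" by blast
  have "a k powr (1 / real k) \<le> max 1 C * \<rho>" if "0 < k" for k
  proof -
    have "a k \<le> C * \<rho> ^ k" by (rule C(3)[OF that])
    also have "\<dots> \<le> max 1 C ^ k * \<rho> ^ k"
    proof (rule mult_right_mono)
      have "C \<le> max 1 C" by simp
      also have "\<dots> \<le> max 1 C ^ k" using that by (intro self_le_power) auto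
      finally show "C \<le> max 1 C ^ k" .
    qed (use C(2) in simp)
    also have "\<dots> = (max 1 C * \<rho>) ^ k" by (simp add: power_mult_distrib)
    finally have "a k powr (1 / real k) \<le> ((max 1 C * \<rho>) ^ k) powr (1 / real k)"
      using pos[of k] by (intro powr_mono2) (auto simp: less_imp_le)
    also have "\<dots> = max 1 C * \<rho>"
      using C(2) that by (simp add: powr_realpow[symmetric] powr_powr)
    finally show ?thesis .
  qed
  then show "bdd_above {a k powr (1 / real k) | k. k > 0}" by (auto intro!: bdd_aboveI)
qed

theorem theorem3p3:
  fixes M N :: "nat \<Rightarrow> real"
  assumes Mpos: "\<And>k. M k > 0" and Npos: "\<And>k. N k > 0"
    and Minc: "\<And>k. M k \<le> M (Suc k)" and Ninc: "\<And>k. N k \<le> N (Suc k)"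
    and Mlc: "log_convex M" and Nlc: "log_convex N"
    and M0: "M 0 = 1" and N0: "N 0 = 1"
  shows "(\<forall>f :: real ^ ('n::{finite,linorder}) ^ ('p::finite) \<Rightarrow> real.
            prod_sym_invariant f \<and> CM_on M UNIV f \<longrightarrow>
            (\<exists>F. CN_closed N (range theta) F \<and> (\<forall>x. f x = F (theta x))))
       \<longleftrightarrow> bdd_above {(M (k * CARD('n)) / N k) powr (1 / real k) | k. k > 0}"
proof -
  let ?n = "CARD('n)"
  have pos: "0 < M (k * ?n) / N k" for k using Mpos Npos by simp
  have iff: "bdd_above {(M (k * ?n) / N k) powr (1 / real k) | k. k > 0} \<longleftrightarrow>
      (\<exists>C>0. \<exists>\<rho>>0. \<forall>k>0. M (k * ?n) \<le> C * \<rho> ^ k * N k)"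
    unfolding powr_root_bound_iff[where a = "\<lambda>k. M (k * ?n) / N k", OF pos] using Npos
    by (simp add: pos_divide_le_eq)
  show ?thesis
  proof (rule iffI, goal_cases)
    case 1
    show ?case
      unfolding iff using extension_necessary[OF Mpos Npos Mlc, where ?'n = 'n and ?'p = 'p] 1
      by (simp add: mult.commute[of _ "CARD('n)"])
  next
    case 2
    then obtain C \<rho> where C: "0 < C" "0 < \<rho>" "\<And>k. 0 < k \<Longrightarrow> M (k * ?n) \<le> C * \<rho> ^ k * N k"
      unfolding iff by blast
    have bdd: "M (k * ?n) \<le> (max 1 C * \<rho>) ^ k * N k" for k
    proof (cases "k = 0")
      case True
      \<comment> \<open>Order 0 is outside the supremum and is covered by the normalization.\<close>
      then show ?thesis by (simp add: M0 N0)
    next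
      case False
      have "C \<le> max 1 C" by simp
      also have "\<dots> \<le> max 1 C ^ k" using False by (intro self_le_power) auto
      finally have "C * \<rho> ^ k * N k \<le> max 1 C ^ k * \<rho> ^ k * N k"
        using C(2) Npos[of k] by (intro mult_right_mono) (auto simp: less_imp_le)
      then show ?thesis using C(3)[of k] False by (simp add: power_mult_distrib)
    qed
    show ?case
    proof (intro allI impI, elim conjE)
      fix f :: "('n, 'p) blocks \<Rightarrow> real"
      assume f: "prod_sym_invariant f" "CM_on M UNIV f"
      show "\<exists>F. CN_closed N (range theta) F \<and> (\<forall>x. f x = F (theta x))"
        by (rule extension_exists[OF Mpos Npos Minc bdd _ f]) (use C in auto)
    qed
  qed
qed

end
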